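(* With $q=e^{-\delta}$ and the primary colours specialised as in the context, $$\sum_{(\mu,\nu)\in\mathcal F^{0_{c_{\overline 1}},(-1)_{c_{\overline 1}}}_>}C((\mu,\nu))q^{|(\mu,\nu)|}=e^{-\Lambda_0}\mathrm{ch}(L(\Lambda_0)),$$ and for all $i\in\{1,\dots,n\}$, $$\sum_{(\mu,\nu)\in\mathcal F^{0_{c_{\overline{i+1}}},0_{c_i}}_>}C((\mu,\nu))q^{|(\mu,\nu)|}=e^{-\Lambda_i}\mathrm{ch}(L(\Lambda_i)),$$ with the convention $\overline{n+1}=n$.
   Context: $\mathfrak g$ is the affine Lie algebra of type $C_n^{(1)}$ with simple roots $\alpha_0,\dots,\alpha_n$, fundamental weights $\Lambda_i$, null root $\delta=\alpha_0+2\sum_{j=1}^{n-1}\alpha_j+\alpha_n$; $L(\Lambda)$ the irreducible highest weight module, $\mathrm{ch}$ its character. $\overline{[n]}=\{1,\dots,n,\overline n,\dots,\overline 1\}$ with total order $1<\dots<n<\overline n<\dots<\overline 1$. Primary colours $c_u$, $u\in\overline{[n]}$; primary-coloured integers $k_{c_u}$ ($k\in\mathbb Z$) with order $k_{c_u}\ge l_{c_v}$ iff $k-l\ge\chi(u<v)$, strict order $k_{c_u}>l_{c_v}$ iff $k-l\ge\chi(u\le v)$ ($\chi$ = truth value in $\{0,1\}$); $k_c+1:=(k+1)_c$. For primary-coloured integers $k_c,l_d$ with $l_d\le k_c\le(l+1)_d$, $\mathcal F^{k_c,l_d}_>$ is the set of pairs $(\mu,\nu)$, $\mu=(\mu_0,\dots,\mu_{s-1},\mu_s=k_c)$,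 $\nu=(\nu_0,\dots,\nu_{s-1},\nu_s=l_d)$ ($s\ge0$) of primary-coloured integers with $\mu_0>\mu_1>\dots>\mu_s$, $\nu_0>\dots>\nu_s$, and $\nu_j+1\ge\mu_j\ge\nu_j$ for $j<s$. Its size is $|(\mu,\nu)|=\sum_{j<s}(|\mu_j|+|\nu_j|)$ and colour sequence $C((\mu,\nu))=\prod_{j<s}c(\mu_j)c(\nu_j)$ (the last parts are not counted). Specialisation: $c_j=e^{\frac12\alpha_n+\sum_{u=j}^{n-1}\alpha_u}$ and $c_{\overline j}=c_j^{-1}$ for $j\in\{1,\dots,n\}$. *)

theory Defs
  imports Complex_Main "HOL-Library.Extended_Nat"
begin

section \<open>Lie algebras and their modules\<close>

locale lie_algebra = vector_space scale
  for scale :: "'k::field \<Rightarrow> 'g::ab_group_add \<Rightarrow> 'g" +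
  fixes bracket :: "'g \<Rightarrow> 'g \<Rightarrow> 'g"
  assumes bracket_add_left: "bracket (x + y) z = bracket x z + bracket y z"
    and bracket_add_right: "bracket x (y + z) = bracket x y + bracket x z"
    and bracket_scale_left: "bracket (scale a x) y = scale a (bracket x y)"
    and bracket_scale_right: "bracket x (scale a y) = scale a (bracket x y)"
    and bracket_self: "bracket x x = 0"
    and jacobi: "bracket x (bracket y z) + bracket y (bracket z x) + bracket z (bracket x y) = 0"
begin

definition subalgebra :: "'g set \<Rightarrow> bool" where
  "subalgebra S \<longleftrightarrow> subspace S \<and> (\<forall>x\<in>S. \<forall>y\<in>S. bracket x y \<in> S)"

definition lie_ideal :: "'g set \<Rightarrow> bool" where
  "lie_ideal S \<longleftrightarrow> subspace S \<and> (\<forall>x. \<forall>y\<in>S. bracket x y \<in> S)"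

definition generates :: "'g set \<Rightarrow> bool" where
  "generates X \<longleftrightarrow> (\<forall>S. subalgebra S \<and> X \<subseteq> S \<longrightarrow> S = UNIV)"

end

locale lie_module = lie_algebra scale bracket + V: vector_space scaleV
  for scale :: "'k::field \<Rightarrow> 'g::ab_group_add \<Rightarrow> 'g"
    and bracket :: "'g \<Rightarrow> 'g \<Rightarrow> 'g"
    and scaleV :: "'k \<Rightarrow> 'v::ab_group_add \<Rightarrow> 'v" +
  fixes act :: "'g \<Rightarrow> 'v \<Rightarrow> 'v"
  assumes act_add_left: "act (x + y) v = act x v + act y v"
    and act_scale_left: "act (scale a x) v = scaleV a (act x v)"
    and act_add_right: "act x (v + w) = act x v + act x w"
    and act_scale_right: "act x (scaleV a v) = scaleV a (act x v)"
    and act_bracket: "act (bracket x y) v = act x (act y v) - act y (act x v)"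
begin

definition submodule :: "'v set \<Rightarrow> bool" where
  "submodule W \<longleftrightarrow> V.subspace W \<and> (\<forall>x. \<forall>w\<in>W. act x w \<in> W)"

definition irreducible_module :: bool where
  "irreducible_module \<longleftrightarrow> (\<exists>v::'v. v \<noteq> 0) \<and> (\<forall>W. submodule W \<longrightarrow> W = {0} \<or> W = UNIV)"

end


section \<open>Affine Lie algebras\<close>

definition linear_functional_on ::
    "('k::field \<Rightarrow> 'g::ab_group_add \<Rightarrow> 'g) \<Rightarrow> 'g set \<Rightarrow> ('g \<Rightarrow> 'k) \<Rightarrow> bool" where
  "linear_functional_on scale H \<kappa> \<longleftrightarrow>
     (\<forall>x\<in>H. \<forall>y\<in>H. \<kappa> (x + y) = \<kappa> x + \<kappa> y) \<and> (\<forall>a. \<forall>x\<in>H. \<kappa> (scale a x) = a * \<kappa> x)"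

text \<open>
  The Kac--Moody algebra of an affine generalised Cartan matrix \<open>A\<close> with index set
  \<open>{0..n}\<close>: the simple coroots \<open>h i\<close> and the scaling element \<open>d\<close> form a basis of the Cartan
  subalgebra \<open>H\<close> (so \<open>dim H = n + 2\<close>), and, as in Kac's definition, the Lie algebra is
  generated by \<open>H\<close> and the Chevalley generators and has no nonzero ideal meeting \<open>H\<close> trivially.
  Weights are functions on the whole Lie algebra of which only the values on \<open>H\<close> matter.
\<close>

locale affine_lie_algebra = lie_algebra scale bracket
  for scale :: "complex \<Rightarrow> 'g::ab_group_add \<Rightarrow> 'g"
    and bracket :: "'g \<Rightarrow> 'g \<Rightarrow> 'g" +
  fixes n :: nat
    and A :: "nat \<Rightarrow> nat \<Rightarrow> int"
    and H :: "'g set"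
    and h :: "nat \<Rightarrow> 'g"
    and d :: 'g
    and e f :: "nat \<Rightarrow> 'g"
    and \<alpha> :: "nat \<Rightarrow> 'g \<Rightarrow> complex"
  assumes inj_coroots: "inj_on h {0..n}"
    and d_not_coroot: "d \<notin> h ` {0..n}"
    and independent_cartan: "independent (insert d (h ` {0..n}))"
    and cartan: "H = span (insert d (h ` {0..n}))"
    and root_linear: "j \<le> n \<Longrightarrow> linear_functional_on scale H (\<alpha> j)"
    and root_coroot: "i \<le> n \<Longrightarrow> j \<le> n \<Longrightarrow> \<alpha> j (h i) = of_int (A i j)"
    and root_d: "j \<le> n \<Longrightarrow> \<alpha> j d = of_bool (j = 0)"
    and bracket_H_H: "x \<in> H \<Longrightarrow> y \<in> H \<Longrightarrow> bracket x y = 0"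
    and bracket_e_f: "i \<le> n \<Longrightarrow> j \<le> n \<Longrightarrow> bracket (e i) (f j) = (if i = j then h i else 0)"
    and bracket_H_e: "x \<in> H \<Longrightarrow> i \<le> n \<Longrightarrow> bracket x (e i) = scale (\<alpha> i x) (e i)"
    and bracket_H_f: "x \<in> H \<Longrightarrow> i \<le> n \<Longrightarrow> bracket x (f i) = scale (- \<alpha> i x) (f i)"
    and chevalley_generates: "generates (H \<union> e ` {0..n} \<union> f ` {0..n})"
    and no_ideal: "lie_ideal S \<Longrightarrow> S \<inter> H = {0} \<Longrightarrow> S = {0}"

text \<open>
  The entry at \<open>i, j\<close> is the value of \<open>\<alpha>\<^sub>j\<close> on the \<open>i\<close>-th simple coroot. The long simple roots are
  \<open>\<alpha>\<^sub>0\<close> and \<open>\<alpha>\<^sub>n\<close>. For \<open>n = 1\<close> this is the matrix of \<open>A\<^sub>1\<^sup>(\<^sup>1\<^sup>)\<close>, the usual reading of \<open>C\<^sub>1\<^sup>(\<^sup>1\<^sup>)\<close>.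
\<close>

definition cartan_matrix_C :: "nat \<Rightarrow> nat \<Rightarrow> nat \<Rightarrow> int" where
  "cartan_matrix_C n i j =
     (if i = j then 2
      else if \<not> (i = Suc j \<or> j = Suc i) then 0
      else if (i = 1 \<and> j = 0) \<or> (Suc i = n \<and> j = n) then - 2
      else - 1)"

definition null_root_C :: "nat \<Rightarrow> (nat \<Rightarrow> 'g \<Rightarrow> complex) \<Rightarrow> 'g \<Rightarrow> complex" where
  "null_root_C n \<alpha> x = \<alpha> 0 x + 2 * (\<Sum>j = 1..n - 1. \<alpha> j x) + \<alpha> n x"

definition fundamental_weights ::
    "(complex \<Rightarrow> 'g::ab_group_add \<Rightarrow> 'g) \<Rightarrow> nat \<Rightarrow> 'g set \<Rightarrow> (nat \<Rightarrow> 'g) \<Rightarrow> 'g \<Rightarrow>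
       (nat \<Rightarrow> 'g \<Rightarrow> complex) \<Rightarrow> bool" where
  "fundamental_weights scale n H h d \<Lambda> \<longleftrightarrow>
     (\<forall>i\<le>n. linear_functional_on scale H (\<Lambda> i) \<and>
        (\<forall>j\<le>n. \<Lambda> i (h j) = of_bool (i = j)) \<and> \<Lambda> i d = 0)"


section \<open>Irreducible highest weight modules and characters\<close>

text \<open>\<open>is_L \<dots> scaleV act \<Lambda>\<close>: the module is (a copy of) the irreducible module \<open>L(\<Lambda>)\<close>.\<close>

definition is_L ::
    "(complex \<Rightarrow> 'g::ab_group_add \<Rightarrow> 'g) \<Rightarrow> ('g \<Rightarrow> 'g \<Rightarrow> 'g) \<Rightarrow> nat \<Rightarrow> 'g set \<Rightarrow> (nat \<Rightarrow> 'g) \<Rightarrow>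
     (complex \<Rightarrow> 'v::ab_group_add \<Rightarrow> 'v) \<Rightarrow> ('g \<Rightarrow> 'v \<Rightarrow> 'v) \<Rightarrow> ('g \<Rightarrow> complex) \<Rightarrow> bool" where
  "is_L scale bracket n H e scaleV act \<Lambda> \<longleftrightarrow>
     lie_module scale bracket scaleV act \<and>
     lie_module.irreducible_module scaleV act \<and>
     (\<exists>v. v \<noteq> 0 \<and>
        (\<forall>i\<le>n. act (e i) v = 0) \<and>
        (\<forall>x\<in>H. act x v = scaleV (\<Lambda> x) v) \<and>
        (\<forall>W. lie_module.submodule scaleV act W \<and> v \<in> W \<longrightarrow> W = UNIV))"

definition weight_space ::
    "(complex \<Rightarrow> 'v::ab_group_add \<Rightarrow> 'v) \<Rightarrow> ('g \<Rightarrow> 'v \<Rightarrow> 'v) \<Rightarrow> 'g set \<Rightarrow> ('g \<Rightarrow> complex) \<Rightarrow> 'v set"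
  where "weight_space scaleV act H \<kappa> = {v. \<forall>x\<in>H. act x v = scaleV (\<kappa> x) v}"

text \<open>
  A formal sum of exponentials is represented by its coefficient function on weights.
  The value \<open>\<infinity>\<close> marks an infinite-dimensional weight space, where the library's \<open>dim\<close> would
  be \<open>0\<close>.
\<close>

definition character ::
    "(complex \<Rightarrow> 'v::ab_group_add \<Rightarrow> 'v) \<Rightarrow> ('g \<Rightarrow> 'v \<Rightarrow> 'v) \<Rightarrow> 'g set \<Rightarrow> ('g \<Rightarrow> complex) \<Rightarrow> enat"
  where
  "character scaleV act H \<kappa> =
     (if \<exists>B. finite B \<and> weight_space scaleV act H \<kappa> \<subseteq> module.span scaleV B
      then enat (vector_space.dim scaleV (weight_space scaleV act H \<kappa>))
      else \<infinity>)"

text \<open>Coefficient function of \<open>e\<^bsup>-\<Lambda>\<^esup> X\<close>.\<close>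

definition exp_neg_times ::
    "('g \<Rightarrow> complex) \<Rightarrow> (('g \<Rightarrow> complex) \<Rightarrow> enat) \<Rightarrow> ('g \<Rightarrow> complex) \<Rightarrow> enat" where
  "exp_neg_times \<Lambda> X \<beta> = X (\<lambda>x. \<Lambda> x + \<beta> x)"

text \<open>
  \<open>\<Sum>s\<in>S. e\<^bsup>wt s\<^esup> = X\<close> as formal series: each weight \<open>\<beta>\<close> in the dual of \<open>H\<close> occurs finitely
  often among the \<open>wt s\<close>, and \<open>X \<beta>\<close> counts the occurrences.
\<close>

definition has_formal_sum ::
    "(complex \<Rightarrow> 'g::ab_group_add \<Rightarrow> 'g) \<Rightarrow> 'g set \<Rightarrow> 's set \<Rightarrow> ('s \<Rightarrow> 'g \<Rightarrow> complex) \<Rightarrow>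
     (('g \<Rightarrow> complex) \<Rightarrow> enat) \<Rightarrow> bool" where
  "has_formal_sum scale H S wt X \<longleftrightarrow>
     (\<forall>\<beta>. linear_functional_on scale H \<beta> \<longrightarrow>
        finite {s \<in> S. \<forall>x\<in>H. wt s x = \<beta> x} \<and>
        X \<beta> = enat (card {s \<in> S. \<forall>x\<in>H. wt s x = \<beta> x}))"


section \<open>Primary-coloured integers and pairs of coloured partitions\<close>

datatype letter = Pos nat | Bar nat

fun letter_le :: "letter \<Rightarrow> letter \<Rightarrow> bool" where
  "letter_le (Pos i) (Pos j) \<longleftrightarrow> i \<le> j"
| "letter_le (Pos i) (Bar j) \<longleftrightarrow> True"
| "letter_le (Bar i) (Pos j) \<longleftrightarrow> False"
| "letter_le (Bar i) (Bar j) \<longleftrightarrow> j \<le> i"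

instantiation letter :: linorder
begin

definition less_eq_letter :: "letter \<Rightarrow> letter \<Rightarrow> bool" where
  "u \<le> v \<longleftrightarrow> letter_le u v"

definition less_letter :: "letter \<Rightarrow> letter \<Rightarrow> bool" where
  "u < v \<longleftrightarrow> letter_le u v \<and> \<not> letter_le v u"

instance
proof
  fix u v w :: letter
  show "u < v \<longleftrightarrow> u \<le> v \<and> \<not> v \<le> u"
    by (simp add: less_eq_letter_def less_letter_def)
  show "u \<le> u"
    by (cases u) (simp_all add: less_eq_letter_def)
  show "u \<le> v \<Longrightarrow> v \<le> w \<Longrightarrow> u \<le> w"
    by (cases u; cases v; cases w) (simp_all add: less_eq_letter_def)
  show "u \<le> v \<Longrightarrow> v \<le> u \<Longrightarrow> u = v"
    by (cases u; cases v) (simp_all add: less_eq_letter_def)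
  show "u \<le> v \<or> v \<le> u"
    by (cases u; cases v) (auto simp add: less_eq_letter_def)
qed

end

definition letters :: "nat \<Rightarrow> letter set" where
  "letters n = Pos ` {1..n} \<union> Bar ` {1..n}"

text \<open>The letter \<open>j\<close> barred, with the convention that \<open>n + 1\<close> barred is \<open>n\<close>.\<close>

definition barred :: "nat \<Rightarrow> nat \<Rightarrow> letter" where
  "barred n j = (if j = n + 1 then Pos n else Bar j)"

text \<open>\<open>(k, u)\<close> is the integer \<open>k\<close> with primary colour \<open>c\<^sub>u\<close>; its size is \<open>k\<close>.\<close>

type_synonym coloured_int = "int \<times> letter"

definition col_ge :: "coloured_int \<Rightarrow> coloured_int \<Rightarrow> bool" where
  "col_ge x y \<longleftrightarrow> fst x - fst y \<ge> of_bool (snd x < snd y)"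

definition col_gt :: "coloured_int \<Rightarrow> coloured_int \<Rightarrow> bool" where
  "col_gt x y \<longleftrightarrow> fst x - fst y \<ge> of_bool (snd x \<le> snd y)"

definition col_succ :: "coloured_int \<Rightarrow> coloured_int" where
  "col_succ x = (fst x + 1, snd x)"

definition F_gt :: "nat \<Rightarrow> coloured_int \<Rightarrow> coloured_int \<Rightarrow> (coloured_int list \<times> coloured_int list) set"
  where
  "F_gt n kc ld = {(\<mu>, \<nu>). \<exists>s.
     length \<mu> = Suc s \<and> length \<nu> = Suc s \<and>
     snd ` set \<mu> \<subseteq> letters n \<and> snd ` set \<nu> \<subseteq> letters n \<and>
     \<mu> ! s = kc \<and> \<nu> ! s = ld \<and>
     (\<forall>j<s. col_gt (\<mu> ! j) (\<mu> ! Suc j)) \<and>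
     (\<forall>j<s. col_gt (\<nu> ! j) (\<nu> ! Suc j)) \<and>
     (\<forall>j<s. col_ge (col_succ (\<nu> ! j)) (\<mu> ! j) \<and> col_ge (\<mu> ! j) (\<nu> ! j))}"

text \<open>The final parts of both sequences do not contribute, hence \<open>butlast\<close>.\<close>

definition pair_size :: "coloured_int list \<times> coloured_int list \<Rightarrow> int" where
  "pair_size p = (\<Sum>x\<leftarrow>butlast (fst p). fst x) + (\<Sum>x\<leftarrow>butlast (snd p). fst x)"

text \<open>Monomials in the specialised colours are represented by their exponents.\<close>

fun colour_weight :: "nat \<Rightarrow> (nat \<Rightarrow> 'g \<Rightarrow> complex) \<Rightarrow> letter \<Rightarrow> 'g \<Rightarrow> complex" where
  "colour_weight n \<alpha> (Pos j) x = \<alpha> n x / 2 + (\<Sum>u = j..<n. \<alpha> u x)"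
| "colour_weight n \<alpha> (Bar j) x = - (\<alpha> n x / 2 + (\<Sum>u = j..<n. \<alpha> u x))"

definition colour_sequence_weight ::
    "nat \<Rightarrow> (nat \<Rightarrow> 'g \<Rightarrow> complex) \<Rightarrow> coloured_int list \<times> coloured_int list \<Rightarrow> 'g \<Rightarrow> complex" where
  "colour_sequence_weight n \<alpha> p x =
     (\<Sum>y\<leftarrow>butlast (fst p). colour_weight n \<alpha> (snd y) x) +
     (\<Sum>y\<leftarrow>butlast (snd p). colour_weight n \<alpha> (snd y) x)"

text \<open>Exponent of \<open>C(p) q\<^bsup>|p|\<^esup>\<close> with \<open>q = e\<^bsup>-\<delta>\<^esup>\<close>.\<close>

definition pair_weight ::
    "nat \<Rightarrow> (nat \<Rightarrow> 'g \<Rightarrow> complex) \<Rightarrow> coloured_int list \<times> coloured_int list \<Rightarrow> 'g \<Rightarrow> complex" where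
  "pair_weight n \<alpha> p x = colour_sequence_weight n \<alpha> p x - of_int (pair_size p) * null_root_C n \<alpha> x"

end

theory Submission
  imports Defs "HOL-Library.Function_Algebras"
begin

text \<open>
  Numbering the coloured integer \<open>k\<^sub>u\<close> by \<open>2nk\<close> plus the rank of \<open>u\<close> identifies the pairs of strictly
  decreasing sequences with charge-zero states of a charged fermion, that is with Maya diagrams.
  On the span of Maya diagrams the Chevalley generators of \<open>C\<^sub>n\<^sup>(\<^sup>1\<^sup>)\<close> act by moving single beads, each
  \<open>e\<^sub>j\<close> is the adjoint of \<open>f\<^sub>j\<close> for a positive definite form, and therefore the vacuum generates a copy
  of \<open>L(\<Lambda>\<^sub>i)\<close>. Order the diagrams by the number of particles and then by a convex weight \<open>Phi\<close>.
  The module is annihilated by two raising operators of a commuting affine \<open>sl\<^sub>2\<close>, and this forces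
  the leading term of each of its vectors to satisfy the two interlacing conditions. Conversely,
  applying one root vector for each pair \<open>(\<mu>\<^sub>j, \<nu>\<^sub>j)\<close> to the vacuum gives a vector with leading term
  \<open>(\<mu>, \<nu>)\<close>. So the interlacing pairs index a basis of every weight space.
\<close>

section \<open>Fermions on Maya diagrams\<close>

text \<open>The commuting algebra comes from level-rank duality: C_n^(1) at level 1 and A_1^(1) at
  level n form a dual pair on these fermions, position p being paired with 2n-1-p. In its main part
  one simple raising operator turns a part p of nu into a part p of mu, and the other turns a part p
  of mu into a part p-2n of nu. In a tensor power of the two-dimensional sl_2-module a highest
  weight vector has a ballot word as leading term; this is used once for each operator. A single
  order must serve both operators, so the ratio of the two coefficients in \<open>Phi\<close> has to
  lie strictly between 1 and 2^(2n). The chosen ratio also makes the pairs with 0 <= a-b <= 2n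
  minimal under the affine Weyl group, so the same order gives the root vectors the required leading
  terms. The Lie algebra is known only through its generators, and no action of it on Fock space is
  constructed. Instead the relation \<open>R\<close> pairs Fock vectors with vectors of L(Lambda_i)
  and is closed under the generators. Irreducibility makes it single-valued; adjointness and
  positivity make it injective.\<close>

typedef maya = "{S :: int set. (\<exists>b. \<forall>x<b. x \<in> S) \<and> (\<exists>c. \<forall>x>c. x \<notin> S)}"
  morphisms beads Abs_maya
  by (rule exI[of _ "{x. x < 0}"]) (auto intro: exI[of _ 0])

lemma maya_eqI: "beads S = beads S' \<Longrightarrow> S = S'"
  by (simp add: beads_inject)

lemma maya_lower:
  obtains b where "\<And>x. x < b \<Longrightarrow> x \<in> beads S"
  using beads[of S] by auto

lemma maya_upper:
  obtains c where "\<And>x. x > c \<Longrightarrow> x \<notin> beads S"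
  using beads[of S] by auto

definition ins :: "int \<Rightarrow> maya \<Rightarrow> maya" where
  "ins p S = Abs_maya (insert p (beads S))"

definition del :: "int \<Rightarrow> maya \<Rightarrow> maya" where
  "del p S = Abs_maya (beads S - {p})"

lemma beads_ins [simp]: "beads (ins p S) = insert p (beads S)"
proof -
  obtain b c where "\<forall>x<b. x \<in> beads S" "\<forall>x>c. x \<notin> beads S"
    by (meson maya_lower maya_upper)
  then have "\<forall>x<b. x \<in> insert p (beads S)" "\<forall>x>max c p. x \<notin> insert p (beads S)"
    by auto
  then show ?thesis
    unfolding ins_def by (intro Abs_maya_inverse) blast
qed

lemma beads_del [simp]: "beads (del p S) = beads S - {p}"
proof -
  obtain b c where "\<forall>x<b. x \<in> beads S" "\<forall>x>c. x \<notin> beads S"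
    by (meson maya_lower maya_upper)
  then have "\<forall>x<min b p. x \<in> beads S - {p}" "\<forall>x>c. x \<notin> beads S - {p}"
    by auto
  then show ?thesis
    unfolding del_def by (intro Abs_maya_inverse) blast
qed

lemma finite_beads_above: "finite {x \<in> beads S. P x \<and> p \<le> x}"
proof -
  obtain c where "\<And>x. x > c \<Longrightarrow> x \<notin> beads S" using maya_upper by blast
  then have "{x \<in> beads S. P x \<and> p \<le> x} \<subseteq> {p..c}" by force
  then show ?thesis by (rule finite_subset) simp
qed

lemma finite_holes_below: "finite {x. x \<notin> beads S \<and> P x \<and> x \<le> p}"
proof -
  obtain b where "\<And>x. x < b \<Longrightarrow> x \<in> beads S" using maya_lower by blast
  then have "{x. x \<notin> beads S \<and> P x \<and> x \<le> p} \<subseteq> {b..p}" by force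
  then show ?thesis by (rule finite_subset) simp
qed

section \<open>Creation and annihilation operators\<close>

text \<open>
  Vectors are coefficient functions, so an operator that adds a bead at \<open>p\<close> reads off the
  coefficient of the diagram with \<open>p\<close> removed.
\<close>

type_synonym fock = "maya \<Rightarrow> complex"

text \<open>Jordan-Wigner sign, which makes the operators at different positions anticommute. Beads
  above \<open>p\<close> are counted because there are infinitely many below.\<close>

definition jw_sign :: "int \<Rightarrow> maya \<Rightarrow> complex" where
  "jw_sign p S = (- 1) ^ card {x \<in> beads S. p < x}"

definition cr :: "int \<Rightarrow> fock \<Rightarrow> fock" where
  "cr p w S = (if p \<in> beads S then jw_sign p S * w (del p S) else 0)"

definition an :: "int \<Rightarrow> fock \<Rightarrow> fock" where
  "an p w S = (if p \<in> beads S then 0 else jw_sign p S * w (ins p S))"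

lemma finite_beads_greater: "finite {x \<in> beads S. p < x}"
  by (rule finite_subset[OF _ finite_beads_above[of S "\<lambda>_. True" p]]) auto

lemma jw_sign_del: "q \<in> beads S \<Longrightarrow> jw_sign p (del q S) = (if p < q then - jw_sign p S else jw_sign p S)"
proof (cases "p < q")
  case True
  assume "q \<in> beads S"
  with True have "{x \<in> beads S. p < x} = insert q {x \<in> beads (del q S). p < x}" by auto
  moreover have "finite {x \<in> beads (del q S). p < x}" by (rule finite_beads_greater)
  ultimately show ?thesis using True unfolding jw_sign_def by simp
next
  case False
  then have "{x \<in> beads (del q S). p < x} = {x \<in> beads S. p < x}" by auto
  then show ?thesis using False by (simp add: jw_sign_def)
qed

lemma jw_sign_ins: "q \<notin> beads S \<Longrightarrow> jw_sign p (ins q S) = (if p < q then - jw_sign p S else jw_sign p S)"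
proof (cases "p < q")
  case True
  assume "q \<notin> beads S"
  with True have "{x \<in> beads (ins q S). p < x} = insert q {x \<in> beads S. p < x}" by auto
  moreover have "finite {x \<in> beads S. p < x}" by (rule finite_beads_greater)
  ultimately show ?thesis using True \<open>q \<notin> beads S\<close> unfolding jw_sign_def by simp
next
  case False
  then have "{x \<in> beads (ins q S). p < x} = {x \<in> beads S. p < x}" by auto
  then show ?thesis using False by (simp add: jw_sign_def)
qed

lemma jw_sign_sq: "jw_sign p S * jw_sign p S = 1"
  by (simp add: jw_sign_def flip: power_mult_distrib)

lemma del_commute: "del p (del q S) = del q (del p S)"
  by (rule maya_eqI) auto

lemma ins_commute: "ins p (ins q S) = ins q (ins p S)"
  by (rule maya_eqI) auto

lemma ins_del_commute: "p \<noteq> q \<Longrightarrow> ins p (del q S) = del q (ins p S)"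
  by (rule maya_eqI) auto

lemma ins_del [simp]: "p \<in> beads S \<Longrightarrow> ins p (del p S) = S"
  by (rule maya_eqI) auto

lemma del_ins [simp]: "p \<notin> beads S \<Longrightarrow> del p (ins p S) = S"
  by (rule maya_eqI) auto

lemma cr_cr: "cr p (cr q w) = - cr q (cr p w)"
proof
  fix S show "cr p (cr q w) S = (- cr q (cr p w)) S"
    by (cases "p \<in> beads S"; cases "q \<in> beads S"; cases p q rule: linorder_cases)
      (simp_all add: cr_def jw_sign_del del_commute[of p q])
qed

lemma an_an: "an p (an q w) = - an q (an p w)"
proof
  fix S show "an p (an q w) S = (- an q (an p w)) S"
    by (cases "p \<in> beads S"; cases "q \<in> beads S"; cases p q rule: linorder_cases)
      (simp_all add: an_def jw_sign_ins ins_commute[of p q])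
qed

lemma an_cr: "an p (cr q w) = (if p = q then w else 0) - cr q (an p w)"
proof
  fix S show "an p (cr q w) S = ((if p = q then w else 0) - cr q (an p w)) S"
    by (cases "p \<in> beads S"; cases "q \<in> beads S"; cases p q rule: linorder_cases)
      (simp_all add: an_def cr_def jw_sign_ins jw_sign_del ins_del_commute jw_sign_sq flip: mult.assoc)
qed

lemma cr_linear: "cr p (u + v) = cr p u + cr p v" "cr p (u - v) = cr p u - cr p v"
  "cr p (- u) = - cr p u" "cr p 0 = 0"
  by (auto simp: cr_def fun_eq_iff algebra_simps)

lemma an_linear: "an p (u + v) = an p u + an p v" "an p (u - v) = an p u - an p v"
  "an p (- u) = - an p u" "an p 0 = 0"
  by (auto simp: an_def fun_eq_iff algebra_simps)

section \<open>Bilinear operators: single bead moves and their infinite sums\<close>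

definition hop :: "int \<Rightarrow> int \<Rightarrow> fock \<Rightarrow> fock" where
  "hop p q w = cr p (an q w)"

text \<open>These are the relations of matrix units. Both products contain the same quartic term
  once the annihilators stand on the right, so only the contractions survive in the
  difference.\<close>

lemma hop_hop:
  "hop a b (hop c d w) - hop c d (hop a b w)
     = (if b = c then hop a d w else 0) - (if d = a then hop c b w else 0)"
proof -
  have 1: "hop a b (hop c d w) = (if b = c then hop a d w else 0) - cr a (cr c (an b (an d w)))"
    for a b c d w
    unfolding hop_def an_cr by (auto simp: cr_linear)
  have "cr a (cr c (an b (an d w))) = cr c (cr a (an d (an b w)))"
    by (subst cr_cr, subst an_an) (simp add: cr_linear)
  then show ?thesis unfolding 1[of a b c d] 1[of c d a b] by simp
qed

text \<open>A bilinear acts as a derivation on products of creators: it replaces each creator with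
  which its annihilator contracts.\<close>

lemma hop_cr_cr:
  "hop a b (cr c (cr d w)) - cr c (cr d (hop a b w))
     = (if b = c then cr a (cr d w) else 0) + (if b = d then cr c (cr a w) else 0)"
proof -
  have "cr a (cr c (cr d (an b w))) = cr c (cr d (cr a (an b w)))"
    by (subst cr_cr) (simp add: cr_linear cr_cr[of a d])
  moreover have "cr a (cr c w) = - cr c (cr a w)" by (rule cr_cr)
  ultimately show ?thesis
    unfolding hop_def an_cr by (auto simp: cr_linear an_cr)
qed

lemma hop_at:
  assumes "p \<noteq> q"
  shows "hop p q w S = (if p \<in> beads S \<and> q \<notin> beads S
     then jw_sign p S * jw_sign q (del p S) * w (ins q (del p S)) else 0)"
  using assms by (auto simp: hop_def cr_def an_def)

text \<open>A move between neighbours jumps over no bead, so its two Jordan-Wigner signs cancel.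
  This is why the Chevalley generators carry no signs.\<close>

lemma hop_up: "hop (p + 1) p w S = (if p + 1 \<in> beads S \<and> p \<notin> beads S then w (ins p (del (p + 1) S)) else 0)"
proof -
  have "{x \<in> beads (del (p + 1) S). p < x} = {x \<in> beads S. p + 1 < x}" by auto
  then have "jw_sign p (del (p + 1) S) = jw_sign (p + 1) S" by (simp add: jw_sign_def)
  then show ?thesis by (simp add: hop_at jw_sign_sq)
qed

lemma hop_down: "hop p (p + 1) w S = (if p \<in> beads S \<and> p + 1 \<notin> beads S then w (ins (p + 1) (del p S)) else 0)"
proof (cases "p \<in> beads S \<and> p + 1 \<notin> beads S")
  case True
  then have "{x \<in> beads (del p S). p + 1 < x} = {x \<in> beads S. p < x}"
  proof (intro set_eqI iffI; clarify)
    fix x assume "x \<in> beads S" "p < x"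
    moreover from this True have "x \<noteq> p + 1" by auto
    ultimately show "x \<in> beads (del p S) \<and> p + 1 < x" by auto
  qed auto
  then have "jw_sign (p + 1) (del p S) = jw_sign p S" by (simp add: jw_sign_def)
  then show ?thesis by (simp add: hop_at jw_sign_sq)
qed (auto simp: hop_at)

lemma hop_same: "hop p p w S = (if p \<in> beads S then w S else 0)"
  by (auto simp: hop_def cr_def an_def jw_sign_del jw_sign_sq mult.assoc[symmetric])

text \<open>
  The operator \<open>\<Sum>p. g p \<psi>\<^sub>p\<^sub>+\<^sub>k \<psi>\<^sub>p\<^sup>*\<close>; for \<open>k \<noteq> 0\<close> only finitely many terms contribute to each coefficient.
\<close>

definition shift_op :: "int \<Rightarrow> (int \<Rightarrow> complex) \<Rightarrow> fock \<Rightarrow> fock" where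
  "shift_op k g w S = (\<Sum>p | p \<notin> beads S \<and> p + k \<in> beads S. g p * hop (p + k) p w S)"

lemma finite_shift_range: "finite {p. p \<notin> beads S \<and> p + k \<in> beads S}"
proof -
  obtain b c where "\<And>x. x < b \<Longrightarrow> x \<in> beads S" "\<And>x. x > c \<Longrightarrow> x \<notin> beads S"
    using maya_lower maya_upper by metis
  then have "{p. p \<notin> beads S \<and> p + k \<in> beads S} \<subseteq> {b..c-k}" by force
  then show ?thesis by (rule finite_subset) simp
qed

lemma shift_op_eq_sum:
  assumes "k \<noteq> 0" "finite I" "\<And>p. p \<notin> beads S \<Longrightarrow> p + k \<in> beads S \<Longrightarrow> p \<in> I"
  shows "shift_op k g w S = (\<Sum>p\<in>I. g p * hop (p + k) p w S)"
  unfolding shift_op_def using assms by (intro sum.mono_neutral_left) (auto simp: hop_at)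

text \<open>A window outside which all occupations are known. It lets the infinite sums in a
  commutator be replaced by sums over one common finite index set.\<close>

definition confined :: "int \<Rightarrow> int \<Rightarrow> maya \<Rightarrow> bool" where
  "confined b c S \<longleftrightarrow> (\<forall>x<b. x \<in> beads S) \<and> (\<forall>x>c. x \<notin> beads S)"

lemma ex_confined: obtains b c where "confined b c S"
  by (metis maya_lower maya_upper confined_def)

lemma confinedD:
  assumes "confined b c S"
  shows "x \<notin> beads S \<Longrightarrow> b \<le> x" and "x \<in> beads S \<Longrightarrow> x \<le> c"
  using assms by (auto simp: confined_def not_le[symmetric])

lemma hop_range:
  assumes "confined b c S" "k \<noteq> 0" "hop (p + k) p w S \<noteq> 0"
  shows "p \<in> {b..c-k}"
proof -
  from assms have "p \<notin> beads S" "p + k \<in> beads S" by (auto simp: hop_at split: if_splits)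
  with confinedD[OF assms(1)] show ?thesis by (auto simp: algebra_simps)
qed

lemma shift_op_window:
  assumes "confined b c S" "k \<noteq> 0" "finite I" "{b..c-k} \<subseteq> I"
  shows "shift_op k g w S = (\<Sum>p\<in>I. g p * hop (p + k) p w S)"
proof (rule shift_op_eq_sum[OF assms(2,3)])
  fix p assume "p \<notin> beads S" "p + k \<in> beads S"
  with confinedD[OF assms(1)] have "b \<le> p" "p + k \<le> c" by auto
  with assms(4) show "p \<in> I" by auto
qed

text \<open>The intermediate diagram differs from \<open>S\<close> only at the two ends of the first
  move, so an index set widened by the lengths of both moves covers both summations.\<close>

lemma shift_op_shift_op:
  assumes S: "confined b c S" and kl: "k \<noteq> 0" "l \<noteq> 0"
    and I: "finite I" "{b-\<bar>k\<bar>-\<bar>l\<bar>..c+\<bar>k\<bar>+\<bar>l\<bar>} \<subseteq> I"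
  shows "shift_op k f (shift_op l g w) S
     = (\<Sum>p\<in>I. \<Sum>q\<in>I. f p * g q * hop (p + k) p (hop (q + l) q w) S)"
proof -
  have "hop (p + k) p (shift_op l g w) S = (\<Sum>q\<in>I. g q * hop (p + k) p (hop (q + l) q w) S)" for p
  proof (cases "p + k \<in> beads S \<and> p \<notin> beads S")
    case True
    define S' where "S' = ins p (del (p + k) S)"
    have "b \<le> p" "p + k \<le> c" using True confinedD[OF S] by auto
    have "shift_op l g w S' = (\<Sum>q\<in>I. g q * hop (q + l) q w S')"
    proof (rule shift_op_eq_sum[OF kl(2) I(1)])
      fix q assume "q \<notin> beads S'" "q + l \<in> beads S'"
      then have "q \<notin> beads S \<or> q = p + k" "q + l \<in> beads S \<or> q + l = p"
        by (auto simp: S'_def)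
      then have "b \<le> q \<or> q = p + k" "q + l \<le> c \<or> q + l = p" using confinedD[OF S] by auto
      with \<open>b \<le> p\<close> \<open>p + k \<le> c\<close> have "q \<in> {b-\<bar>k\<bar>-\<bar>l\<bar>..c+\<bar>k\<bar>+\<bar>l\<bar>}" by auto
      with I(2) show "q \<in> I" by blast
    qed
    then show ?thesis using True kl(1)
      by (simp add: hop_at S'_def sum_distrib_left algebra_simps)
  qed (use kl(1) in \<open>auto simp: hop_at\<close>)
  moreover have "{b..c-k} \<subseteq> I" using I(2) by force
  ultimately show ?thesis using shift_op_window[OF S kl(1) I(1), of f "shift_op l g w"]
    by (simp add: sum_distrib_left algebra_simps)
qed

lemma shift_op_commutator_sum:
  assumes S: "confined b c S" and kl: "k \<noteq> 0" "l \<noteq> 0"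
    and I: "finite I" "{b-\<bar>k\<bar>-\<bar>l\<bar>..c+\<bar>k\<bar>+\<bar>l\<bar>} \<subseteq> I"
  shows "shift_op k f (shift_op l g w) S - shift_op l g (shift_op k f w) S
     = (\<Sum>q\<in>I. if q + l \<in> I then f (q + l) * g q * hop (q + (k + l)) q w S else 0)
       - (\<Sum>p\<in>I. if p + k \<in> I then f p * g (p + k) * hop (p + (k + l)) p w S else 0)"
proof -
  have distrib: "x * ((if P then u else 0) - (if Q then v else 0)) S
      = (if P then x * u S else 0) - (if Q then x * v S else (0::complex))" for x P Q and u v :: fock
    by (simp add: algebra_simps)
  have I': "{b-\<bar>l\<bar>-\<bar>k\<bar>..c+\<bar>l\<bar>+\<bar>k\<bar>} \<subseteq> I" using I(2) by (simp add: algebra_simps)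
  have "shift_op k f (shift_op l g w) S - shift_op l g (shift_op k f w) S
    = (\<Sum>p\<in>I. \<Sum>q\<in>I. f p * g q * (hop (p + k) p (hop (q + l) q w) - hop (q + l) q (hop (p + k) p w)) S)"
    unfolding shift_op_shift_op[OF S kl I] shift_op_shift_op[OF S kl(2,1) I(1) I']
    by (subst (2) sum.swap) (simp add: sum_subtractf[symmetric] algebra_simps)
  also have "\<dots> = (\<Sum>p\<in>I. \<Sum>q\<in>I. (if p = q + l then f p * g q * hop (p + k) q w S else 0)
        - (if q = p + k then f p * g q * hop (q + l) p w S else 0))"
    unfolding hop_hop distrib ..
  also have "\<dots> = (\<Sum>q\<in>I. \<Sum>p\<in>I. if p = q + l then f p * g q * hop (p + k) q w S else 0)
      - (\<Sum>p\<in>I. \<Sum>q\<in>I. if q = p + k then f p * g q * hop (q + l) p w S else 0)"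
    unfolding sum_subtractf by (subst sum.swap) simp
  finally show ?thesis using I(1) by (simp add: sum.delta add.commute add.left_commute cong: if_cong)
qed

text \<open>For nonzero total shift each of the two contraction sums is finite at a given diagram,
  so the commutator is the one of matrix units without a central term.\<close>

lemma shift_op_commutator:
  assumes "k \<noteq> 0" "l \<noteq> 0" "k + l \<noteq> 0"
  shows "shift_op k f (shift_op l g w) - shift_op l g (shift_op k f w)
     = shift_op (k + l) (\<lambda>p. f (p + l) * g p - f p * g (p + k)) w"
proof
  fix S
  obtain b c where S: "confined b c S" by (rule ex_confined)
  define I where "I = {b-\<bar>k\<bar>-\<bar>l\<bar>..c+\<bar>k\<bar>+\<bar>l\<bar>}"
  have fin: "finite I" by (simp add: I_def)
  have *: "hop (q + (k + l)) q w S = 0" if "q + l \<notin> I \<or> q + k \<notin> I" for q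
    using hop_range[OF S assms(3), of q w] that unfolding I_def by fastforce
  have "(shift_op k f (shift_op l g w) - shift_op l g (shift_op k f w)) S
    = (\<Sum>q\<in>I. if q + l \<in> I then f (q + l) * g q * hop (q + (k + l)) q w S else 0)
       - (\<Sum>p\<in>I. if p + k \<in> I then f p * g (p + k) * hop (p + (k + l)) p w S else 0)"
    using shift_op_commutator_sum[OF S assms(1,2) fin] by (simp add: I_def)
  also have "\<dots> = (\<Sum>q\<in>I. f (q + l) * g q * hop (q + (k + l)) q w S)
       - (\<Sum>p\<in>I. f p * g (p + k) * hop (p + (k + l)) p w S)"
    using * by (intro arg_cong2[where f="(-)"] sum.cong refl) auto
  also have "\<dots> = shift_op (k + l) (\<lambda>p. f (p + l) * g p - f p * g (p + k)) w S"
    by (subst shift_op_window[OF S assms(3) fin]) (auto simp: I_def sum_subtractf[symmetric] algebra_simps)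
  finally show "(shift_op k f (shift_op l g w) - shift_op l g (shift_op k f w)) S
     = shift_op (k + l) (\<lambda>p. f (p + l) * g p - f p * g (p + k)) w S" .
qed

lemma shift_op_linear:
  "shift_op k g (u + v) = shift_op k g u + shift_op k g v"
  "shift_op k g (\<lambda>S. a * u S) = (\<lambda>S. a * shift_op k g u S)"
  "shift_op k (\<lambda>p. a * g p) u = (\<lambda>S. a * shift_op k g u S)"
  "shift_op k (\<lambda>p. g p + g' p) u = shift_op k g u + shift_op k g' u"
proof -
  have 1: "hop p q (u + v) S = hop p q u S + hop p q v S" for p q S
    by (simp add: hop_def cr_linear an_linear)
  have 2: "hop p q (\<lambda>S. a * u S) S = a * hop p q u S" for p q S
    by (simp add: hop_def cr_def an_def)
  show "shift_op k g (u + v) = shift_op k g u + shift_op k g v"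
    by (simp add: fun_eq_iff shift_op_def 1 sum.distrib algebra_simps)
  show "shift_op k g (\<lambda>S. a * u S) = (\<lambda>S. a * shift_op k g u S)"
    by (simp add: fun_eq_iff shift_op_def 2 sum_distrib_left algebra_simps)
  show "shift_op k (\<lambda>p. a * g p) u = (\<lambda>S. a * shift_op k g u S)"
    by (simp add: fun_eq_iff shift_op_def sum_distrib_left algebra_simps)
  show "shift_op k (\<lambda>p. g p + g' p) u = shift_op k g u + shift_op k g' u"
    by (simp add: fun_eq_iff shift_op_def sum.distrib algebra_simps)
qed

text \<open>For opposite shifts the two contraction sums are diagonal and diverge separately over
  the filled positions. Subtracted term by term they vanish outside the window; the central term of
  the affine algebra is hidden in this regularisation.\<close>

lemma shift_op_commutator_diag:
  assumes "confined b c S"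
  shows "shift_op (-1) f (shift_op 1 (\<lambda>p. g (p + 1)) w) S - shift_op 1 (\<lambda>p. g (p + 1)) (shift_op (-1) f w) S
     = (\<Sum>q\<in>{b-2..<c+2}. f (q + 1) * g (q + 1) * (of_bool (q \<in> beads S) - of_bool (q + 1 \<in> beads S))) * w S"
proof -
  define I where "I = {b-2..c+2}"
  have fin: "finite I" by (simp add: I_def)
  have "shift_op (-1) f (shift_op 1 (\<lambda>p. g (p + 1)) w) S - shift_op 1 (\<lambda>p. g (p + 1)) (shift_op (-1) f w) S
    = (\<Sum>q\<in>I. if q + 1 \<in> I then f (q + 1) * g (q + 1) * hop q q w S else 0)
       - (\<Sum>p\<in>I. if p - 1 \<in> I then f p * g p * hop p p w S else 0)"
    using shift_op_commutator_sum[OF assms, of "-1" 1 I f "\<lambda>p. g (p + 1)" w] fin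
    by (simp add: I_def cong: if_cong)
  also have "(\<Sum>p\<in>I. if p - 1 \<in> I then f p * g p * hop p p w S else 0)
      = (\<Sum>p\<in>{b-1..c+2}. f p * g p * hop p p w S)"
    unfolding I_def by (subst sum.inter_filter[symmetric]) (auto intro!: sum.cong)
  also have "\<dots> = (\<Sum>q\<in>{b-2..<c+2}. f (q + 1) * g (q + 1) * hop (q + 1) (q + 1) w S)"
    by (rule sum.reindex_bij_witness[of _ "\<lambda>q. q + 1" "\<lambda>q. q - 1"]) auto
  also have "(\<Sum>q\<in>I. if q + 1 \<in> I then f (q + 1) * g (q + 1) * hop q q w S else 0)
      = (\<Sum>q\<in>{b-2..<c+2}. f (q + 1) * g (q + 1) * hop q q w S)"
    unfolding I_def by (subst sum.inter_filter[symmetric]) (auto intro!: sum.cong)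
  finally show ?thesis
    by (simp add: sum_subtractf[symmetric] sum_distrib_right)
       (intro sum.cong refl; simp add: hop_same algebra_simps)
qed

section \<open>The Chevalley generators on the Fock space\<close>

definition particles :: "int \<Rightarrow> maya \<Rightarrow> int set" where
  "particles c S = {x \<in> beads S. c \<le> x}"

definition holes :: "int \<Rightarrow> maya \<Rightarrow> int set" where
  "holes c S = {x. x \<notin> beads S \<and> x < c}"

lemma finite_particles [simp]: "finite (particles c S)"
  unfolding particles_def by (rule finite_subset[OF _ finite_beads_above[of S "\<lambda>_. True" c]]) auto

lemma finite_holes [simp]: "finite (holes c S)"
  unfolding holes_def by (rule finite_subset[OF _ finite_holes_below[of S "\<lambda>_. True" c]]) auto

text \<open>The normal-ordered form of the divergent sum of \<open>\<phi>\<close> over all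
  beads.\<close>

definition excess :: "int \<Rightarrow> (int \<Rightarrow> complex) \<Rightarrow> maya \<Rightarrow> complex" where
  "excess c \<phi> S = sum \<phi> (particles c S) - sum \<phi> (holes c S)"

lemma excess_ins: "p \<notin> beads S \<Longrightarrow> excess c \<phi> (ins p S) = excess c \<phi> S + \<phi> p"
proof (cases "c \<le> p")
  case True
  assume p: "p \<notin> beads S"
  with True have "particles c (ins p S) = insert p (particles c S)" "holes c (ins p S) = holes c S"
    "p \<notin> particles c S"
    by (auto simp: particles_def holes_def)
  then show ?thesis by (simp add: excess_def)
next
  case False
  assume p: "p \<notin> beads S"
  with False have "particles c (ins p S) = particles c S" "holes c S = insert p (holes c (ins p S))"
    "p \<notin> holes c (ins p S)"
    by (auto simp: particles_def holes_def)
  then show ?thesis by (simp add: excess_def)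
qed

lemma excess_del: "p \<in> beads S \<Longrightarrow> excess c \<phi> (del p S) = excess c \<phi> S - \<phi> p"
  using excess_ins[of p "del p S" c \<phi>] by (simp add: algebra_simps)

lemma excess_move:
  "p \<in> beads S \<Longrightarrow> q \<notin> beads S \<Longrightarrow> excess c \<phi> (ins q (del p S)) = excess c \<phi> S - \<phi> p + \<phi> q"
  by (simp add: excess_ins excess_del)

definition sea :: "int \<Rightarrow> maya" where
  "sea c = Abs_maya {x. x < c}"

lemma beads_sea [simp]: "beads (sea c) = {x. x < c}"
  unfolding sea_def by (rule Abs_maya_inverse) (auto intro: exI[of _ c])

lemma particles_sea [simp]: "particles c (sea c) = {}"
  and holes_sea [simp]: "holes c (sea c) = {}"
  by (auto simp: particles_def holes_def)

lemma excess_sea [simp]: "excess c \<phi> (sea c) = 0"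
  by (simp add: excess_def)

lemma sum_of_bool_mult: "finite W \<Longrightarrow> A \<subseteq> W \<Longrightarrow> (\<Sum>q\<in>W. f q * of_bool (q \<in> A)) = (sum f A :: complex)"
  by (subst sum.mono_neutral_cong_right[where S = A]) auto

text \<open>Summation by parts. The boundary term \<open>\<phi> m\<close> is the value on the sea
  filled below \<open>m\<close>; it later supplies the value of Lambda_i on the coroots.\<close>

lemma telescope_excess:
  assumes S: "confined b c S" and cut: "b \<le> m" "m \<le> c"
  shows "(\<Sum>q\<in>{b-2..<c+2}. \<phi> (q + 1) * (of_bool (q \<in> beads S) - of_bool (q + 1 \<in> beads S)))
     = \<phi> m + excess m (\<lambda>p. \<phi> (p + 1) - \<phi> p) S"
proof -
  define W where "W = {b-2..<c+2}"
  have W [simp]: "finite W" by (simp add: W_def)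
  have ph: "particles m S \<subseteq> {b..c}" "holes m S \<subseteq> {b..c}"
    using confinedD[OF S] cut by (force simp: particles_def holes_def)+
  have occ: "of_bool (q \<in> beads S) = of_bool (q < m) + of_bool (q \<in> particles m S) - (of_bool (q \<in> holes m S) :: complex)" for q
    by (auto simp: particles_def holes_def)
  have shift: "(\<Sum>q\<in>W. \<phi> (q + 1) * of_bool (q + 1 \<in> A)) = sum \<phi> A" if "A \<subseteq> {b..c}" for A
  proof -
    have "(\<Sum>q\<in>W. \<phi> (q + 1) * of_bool (q + 1 \<in> A)) = (\<Sum>q\<in>{b-1..<c+3}. \<phi> q * of_bool (q \<in> A))"
      unfolding W_def by (rule sum.reindex_bij_witness[of _ "\<lambda>q. q - 1" "\<lambda>q. q + 1"]) auto
    also have "\<dots> = sum \<phi> A" using that by (intro sum_of_bool_mult) auto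
    finally show ?thesis .
  qed
  have "(\<Sum>q\<in>W. \<phi> (q + 1) * (of_bool (q \<in> beads S) - of_bool (q + 1 \<in> beads S)))
     = (\<Sum>q\<in>W. \<phi> (q + 1) * (of_bool (q < m) - of_bool (q + 1 < m)))
     + (\<Sum>q\<in>W. \<phi> (q + 1) * of_bool (q \<in> particles m S)) - (\<Sum>q\<in>W. \<phi> (q + 1) * of_bool (q + 1 \<in> particles m S))
     - (\<Sum>q\<in>W. \<phi> (q + 1) * of_bool (q \<in> holes m S)) + (\<Sum>q\<in>W. \<phi> (q + 1) * of_bool (q + 1 \<in> holes m S))"
    unfolding occ by (simp add: algebra_simps sum.distrib sum_subtractf)
  also have "(\<Sum>q\<in>W. \<phi> (q + 1) * (of_bool (q < m) - of_bool (q + 1 < m))) = (\<Sum>q\<in>W. if q = m - 1 then \<phi> m else 0)"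
    by (intro sum.cong refl) (auto simp: of_bool_def)
  also have "\<dots> = \<phi> m" using cut by (auto simp: W_def)
  also have "(\<Sum>q\<in>W. \<phi> (q + 1) * of_bool (q \<in> particles m S)) = (\<Sum>q\<in>particles m S. \<phi> (q + 1))"
    using ph by (intro sum_of_bool_mult) (auto simp: W_def)
  also have "(\<Sum>q\<in>W. \<phi> (q + 1) * of_bool (q \<in> holes m S)) = (\<Sum>q\<in>holes m S. \<phi> (q + 1))"
    using ph by (intro sum_of_bool_mult) (auto simp: W_def)
  finally show ?thesis using shift[OF ph(1)] shift[OF ph(2)]
    by (simp add: W_def excess_def sum_subtractf)
qed

lemma ex_confined_around: obtains b c where "confined b c S" "b \<le> m" "m \<le> c"
proof -
  obtain b c where "confined b c S" by (rule ex_confined)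
  then have "confined (min b m) (max c m) S" by (auto simp: confined_def)
  with that show ?thesis by (metis max.cobounded2 min.cobounded2)
qed

section \<open>Folding the residue classes modulo 2n\<close>

locale C_fock =
  fixes n :: nat
  assumes n_pos: "1 \<le> n"
begin

abbreviation per :: int where
  "per \<equiv> 2 * int n"

text \<open>
  Folding \<open>A\<^bsub>2n-1\<^esub>\<^sup>(\<^sup>1\<^sup>)\<close> to \<open>C\<^sub>n\<^sup>(\<^sup>1\<^sup>)\<close>: the \<open>j\<close>-th generator moves beads into positions congruent to \<open>j\<close> or \<open>-j\<close>.
\<close>

definition resid :: "nat \<Rightarrow> int \<Rightarrow> bool" where
  "resid j p \<longleftrightarrow> per dvd p - int j \<or> per dvd p + int j"

abbreviation chi :: "nat \<Rightarrow> int \<Rightarrow> complex" where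
  "chi j p \<equiv> of_bool (resid j p)"

lemma resid_cong:
  assumes "per dvd p - q"
  shows "resid j p \<longleftrightarrow> resid j q"
proof -
  have "p - x = (p - q) + (q - x)" "p + x = (p - q) + (q + x)" for x by simp_all
  then show ?thesis unfolding resid_def using assms by (metis dvd_add_right_iff)
qed

lemma resid_periodic: "resid j (p + per * m) \<longleftrightarrow> resid j p"
  by (rule resid_cong) simp

lemma resid_uminus: "resid j (- p) \<longleftrightarrow> resid j p"
proof -
  have "- p - x = - (p + x)" "- p + x = - (p - x)" for x by simp_all
  then show ?thesis unfolding resid_def by (metis dvd_minus_iff)
qed

lemma resid_reflect: "resid j (per * m - p) \<longleftrightarrow> resid j p"
  using resid_periodic[of j "- p" m] by (simp add: resid_uminus algebra_simps)

text \<open>With \<open>ex_resid\<close> this makes the classes of j and -j, for j from 0 to n, a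
  partition of the integers: exactly one generator moves a bead into a given position.\<close>

lemma resid_unique:
  assumes "resid i p" "resid j p" "i \<le> n" "j \<le> n"
  shows "i = j"
proof -
  have *: "per dvd x \<Longrightarrow> \<bar>x\<bar> < per \<Longrightarrow> x = 0" for x
    using dvd_imp_le_int[of x "per"] by force
  have **: "per dvd int i + int j \<Longrightarrow> i = j"
  proof (cases "i = n \<and> j = n")
    case False
    assume d: "per dvd int i + int j"
    have "int i + int j < per" using False assms(3,4) by auto
    with *[OF d] have "int i + int j = 0" by simp
    then show ?thesis by simp
  qed auto
  have ***: "per dvd int i - int j \<Longrightarrow> i = j" "per dvd int j - int i \<Longrightarrow> i = j"
    using *[of "int i - int j"] *[of "int j - int i"] assms(3,4) n_pos by auto
  from assms(1,2) consider "per dvd p - int i" "per dvd p - int j"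
    | "per dvd p - int i" "per dvd p + int j"
    | "per dvd p + int i" "per dvd p - int j"
    | "per dvd p + int i" "per dvd p + int j"
    unfolding resid_def by blast
  then show ?thesis
  proof cases
    case 1 then have "per dvd (p - int j) - (p - int i)" by (rule dvd_diff[rotated])
    then show ?thesis using *** by simp
  next
    case 2 then have "per dvd (p + int j) - (p - int i)" by (rule dvd_diff[rotated])
    then show ?thesis using ** by (simp add: add.commute)
  next
    case 3 then have "per dvd (p + int i) - (p - int j)" by (rule dvd_diff)
    then show ?thesis using ** by (simp add: add.commute)
  next
    case 4 then have "per dvd (p + int i) - (p + int j)" by (rule dvd_diff)
    then show ?thesis using *** by simp
  qed
qed

lemma ex_resid: "\<exists>j\<le>n. resid j p"
proof -
  define r where "r = p mod per"
  have r: "0 \<le> r" "r < per" using n_pos by (auto simp: r_def)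
  have d: "per dvd p - r" by (simp add: r_def)
  show ?thesis
  proof (cases "r \<le> int n")
    case True
    then show ?thesis using d r by (intro exI[of _ "nat r"]) (auto simp: resid_def)
  next
    case False
    have "per dvd (p - r) + per" using d by simp
    then have "per dvd p + (per - r)" by (simp add: algebra_simps)
    then show ?thesis using False r by (intro exI[of _ "nat (per - r)"]) (auto simp: resid_def)
  qed
qed

section \<open>The raising and lowering operators\<close>

definition F :: "nat \<Rightarrow> fock \<Rightarrow> fock" where
  "F j = shift_op 1 (\<lambda>p. chi j (p + 1))"

definition E :: "nat \<Rightarrow> fock \<Rightarrow> fock" where
  "E j = shift_op (- 1) (chi j)"

lemma F_at: "F j w S = (\<Sum>p | resid j (p + 1) \<and> p \<notin> beads S \<and> p + 1 \<in> beads S. w (ins p (del (p + 1) S)))"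
proof -
  have "F j w S = (\<Sum>p | p \<notin> beads S \<and> p + 1 \<in> beads S. if resid j (p + 1) then w (ins p (del (p + 1) S)) else 0)"
    unfolding F_def shift_op_def by (intro sum.cong refl) (auto simp: hop_up)
  also have "\<dots> = (\<Sum>p | (p \<notin> beads S \<and> p + 1 \<in> beads S) \<and> resid j (p + 1). w (ins p (del (p + 1) S)))"
    using sum.inter_filter[OF finite_shift_range[of S 1], of "\<lambda>p. w (ins p (del (p + 1) S))" "\<lambda>p. resid j (p + 1)"]
    by simp
  also have "{p. (p \<notin> beads S \<and> p + 1 \<in> beads S) \<and> resid j (p + 1)} = {p. resid j (p + 1) \<and> p \<notin> beads S \<and> p + 1 \<in> beads S}" by auto
  finally show ?thesis .
qed

lemma E_at: "E j w S = (\<Sum>p | resid j (p + 1) \<and> p \<in> beads S \<and> p + 1 \<notin> beads S. w (ins (p + 1) (del p S)))"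
proof -
  have "E j w S = (\<Sum>p | p \<notin> beads S \<and> p + -1 \<in> beads S. if resid j p then w (ins p (del (p - 1) S)) else 0)"
    unfolding E_def shift_op_def using hop_down[of "_ - 1" w S] by (intro sum.cong refl) auto
  also have "\<dots> = (\<Sum>p | (p \<notin> beads S \<and> p + -1 \<in> beads S) \<and> resid j p. w (ins p (del (p - 1) S)))"
    using sum.inter_filter[OF finite_shift_range[of S "-1"], of "\<lambda>p. w (ins p (del (p - 1) S))" "\<lambda>p. resid j p"]
    by simp
  also have "\<dots> = (\<Sum>p | resid j (p + 1) \<and> p \<in> beads S \<and> p + 1 \<notin> beads S. w (ins (p + 1) (del p S)))"
    by (rule sum.reindex_bij_witness[of _ "\<lambda>p. p + 1" "\<lambda>p. p - 1"]) auto
  finally show ?thesis .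
qed

lemma F_nonzeroE:
  assumes "F j w S \<noteq> 0"
  obtains p where "resid j (p + 1)" "p \<notin> beads S" "p + 1 \<in> beads S" "w (ins p (del (p + 1) S)) \<noteq> 0"
  using assms unfolding F_at by (metis (mono_tags, lifting) mem_Collect_eq sum.neutral)

text \<open>Distinct classes are disjoint, which kills the product of the coefficients for distinct
  \<open>i\<close> and \<open>j\<close>. The level \<open>m\<close> is arbitrary; it is later taken
  to be the filling level of the vacuum, where the excess is zero.\<close>

lemma E_F_commutator:
  assumes "i \<le> n" "j \<le> n"
  shows "E i (F j w) S - F j (E i w) S
     = (if i = j then (chi j m + excess m (\<lambda>p. chi j (p + 1) - chi j p) S) * w S else 0)"
proof -
  obtain b c where S: "confined b c S" "b \<le> m" "m \<le> c" by (rule ex_confined_around)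
  have "E i (F j w) S - F j (E i w) S = (\<Sum>q\<in>{b-2..<c+2}. chi i (q + 1) * chi j (q + 1) *
      (of_bool (q \<in> beads S) - of_bool (q + 1 \<in> beads S))) * w S"
    unfolding E_def F_def by (rule shift_op_commutator_diag[OF S(1)])
  also have "(\<Sum>q\<in>{b-2..<c+2}. chi i (q + 1) * chi j (q + 1) *
      (of_bool (q \<in> beads S) - of_bool (q + 1 \<in> beads S)))
    = (if i = j then (\<Sum>q\<in>{b-2..<c+2}. chi j (q + 1) *
      (of_bool (q \<in> beads S) - of_bool (q + 1 \<in> beads S))) else 0)"
  proof (cases "i = j")
    case True
    then show ?thesis by (simp flip: of_bool_conj)
  next
    case False
    then have "chi i p * chi j p = 0" for p using resid_unique[OF _ _ assms] by auto
    then show ?thesis by (simp only: False if_False mult_zero_left sum.neutral_const)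
  qed
  finally show ?thesis unfolding telescope_excess[OF S, of "chi j"] by (simp split: if_splits)
qed

section \<open>The vacuum module and its contravariant form\<close>

definition vac :: "int \<Rightarrow> fock" where
  "vac c S = of_bool (S = sea c)"

text \<open>Only lowering operators generate. Stability under \<open>E\<close> comes from the
  commutation relations and appears with \<open>R_E\<close>.\<close>

inductive_set Mod :: "int \<Rightarrow> fock set" for c where
  Mod_vac: "vac c \<in> Mod c"
| Mod_F: "w \<in> Mod c \<Longrightarrow> j \<le> n \<Longrightarrow> F j w \<in> Mod c"
| Mod_add: "w \<in> Mod c \<Longrightarrow> u \<in> Mod c \<Longrightarrow> w + u \<in> Mod c"
| Mod_scale: "w \<in> Mod c \<Longrightarrow> (\<lambda>S. a * w S) \<in> Mod c"

lemma E_linear: "E j (u + v) = E j u + E j v" "E j (\<lambda>S. a * u S) = (\<lambda>S. a * E j u S)"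
  by (simp_all add: E_def shift_op_linear)

lemma F_support: "{S. F j w S \<noteq> 0} \<subseteq> (\<Union>S'\<in>{S. w S \<noteq> 0}. (\<lambda>p. ins (p + 1) (del p S')) ` {p. p + 1 \<notin> beads S' \<and> p + 1 + - 1 \<in> beads S'})"
proof
  fix S assume "S \<in> {S. F j w S \<noteq> 0}"
  then obtain p where p: "p \<notin> beads S" "p + 1 \<in> beads S" "w (ins p (del (p + 1) S)) \<noteq> 0"
    using F_nonzeroE by blast
  define S' where "S' = ins p (del (p + 1) S)"
  have "S = ins (p + 1) (del p S')" "p + 1 \<notin> beads S'" "p \<in> beads S'"
    using p by (auto simp: S'_def intro!: maya_eqI)
  then show "S \<in> (\<Union>S'\<in>{S. w S \<noteq> 0}. (\<lambda>p. ins (p + 1) (del p S')) ` {p. p + 1 \<notin> beads S' \<and> p + 1 + - 1 \<in> beads S'})"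
    using p(3) unfolding S'_def[symmetric] by auto
qed

lemma finite_up_range: "finite {p. p + 1 \<notin> beads S \<and> p \<in> beads S}"
proof -
  have "{p. p + 1 \<notin> beads S \<and> p \<in> beads S} = (\<lambda>p. p - 1) ` {p. p \<notin> beads S \<and> p + -1 \<in> beads S}"
    by (auto simp: image_iff) (metis add_diff_cancel_right')
  then show ?thesis using finite_shift_range[of S "-1"] by simp
qed

lemma finite_support_F: "finite {S. w S \<noteq> 0} \<Longrightarrow> finite {S. F j w S \<noteq> 0}"
  by (rule finite_subset[OF F_support]) (auto simp: finite_up_range)

lemma finite_support_Mod: "w \<in> Mod c \<Longrightarrow> finite {S. w S \<noteq> 0}"
proof (induction rule: Mod.induct)
  case (Mod_add w u)
  then have "finite ({S. w S \<noteq> 0} \<union> {S. u S \<noteq> 0})" by simp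
  then show ?case by (rule rev_finite_subset) auto
next
  case (Mod_scale w a)
  then show ?case by (elim rev_finite_subset) auto
qed (auto simp: vac_def finite_support_F)

definition inner :: "fock \<Rightarrow> fock \<Rightarrow> complex" where
  "inner u w = (\<Sum>S | u S \<noteq> 0. u S * cnj (w S))"

lemma inner_eq: "finite Z \<Longrightarrow> {S. u S \<noteq> 0} \<subseteq> Z \<Longrightarrow> inner u w = (\<Sum>S\<in>Z. u S * cnj (w S))"
  unfolding inner_def by (rule sum.mono_neutral_left) auto

lemma inner_add: "finite {S. u S \<noteq> 0} \<Longrightarrow> finite {S. v S \<noteq> 0} \<Longrightarrow> inner (u + v) w = inner u w + inner v w"
  by (subst (1 2 3) inner_eq[where Z = "{S. u S \<noteq> 0} \<union> {S. v S \<noteq> 0}"]) (auto simp: algebra_simps sum.distrib)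

lemma inner_scale: "finite {S. u S \<noteq> 0} \<Longrightarrow> inner (\<lambda>S. a * u S) w = a * inner u w"
  by (subst (1 2) inner_eq[where Z = "{S. u S \<noteq> 0}"]) (auto simp: sum_distrib_left algebra_simps)

lemma inner_self_zero: "finite {S. u S \<noteq> 0} \<Longrightarrow> inner u u = 0 \<Longrightarrow> u = 0"
proof -
  assume fin: "finite {S. u S \<noteq> 0}" and 0: "inner u u = 0"
  have "inner u u = complex_of_real (\<Sum>S | u S \<noteq> 0. (cmod (u S))\<^sup>2)"
    by (simp only: inner_def of_real_sum complex_norm_square)
  with 0 have "(\<Sum>S | u S \<noteq> 0. (cmod (u S))\<^sup>2) = 0" by (metis of_real_eq_0_iff)
  then have "\<forall>S\<in>{S. u S \<noteq> 0}. (cmod (u S))\<^sup>2 = 0"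
    using fin by (subst (asm) sum_nonneg_eq_0_iff) auto
  then show "u = 0" by (auto simp: fun_eq_iff)
qed

text \<open>\<open>F j\<close> and \<open>E j\<close> run in opposite directions along the same
  edges of a graph on diagrams, with all coefficients equal to 1. They are transposes of each other,
  and being real also adjoints.\<close>

lemma inner_F:
  assumes "finite {S. u S \<noteq> 0}"
  shows "inner (F j u) w = inner u (E j w)"
proof -
  let ?R = "\<lambda>S. {p. resid j (p + 1) \<and> p \<notin> beads S \<and> p + 1 \<in> beads S}"
  let ?Q = "\<lambda>S. {p. resid j (p + 1) \<and> p \<in> beads S \<and> p + 1 \<notin> beads S}"
  define Z where "Z = (\<Union>S'\<in>{S. u S \<noteq> 0}. (\<lambda>p. ins (p + 1) (del p S')) ` {p. p + 1 \<notin> beads S' \<and> p + 1 + - 1 \<in> beads S'})"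
  have Z: "finite Z" using assms by (auto simp: Z_def finite_up_range)
  have finR: "finite (?R S)" and finQ: "finite (?Q S)" for S
    by (rule finite_subset[OF _ finite_shift_range[of S 1]] finite_subset[OF _ finite_up_range[of S]], auto)+
  have up_down: "ins (p + 1) (del p (ins p (del (p + 1) S))) = S" if "p \<notin> beads S" "p + 1 \<in> beads S" for p S
    using that by (auto intro!: maya_eqI)
  have down_up: "ins p (del (p + 1) (ins (p + 1) (del p S))) = S" if "p \<in> beads S" "p + 1 \<notin> beads S" for p S
    using that by (auto intro!: maya_eqI)
  have "inner (F j u) w = (\<Sum>S\<in>Z. F j u S * cnj (w S))"
    using F_support[of j u] Z by (intro inner_eq) (auto simp: Z_def)
  also have "\<dots> = (\<Sum>S\<in>Z. \<Sum>p\<in>?R S. u (ins p (del (p + 1) S)) * cnj (w S))"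
    by (simp add: F_at sum_distrib_right)
  also have "\<dots> = (\<Sum>(S, p)\<in>Sigma Z ?R. u (ins p (del (p + 1) S)) * cnj (w S))"
    by (rule sum.Sigma) (use Z finR in auto)
  also have "\<dots> = (\<Sum>(S, p)\<in>{(S, p). S \<in> Z \<and> p \<in> ?R S \<and> u (ins p (del (p + 1) S)) \<noteq> 0}. u (ins p (del (p + 1) S)) * cnj (w S))"
    using Z finR by (intro sum.mono_neutral_right) auto
  also have "\<dots> = (\<Sum>(S, p)\<in>Sigma {S. u S \<noteq> 0} ?Q. u S * cnj (w (ins (p + 1) (del p S))))"
  proof (rule sum.reindex_bij_witness[of _ "\<lambda>(S, p). (ins (p + 1) (del p S), p)" "\<lambda>(S, p). (ins p (del (p + 1) S), p)"])
    fix x assume "x \<in> Sigma {S. u S \<noteq> 0} ?Q"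
    then show "(case case x of (S, p) \<Rightarrow> (ins (p + 1) (del p S), p) of (S, p) \<Rightarrow> (ins p (del (p + 1) S), p)) = x"
      and "(case x of (S, p) \<Rightarrow> (ins (p + 1) (del p S), p)) \<in> {(S, p). S \<in> Z \<and> p \<in> ?R S \<and> u (ins p (del (p + 1) S)) \<noteq> 0}"
      by (auto simp: down_up Z_def)
  qed (auto simp: up_down)
  also have "\<dots> = (\<Sum>S | u S \<noteq> 0. \<Sum>p\<in>?Q S. u S * cnj (w (ins (p + 1) (del p S))))"
    using assms finQ by (intro sum.Sigma[symmetric]) auto
  also have "\<dots> = inner u (E j w)"
    by (simp add: inner_def E_at sum_distrib_left)
  finally show ?thesis .
qed

end

section \<open>Upper bound: the commuting affine \<open>sl\<^sub>2\<close>\<close>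

definition two_weight :: "int set \<Rightarrow> real" where
  "two_weight A = (\<Sum>a\<in>A. 2 powi a)"

text \<open>Read as binary numerals, sets are compared by the largest element in which they differ.
  A shift of the set only rescales the numeral, which later allows weights of shifted parts to be
  combined linearly.\<close>

lemma two_weight_less:
  assumes "finite A" "\<And>a. a \<in> A \<Longrightarrow> a < b"
  shows "two_weight A < 2 powi b"
  using assms
proof (induction A arbitrary: b rule: finite_linorder_max_induct)
  case (insert a A)
  then have "two_weight A < 2 powi a" by blast
  moreover have "a \<notin> A" using insert.hyps by auto
  ultimately have "two_weight (insert a A) < 2 powi a + 2 powi a"
    using insert.hyps by (simp add: two_weight_def)
  also have "\<dots> = 2 powi (a + 1)" by (simp add: power_int_add)
  also have "\<dots> \<le> (2::real) powi b" using insert.prems[of a] by (intro power_int_increasing) auto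
  finally show ?case .
qed (simp add: two_weight_def)

definition drop_one :: "(int set \<Rightarrow> complex) \<Rightarrow> int set \<Rightarrow> complex" where
  "drop_one g X = (\<Sum>p\<in>X. g (X - {p}))"

lemma drop_one_cong: "(\<And>p. p \<in> X \<Longrightarrow> g (X - {p}) = g' (X - {p})) \<Longrightarrow> drop_one g X = drop_one g' X"
  unfolding drop_one_def by (rule sum.cong) auto

text \<open>Leibniz rule for splitting off the tensor factor \<open>b\<close>. The raising operator
  squares to zero on that factor, so at most one of the \<open>m\<close> applications falls on
  it.\<close>

lemma drop_one_insert:
  assumes "finite X" "b \<notin> X"
  shows "(drop_one ^^ m) g (insert b X)
     = (drop_one ^^ m) (\<lambda>Y. g (insert b Y)) X + of_nat m * (drop_one ^^ (m - 1)) g X"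
  using assms
proof (induction m arbitrary: X)
  case (Suc m)
  let ?G = "(drop_one ^^ m) g" and ?H = "(drop_one ^^ m) (\<lambda>Y. g (insert b Y))"
  have "(drop_one ^^ Suc m) g (insert b X) = ?G X + (\<Sum>p\<in>X. ?G (insert b X - {p}))"
    using Suc.prems by (simp add: drop_one_def)
  also have "(\<Sum>p\<in>X. ?G (insert b X - {p})) = (\<Sum>p\<in>X. ?H (X - {p}) + of_nat m * (drop_one ^^ (m - 1)) g (X - {p}))"
  proof (rule sum.cong[OF refl])
    fix p assume "p \<in> X"
    then have "insert b X - {p} = insert b (X - {p})" using Suc.prems by auto
    then show "?G (insert b X - {p}) = ?H (X - {p}) + of_nat m * (drop_one ^^ (m - 1)) g (X - {p})"
      using Suc.IH[of "X - {p}"] Suc.prems by simp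
  qed
  also have "\<dots> = drop_one ?H X + of_nat m * drop_one ((drop_one ^^ (m - 1)) g) X"
    by (simp add: drop_one_def sum.distrib sum_distrib_left)
  also have "of_nat m * drop_one ((drop_one ^^ (m - 1)) g) X = of_nat m * ?G X"
    by (cases m) auto
  finally show ?case by (simp add: algebra_simps)
qed simp

lemma drop_one_pow_zero:
  assumes "\<And>Z. Z \<subseteq> Y \<Longrightarrow> g Z = 0"
  shows "(drop_one ^^ m) g Y = 0"
  using assms
proof (induction m arbitrary: Y)
  case (Suc m)
  have "(drop_one ^^ m) g (Y - {p}) = 0" for p
    using Suc.prems by (intro Suc.IH) auto
  then show ?case by (simp add: drop_one_def[of "(drop_one ^^ m) g"])
qed simp

text \<open>
  A function on the subsets of \<open>U\<close> is a vector of the tensor power of the two-dimensional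
  representation of \<open>sl\<^sub>2\<close> and \<open>drop_one\<close> is the raising operator. Allowing powers of it makes the
  induction on the largest element of \<open>U\<close> go through.
\<close>

lemma leading_set_ballot:
  assumes "finite U"
    and "\<And>Y. Y \<subseteq> U \<Longrightarrow> (drop_one ^^ Suc k) g Y = 0"
    and "X \<subseteq> U" "g X \<noteq> 0"
    and "\<And>Y. Y \<subseteq> U \<Longrightarrow> g Y \<noteq> 0 \<Longrightarrow> two_weight Y \<le> two_weight X"
  shows "card {u \<in> U - X. m \<le> u} \<le> card {u \<in> X. m \<le> u} + k"
  using assms
proof (induction U arbitrary: g k X rule: finite_linorder_max_induct)
  case (insert b A)
  have bA: "b \<notin> A" using insert.hyps by auto
  have finA: "finite Y" if "Y \<subseteq> A" for Y using that insert.hyps by (meson finite_subset)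
  have rel: "(drop_one ^^ Suc k) (\<lambda>Y. g (insert b Y)) Y = - of_nat (Suc k) * (drop_one ^^ k) g Y" if "Y \<subseteq> A" for Y
  proof -
    have "b \<notin> Y" "insert b Y \<subseteq> insert b A" using that bA by auto
    then have "(drop_one ^^ Suc k) (\<lambda>Y. g (insert b Y)) Y + of_nat (Suc k) * (drop_one ^^ k) g Y = 0"
      using insert.prems(1)[of "insert b Y"] drop_one_insert[OF finA[OF that], of b "Suc k" g] by (metis diff_Suc_1)
    then show ?thesis unfolding mult_minus_left by (simp only: eq_neg_iff_add_eq_0)
  qed
  have empty: ?case if "b < m"
  proof -
    have "{u \<in> insert b A - X. m \<le> u} = {}" using that insert.hyps by force
    then show ?thesis by (metis card.empty le0)
  qed
  show ?case
  proof (cases "\<exists>Y\<subseteq>A. g (insert b Y) \<noteq> 0")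
    case True
    then obtain Y where Y: "Y \<subseteq> A" "g (insert b Y) \<noteq> 0" by blast
    \<comment> \<open>All of \<open>A\<close> weighs less than \<open>b\<close> alone, so a leading
      set must contain \<open>b\<close> as soon as some set in the support does. The slice through
      \<open>b\<close> is then killed by the next higher power, and \<open>b\<close> itself pays for
      the extra unit in the bound.\<close>
    have "b \<in> X"
    proof (rule ccontr)
      assume "b \<notin> X"
      then have "X \<subseteq> A" using insert.prems(2) by auto
      then have "two_weight X < 2 powi b" using insert.hyps finA by (intro two_weight_less) auto
      also have "\<dots> \<le> two_weight (insert b Y)"
        using Y(1) bA finA[OF Y(1)] by (subst two_weight_def, subst sum.insert) (auto simp: sum_nonneg)
      also have "\<dots> \<le> two_weight X" using insert.prems(4)[of "insert b Y"] Y by auto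
      finally show False by simp
    qed
    define X' where "X' = X - {b}"
    have X: "X = insert b X'" "b \<notin> X'" "X' \<subseteq> A" using \<open>b \<in> X\<close> insert.prems(2) by (auto simp: X'_def)
    have "card {u \<in> A - X'. m \<le> u} \<le> card {u \<in> X'. m \<le> u} + Suc k"
    proof (rule insert.IH[where g = "\<lambda>Y. g (insert b Y)"])
      fix Y assume Y: "Y \<subseteq> A"
      have "(drop_one ^^ Suc (Suc k)) (\<lambda>Y. g (insert b Y)) Y = drop_one (\<lambda>Y. - of_nat (Suc k) * (drop_one ^^ k) g Y) Y"
        using Y rel by (subst funpow.simps, subst o_def, intro drop_one_cong) blast
      also have "\<dots> = - of_nat (Suc k) * (drop_one ^^ Suc k) g Y"
        by (simp add: drop_one_def sum_distrib_left)
      also have "\<dots> = 0" using insert.prems(1)[of Y] Y by auto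
      finally show "(drop_one ^^ Suc (Suc k)) (\<lambda>Y. g (insert b Y)) Y = 0" .
    next
      fix Y assume Y: "Y \<subseteq> A" "g (insert b Y) \<noteq> 0"
      then have "two_weight (insert b Y) \<le> two_weight X" using insert.prems(4)[of "insert b Y"] by auto
      moreover have "b \<notin> Y" using Y bA by auto
      ultimately show "two_weight Y \<le> two_weight X'"
        using X finA[OF Y(1)] finA[OF X(3)] by (simp add: two_weight_def)
    qed (use X insert.prems in auto)
    moreover have "{u \<in> insert b A - X. m \<le> u} = {u \<in> A - X'. m \<le> u}" using X bA by auto
    moreover have "{u \<in> X. m \<le> u} = insert b {u \<in> X'. m \<le> u}" if "m \<le> b" using X that by auto
    ultimately show ?thesis using empty X finA[OF X(3)] by (cases "b < m") auto
  next
    case False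
    then have bX: "b \<notin> X" using insert.prems(2,3) by (metis Diff_insert_absorb insert_Diff subset_insert_iff)
    then have XA: "X \<subseteq> A" using insert.prems(2) by auto
    \<comment> \<open>With an empty slice through \<open>b\<close>, the relation \<open>rel\<close>
      leaves a lower power killing \<open>g\<close> on \<open>A\<close>. This excludes k = 0, where
      it would give g X = 0, and the unit gained accounts for \<open>b\<close> lying outside
      \<open>X\<close>.\<close>
    have zero: "(drop_one ^^ k) g Y = 0" if "Y \<subseteq> A" for Y
    proof -
      have "(drop_one ^^ Suc k) (\<lambda>Y. g (insert b Y)) Y = 0"
        using False that by (intro drop_one_pow_zero) auto
      with rel[OF that] show ?thesis by (metis mult_eq_0_iff neg_equal_0_iff_equal of_nat_eq_0_iff nat.distinct(2))
    qed
    obtain k' where k: "k = Suc k'" using zero[OF XA] insert.prems(3) by (cases k) auto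
    have "card {u \<in> A - X. m \<le> u} \<le> card {u \<in> X. m \<le> u} + k'"
      using zero XA insert.prems(3) insert.prems(4)[OF subset_insertI2] unfolding k
      by (intro insert.IH[where g = g]) auto
    moreover have "{u \<in> insert b A - X. m \<le> u} = insert b {u \<in> A - X. m \<le> u}" if "m \<le> b" using bX that by auto
    ultimately show ?thesis using empty bA insert.hyps k by (cases "b < m") auto
  qed
qed simp

section \<open>The pairing operator and its commutation with the generators\<close>

definition sgi :: "int \<Rightarrow> complex" where
  "sgi p = (if even p then 1 else - 1)"

lemma sgi_mult: "sgi a * sgi b = sgi (a + b)"
  by (simp add: sgi_def)

lemma sgi_of_nat: "(- 1) ^ k = sgi (int k)"
  by (simp add: sgi_def minus_one_power_iff)

lemma sgi_cong: "even (a - b) \<Longrightarrow> sgi a = sgi b"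
  by (simp add: sgi_def)

context C_fock
begin

abbreviation bar :: "int \<Rightarrow> int" where
  "bar p \<equiv> per - 1 - p"

text \<open>
  A raising operator of the affine \<open>sl\<^sub>2\<close> commuting with all \<open>F j\<close>; the alternating signs are forced
  by this. Each pair is counted twice.
\<close>

definition pair_op :: "fock \<Rightarrow> fock" where
  "pair_op w S = (\<Sum>p | p \<in> beads S \<and> bar p \<in> beads S. sgi p * cr p (cr (bar p) w) S)"

lemma cr_cr_at:
  "p \<noteq> q \<Longrightarrow> cr p (cr q w) S = (if p \<in> beads S \<and> q \<in> beads S
     then jw_sign p S * jw_sign q (del p S) * w (del q (del p S)) else 0)"
  by (auto simp: cr_def)

lemma bar_neq [simp]: "p \<noteq> bar p" "bar p \<noteq> p"
  by presburger+

lemma pair_op_eq_sum: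
  assumes "finite I" "\<And>p. p \<in> beads S \<Longrightarrow> bar p \<in> beads S \<Longrightarrow> p \<in> I"
  shows "pair_op w S = (\<Sum>p\<in>I. sgi p * cr p (cr (bar p) w) S)"
  unfolding pair_op_def using assms by (intro sum.mono_neutral_left) (auto simp: cr_cr_at)

text \<open>Contracting the bead move with either creator of a pair gives a pair with positions
  summing to 2n. After an index shift the two families agree up to sign: \<open>bar p\<close> and
  \<open>p + 1\<close> lie in the same class, and \<open>sgi\<close> alternates.\<close>

lemma pair_op_F: "pair_op (F j w) = F j (pair_op w)"
proof
  fix S
  obtain b c where S: "confined b c S" by (rule ex_confined)
  define R where "R = \<bar>b\<bar> + \<bar>c\<bar> + per + 5"
  define I where "I = {bar R..R}"
  have I: "finite I" by (simp add: I_def)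
  have bar: "bar p \<in> I \<longleftrightarrow> p \<in> I" for p by (auto simp: I_def)
  have inI: "p \<in> I" if "p \<in> beads S" "bar p \<in> beads S" for p
    using confinedD(2)[OF S that(1)] confinedD(2)[OF S that(2)] by (auto simp: I_def R_def)
  have 1: "pair_op (F j w) S = (\<Sum>p\<in>I. \<Sum>q\<in>I. sgi p * chi j (q + 1) * cr p (cr (bar p) (hop (q + 1) q w)) S)"
  proof -
    have "pair_op (F j w) S = (\<Sum>p\<in>I. sgi p * cr p (cr (bar p) (F j w)) S)"
      using inI by (intro pair_op_eq_sum[OF I]) auto
    also have "\<dots> = (\<Sum>p\<in>I. \<Sum>q\<in>I. sgi p * chi j (q + 1) * cr p (cr (bar p) (hop (q + 1) q w)) S)"
    proof (rule sum.cong[OF refl])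
      fix p assume "p \<in> I"
      show "sgi p * cr p (cr (bar p) (F j w)) S = (\<Sum>q\<in>I. sgi p * chi j (q + 1) * cr p (cr (bar p) (hop (q + 1) q w)) S)"
      proof (cases "p \<in> beads S \<and> bar p \<in> beads S")
        case True
        define S' where "S' = del (bar p) (del p S)"
        have "F j w S' = (\<Sum>q\<in>I. chi j (q + 1) * hop (q + 1) q w S')"
          unfolding F_def
        proof (rule shift_op_eq_sum[OF _ I])
          fix q assume "q \<notin> beads S'" "q + 1 \<in> beads S'"
          then have "b \<le> q \<or> q = p \<or> q = bar p" "q + 1 \<le> c" "p \<le> c" "bar p \<le> c"
            using confinedD[OF S] True by (auto simp: S'_def)
          then show "q \<in> I" by (auto simp: I_def R_def)
        qed simp
        then show ?thesis using True by (simp add: cr_cr_at S'_def sum_distrib_left mult.assoc mult.left_commute)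
      qed (auto simp: cr_cr_at)
    qed
    finally show ?thesis .
  qed
  have 2: "F j (pair_op w) S = (\<Sum>q\<in>I. \<Sum>p\<in>I. sgi p * chi j (q + 1) * hop (q + 1) q (cr p (cr (bar p) w)) S)"
  proof -
    have "F j (pair_op w) S = (\<Sum>q\<in>I. chi j (q + 1) * hop (q + 1) q (pair_op w) S)"
      unfolding F_def using confinedD[OF S] by (intro shift_op_eq_sum I) (force simp: I_def R_def)+
    also have "\<dots> = (\<Sum>q\<in>I. \<Sum>p\<in>I. sgi p * chi j (q + 1) * hop (q + 1) q (cr p (cr (bar p) w)) S)"
    proof (rule sum.cong[OF refl])
      fix q assume "q \<in> I"
      show "chi j (q + 1) * hop (q + 1) q (pair_op w) S = (\<Sum>p\<in>I. sgi p * chi j (q + 1) * hop (q + 1) q (cr p (cr (bar p) w)) S)"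
      proof (cases "q + 1 \<in> beads S \<and> q \<notin> beads S")
        case True
        define S' where "S' = ins q (del (q + 1) S)"
        have "pair_op w S' = (\<Sum>p\<in>I. sgi p * cr p (cr (bar p) w) S')"
        proof (rule pair_op_eq_sum[OF I])
          fix p assume "p \<in> beads S'" "bar p \<in> beads S'"
          then have "p \<le> c" "bar p \<le> c"
            using confinedD(2)[OF S, of p] confinedD(2)[OF S, of "q + 1"] confinedD(2)[OF S, of "bar p"] True by (auto simp: S'_def)
          then show "p \<in> I" by (auto simp: I_def R_def)
        qed
        then show ?thesis using True by (simp add: hop_up S'_def sum_distrib_left mult.assoc mult.left_commute)
      qed (auto simp: hop_up)
    qed
    finally show ?thesis .
  qed
  have "F j (pair_op w) S - pair_op (F j w) S = (\<Sum>p\<in>I. \<Sum>q\<in>I. sgi p * chi j (q + 1) *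
     (hop (q + 1) q (cr p (cr (bar p) w)) - cr p (cr (bar p) (hop (q + 1) q w))) S)"
    unfolding 1 2 by (subst sum.swap) (simp add: sum_subtractf[symmetric] algebra_simps)
  also have "\<dots> = (\<Sum>p\<in>I. \<Sum>q\<in>I. (if q = p then sgi p * chi j (p + 1) * cr (p + 1) (cr (bar p) w) S else 0)
     + (if q = bar p then sgi p * chi j (bar p + 1) * cr p (cr (bar p + 1) w) S else 0))"
    unfolding hop_cr_cr by (intro sum.cong refl) auto
  also have "\<dots> = (\<Sum>p\<in>I. sgi p * chi j (p + 1) * cr (p + 1) (cr (bar p) w) S)
     + (\<Sum>p\<in>I. sgi p * chi j (bar p + 1) * cr p (cr (bar p + 1) w) S)"
    using I by (simp add: sum.distrib sum.delta bar)
  also have "(\<Sum>p\<in>I. sgi p * chi j (bar p + 1) * cr p (cr (bar p + 1) w) S)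
     = (\<Sum>p\<in>(\<lambda>p. p - 1) ` I. sgi (p + 1) * chi j (bar p) * cr (p + 1) (cr (bar p) w) S)"
    by (subst sum.reindex) (auto simp: algebra_simps intro!: inj_onI sum.cong)
  \<comment> \<open>The shift changes the range of summation only at indices where the pair cannot
    be occupied in \<open>S\<close>.\<close>
  also have "\<dots> = (\<Sum>p\<in>I. sgi (p + 1) * chi j (bar p) * cr (p + 1) (cr (bar p) w) S)"
  proof (rule sum.mono_neutral_cong)
    have *: "cr (p + 1) (cr (bar p) w) S = 0" if "p \<notin> I \<or> p + 1 \<notin> I" for p
    proof (cases "p + 1 \<in> beads S \<and> bar p \<in> beads S")
      case True
      then have "p + 1 \<le> c" "bar p \<le> c" using confinedD[OF S] by auto
      then have "p \<in> I" "p + 1 \<in> I" by (auto simp: I_def R_def)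
      with that show ?thesis by auto
    next
      case False
      then show ?thesis by (auto simp: cr_def)
    qed
    show "sgi (p + 1) * chi j (bar p) * cr (p + 1) (cr (bar p) w) S = 0" if "p \<in> I - (\<lambda>p. p - 1) ` I" for p
      using * [of p] that by force
    show "sgi (p + 1) * chi j (bar p) * cr (p + 1) (cr (bar p) w) S = 0" if "p \<in> (\<lambda>p. p - 1) ` I - I" for p
      using * [of p] that by force
  qed (use I in auto)
  also have "(\<Sum>p\<in>I. sgi p * chi j (p + 1) * cr (p + 1) (cr (bar p) w) S) + \<dots> = 0"
  proof -
    have "resid j (bar p) \<longleftrightarrow> resid j (p + 1)" for p
      using resid_reflect[of j 1 "p + 1"] by (simp add: algebra_simps)
    moreover have "sgi (p + 1) = - sgi p" for p by (simp add: sgi_def)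
    ultimately show ?thesis by (simp add: sum.distrib[symmetric])
  qed
  finally show "pair_op (F j w) S = F j (pair_op w) S" by simp
qed

text \<open>One of \<open>p\<close> and \<open>bar p\<close> is below n, hence already occupied in
  the vacuum, and the creator there gives zero. Commutation with \<open>F\<close> carries this to
  the whole module.\<close>

lemma pair_op_Mod:
  assumes "w \<in> Mod c" "int n \<le> c"
  shows "pair_op w = 0"
  using assms(1)
proof (induction rule: Mod.induct)
  case Mod_vac
  have "cr p (cr (bar p) (vac c)) S = 0" for p S
  proof (rule ccontr)
    assume "cr p (cr (bar p) (vac c)) S \<noteq> 0"
    then have "p \<in> beads S" "bar p \<in> beads S" "del (bar p) (del p S) = sea c"
      by (auto simp: cr_cr_at vac_def split: if_splits)
    from this(3) have "beads S - {p} - {bar p} = {x. x < c}" by (metis beads_del beads_sea)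
    then have "\<not> p < c" "\<not> bar p < c" by auto
    then show False using assms(2) by auto
  qed
  then show ?case by (auto simp: pair_op_def fun_eq_iff)
next
  case (Mod_F w j)
  then show ?case by (simp add: pair_op_F) (simp add: F_at fun_eq_iff)
next
  case (Mod_add w u)
  have "pair_op (w + u) = pair_op w + pair_op u"
    by (simp add: pair_op_def fun_eq_iff cr_linear sum.distrib algebra_simps)
  then show ?case by (simp only: Mod_add.IH add_0_left)
next
  case (Mod_scale w a)
  have "pair_op (\<lambda>S. a * w S) S = a * pair_op w S" for S
    by (simp add: pair_op_def cr_cr_at sum_distrib_left mult.assoc mult.left_commute)
  with Mod_scale show ?case by (simp add: fun_eq_iff)
qed

end

text \<open>The sign \<open>(-1)\<^bsup>inversions A B\<^esup>\<close> removes all fermionic signs from \<open>pair_op\<close>.\<close>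

definition inversions :: "int set \<Rightarrow> int set \<Rightarrow> nat" where
  "inversions A B = (\<Sum>a\<in>A. card {b \<in> B. a < b})"

lemma inversions_swap:
  assumes "finite A" "finite B" "p \<in> A" "p \<notin> B"
  shows "int (inversions (A - {p}) (insert p B))
     = int (inversions A B) - int (card {b \<in> B. p < b}) + int (card {a \<in> A. a < p})"
proof -
  have "inversions (A - {p}) (insert p B) = (\<Sum>a\<in>A - {p}. card {b \<in> B. a < b} + of_bool (a < p))"
    unfolding inversions_def
  proof (rule sum.cong[OF refl])
    fix a
    have "{b \<in> insert p B. a < b} = (if a < p then insert p {b \<in> B. a < b} else {b \<in> B. a < b})" by auto
    then show "card {b \<in> insert p B. a < b} = card {b \<in> B. a < b} + of_bool (a < p)"
      using assms by simp
  qed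
  also have "\<dots> = inversions (A - {p}) B + (\<Sum>a\<in>A - {p}. of_bool (a < p))"
    by (simp add: sum.distrib inversions_def)
  also have "(\<Sum>a\<in>A - {p}. of_bool (a < p)) = card {a \<in> A. a < p}"
    using assms by (simp add: Int_def) (rule arg_cong[of _ _ card], auto)
  finally show ?thesis
    using sum.remove[OF assms(1,3), of "\<lambda>a. card {b \<in> B. a < b}"] by (simp add: inversions_def)
qed

section \<open>Diagrams as pairs of sets of parts\<close>

context C_fock
begin

text \<open>The parts of \<open>\<mu>\<close> are the particles; those of \<open>\<nu>\<close> are the holes, reflected by \<open>bar\<close>.\<close>

definition nus :: "int \<Rightarrow> maya \<Rightarrow> int set" where
  "nus c S = bar ` holes c S"

definition config :: "int \<Rightarrow> int set \<Rightarrow> int set \<Rightarrow> maya" where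
  "config c A B = Abs_maya ({x. x < c \<and> bar x \<notin> B} \<union> A)"

lemma beads_config:
  assumes "finite A" "finite B"
  shows "beads (config c A B) = {x. x < c \<and> bar x \<notin> B} \<union> A"
  unfolding config_def
proof (rule Abs_maya_inverse, intro CollectI conjI)
  have fin: "finite (bar ` B)" using assms by simp
  have "x \<in> {x. x < c \<and> bar x \<notin> B} \<union> A" if "x < Min (insert c (bar ` B))" for x
  proof -
    have "bar (bar x) \<notin> bar ` B" "x < c" using that fin by auto
    then show ?thesis by blast
  qed
  then show "\<exists>b. \<forall>x<b. x \<in> {x. x < c \<and> bar x \<notin> B} \<union> A" by blast
  have "x \<notin> {x. x < c \<and> bar x \<notin> B} \<union> A" if "x > Max (insert c A)" for x
    using that assms by auto
  then show "\<exists>c'. \<forall>x>c'. x \<notin> {x. x < c \<and> bar x \<notin> B} \<union> A" by blast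
qed

lemma bar_mem_holes_iff: "bar b \<in> holes c S \<longleftrightarrow> b \<in> nus c S"
  by (auto simp: nus_def intro: rev_image_eqI)

lemma finite_nus [simp]: "finite (nus c S)"
  by (simp add: nus_def)

lemma nus_ge: "b \<in> nus c S \<Longrightarrow> per - c \<le> b"
  by (auto simp: nus_def holes_def)

lemma particles_ge: "a \<in> particles c S \<Longrightarrow> c \<le> a"
  by (auto simp: particles_def)

lemma card_nus: "card (nus c S) = card (holes c S)"
  unfolding nus_def by (rule card_image) (auto intro: inj_onI)

lemma particles_config:
  assumes "finite A" "finite B" "\<And>a. a \<in> A \<Longrightarrow> c \<le> a"
  shows "particles c (config c A B) = A"
  using assms by (auto simp: particles_def beads_config)

lemma nus_config:
  assumes "finite A" "finite B" "\<And>a. a \<in> A \<Longrightarrow> c \<le> a" "\<And>b. b \<in> B \<Longrightarrow> per - c \<le> b"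
  shows "nus c (config c A B) = B"
proof (rule set_eqI)
  fix b
  have "b \<in> nus c (config c A B) \<longleftrightarrow> bar b \<notin> beads (config c A B) \<and> bar b < c"
    by (simp add: bar_mem_holes_iff[symmetric] holes_def)
  also have "\<dots> \<longleftrightarrow> b \<in> B" unfolding beads_config[OF assms(1,2)] using assms(3)[of "bar b"] assms(4)[of b] by auto
  finally show "b \<in> nus c (config c A B) \<longleftrightarrow> b \<in> B" .
qed

lemma config_particles_nus: "config c (particles c S) (nus c S) = S"
proof (rule maya_eqI, rule set_eqI)
  fix x
  have "bar x \<in> nus c S \<longleftrightarrow> x \<in> holes c S"
    using bar_mem_holes_iff[of "bar x" c S] by simp
  then show "x \<in> beads (config c (particles c S) (nus c S)) \<longleftrightarrow> x \<in> beads S"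
    unfolding beads_config[OF finite_particles finite_nus] by (auto simp: particles_def holes_def)
qed

lemma config_remove_pair:
  assumes "finite A" "finite B" "p \<in> A" "p \<notin> B" "c \<le> p" "int n \<le> c" "\<And>a. a \<in> A \<Longrightarrow> c \<le> a"
  shows "del (bar p) (del p (config c A B)) = config c (A - {p}) (insert p B)"
proof (rule maya_eqI)
  have "bar p \<notin> A" using assms(5,6) assms(7)[of "bar p"] by auto
  then show "beads (del (bar p) (del p (config c A B))) = beads (config c (A - {p}) (insert p B))"
    using assms(1-6) by (auto simp: beads_config)
qed

text \<open>A parity count. The beads above \<open>p\<close> are parts of \<open>A\<close>; those
  above \<open>bar p\<close>, once \<open>p\<close> is removed, are the rest of \<open>A\<close> and
  the interval up to \<open>c\<close> without the reflected parts of \<open>B\<close> below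
  \<open>p\<close>. Modulo 2 this is the change of the inversion number plus a quantity independent
  of \<open>p\<close>.\<close>

lemma pair_sign:
  assumes fin: "finite A" "finite B" and p: "p \<in> A" "p \<notin> B" and c: "int n \<le> c"
    and A: "\<And>a. a \<in> A \<Longrightarrow> c \<le> a" and B: "\<And>b. b \<in> B \<Longrightarrow> per - c \<le> b"
  defines "S \<equiv> config c A B"
  shows "sgi p * (jw_sign p S * jw_sign (bar p) (del p S))
     = sgi (c + int (card B) + int (inversions A B)) * sgi (int (inversions (A - {p}) (insert p B)))"
proof -
  have pc: "c \<le> p" using A p by auto
  have S: "beads S = {x. x < c \<and> bar x \<notin> B} \<union> A" unfolding S_def by (rule beads_config[OF fin])
  have 1: "{x \<in> beads S. p < x} = {a \<in> A. p < a}" using pc by (auto simp: S)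
  have sub: "bar ` {b \<in> B. b < p} \<subseteq> {bar p<..<c}" by (auto dest!: B)
  have "{x \<in> beads (del p S). bar p < x} = (A - {p}) \<union> ({bar p<..<c} - bar ` {b \<in> B. b < p})"
  proof (rule set_eqI)
    fix x
    have "x \<in> bar ` {b \<in> B. b < p} \<longleftrightarrow> bar x \<in> B \<and> bar x < p"
      by (auto simp: image_iff intro: bexI[of _ "bar x"])
    then show "x \<in> {x \<in> beads (del p S). bar p < x} \<longleftrightarrow> x \<in> (A - {p}) \<union> ({bar p<..<c} - bar ` {b \<in> B. b < p})"
      using pc A[of x] c by (auto simp: S)
  qed
  then have "card {x \<in> beads (del p S). bar p < x} = card (A - {p}) + card ({bar p<..<c} - bar ` {b \<in> B. b < p})"
    using fin A by (subst card_Un_disjoint[symmetric]) (auto dest: A)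
  also have "card ({bar p<..<c} - bar ` {b \<in> B. b < p}) = card {bar p<..<c} - card (bar ` {b \<in> B. b < p})"
    using fin sub by (intro card_Diff_subset) auto
  also have "card (bar ` {b \<in> B. b < p}) = card {b \<in> B. b < p}"
    by (rule card_image) (auto intro: inj_onI)
  finally have 2: "card {x \<in> beads (del p S). bar p < x} = card (A - {p}) + (card {bar p<..<c} - card {b \<in> B. b < p})" .
  have "card (bar ` {b \<in> B. b < p}) \<le> card {bar p<..<c}"
    using sub by (intro card_mono) auto
  then have le: "card {b \<in> B. b < p} \<le> card {bar p<..<c}"
    by (subst (asm) card_image) (auto intro: inj_onI)
  have win: "int (card {bar p<..<c}) = c - per + p" using pc c by simp
  have cA: "int (card (A - {p})) = int (card A) - 1" using card_Suc_Diff1[OF fin(1) p(1)] by linarith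
  have "A - {p} = {a \<in> A. a < p} \<union> {a \<in> A. p < a}" by auto
  then have "card (A - {p}) = card {a \<in> A. a < p} + card {a \<in> A. p < a}"
    using fin by (simp add: card_Un_disjoint disjoint_iff)
  moreover have "B = {b \<in> B. b < p} \<union> {b \<in> B. p < b}" using p(2) by (auto simp: not_less order.order_iff_strict)
  then have "card B = card {b \<in> B. b < p} + card {b \<in> B. p < b}"
    using fin card_Un_disjoint[of "{b \<in> B. b < p}" "{b \<in> B. p < b}"] by (simp add: disjoint_iff)
  ultimately have splits: "int (card A) - 1 = int (card {a \<in> A. a < p}) + int (card {a \<in> A. p < a})"
      "int (card B) = int (card {b \<in> B. b < p}) + int (card {b \<in> B. p < b})"
    using cA by linarith+
  have "sgi p * (jw_sign p S * jw_sign (bar p) (del p S))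
    = sgi (p + (int (card {a \<in> A. p < a}) + (int (card (A - {p})) + (c - per + p - int (card {b \<in> B. b < p})))))"
    unfolding jw_sign_def 1 2 sgi_of_nat sgi_mult using le win by (simp add: of_nat_diff)
  also have "\<dots> = sgi (c + int (card B) + int (inversions A B) + int (inversions (A - {p}) (insert p B)))"
  proof (rule sgi_cong)
    have "p + (int (card {a \<in> A. p < a}) + (int (card (A - {p})) + (c - per + p - int (card {b \<in> B. b < p}))))
        - (c + int (card B) + int (inversions A B) + int (inversions (A - {p}) (insert p B)))
      = 2 * (p + int (card {a \<in> A. p < a}) - int n - int (card {b \<in> B. b < p}) - int (inversions A B))"
      unfolding inversions_swap[OF fin p] using splits cA by (simp add: algebra_simps)
    then show "even (p + (int (card {a \<in> A. p < a}) + (int (card (A - {p})) + (c - per + p - int (card {b \<in> B. b < p}))))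
        - (c + int (card B) + int (inversions A B) + int (inversions (A - {p}) (insert p B))))"
      by (metis dvd_triv_left)
  qed
  finally show ?thesis by (simp add: sgi_mult)
qed

lemma excess_Mod:
  assumes "w \<in> Mod c" "w S \<noteq> 0"
  shows "excess c (\<lambda>_. 1) S = 0"
  using assms
proof (induction arbitrary: S rule: Mod.induct)
  case (Mod_F w j)
  from Mod_F.prems obtain p where "p \<notin> beads S" "p + 1 \<in> beads S" "w (ins p (del (p + 1) S)) \<noteq> 0"
    by (rule F_nonzeroE)
  then show ?case using Mod_F.IH[of "ins p (del (p + 1) S)"] by (simp add: excess_move)
next
  case (Mod_add w u)
  then have "w S \<noteq> 0 \<or> u S \<noteq> 0" by auto
  then show ?case using Mod_add.IH by blast
qed (auto simp: vac_def split: if_splits)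

lemma card_particles_Mod:
  assumes "w \<in> Mod c" "w S \<noteq> 0"
  shows "card (particles c S) = card (nus c S)"
proof -
  have "complex_of_nat (card (particles c S)) - of_nat (card (holes c S)) = 0"
    using excess_Mod[OF assms] by (simp add: excess_def)
  then show ?thesis by (simp add: card_nus)
qed

text \<open>The indices \<open>p\<close> and \<open>bar p\<close> give equal terms, since both
  \<open>sgi\<close> and the order of the creators change sign. Hypothesis \<open>top\<close>
  discards the terms that fill two holes, and the signs from \<open>pair_sign\<close> leave a common
  factor that can be cancelled.\<close>

lemma pair_op_config:
  assumes w: "pair_op w = 0" and c: "int n \<le> c"
    and fin: "finite A" "finite B"
    and A: "\<And>a. a \<in> A \<Longrightarrow> c \<le> a" and B: "\<And>b. b \<in> B \<Longrightarrow> per - c \<le> b"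
    and top: "\<And>p. w (del (bar p) (del p (config c A B))) \<noteq> 0 \<Longrightarrow> p \<in> beads (config c A B) \<Longrightarrow>
       bar p \<in> beads (config c A B) \<Longrightarrow> c \<le> p \<or> c \<le> bar p"
  shows "(\<Sum>p\<in>A - B. sgi (int (inversions (A - {p}) (insert p B))) * w (config c (A - {p}) (insert p B))) = 0"
proof -
  define S where "S = config c A B"
  define t where "t p = sgi p * cr p (cr (bar p) w) S" for p
  have S: "beads S = {x. x < c \<and> bar x \<notin> B} \<union> A" unfolding S_def by (rule beads_config[OF fin])
  have memb: "p \<in> A - B \<longleftrightarrow> p \<in> beads S \<and> bar p \<in> beads S \<and> c \<le> p" for p
    using A[of p] A[of "bar p"] c by (auto simp: S)
  define Q where "Q = {p. p \<in> beads S \<and> bar p \<in> beads S}"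
  have finQ: "finite Q"
  proof -
    obtain b m where "confined b m S" by (rule ex_confined)
    then have "Q \<subseteq> {bar m..m}" using confinedD(2) by (force simp: Q_def)
    then show ?thesis by (rule finite_subset) simp
  qed
  have "0 = pair_op w S" using w by simp
  also have "\<dots> = sum t Q" by (simp add: pair_op_def t_def Q_def)
  also have "\<dots> = sum t ((A - B) \<union> bar ` (A - B))"
  proof (rule sum.mono_neutral_right[OF finQ])
    have "p \<in> Q" "bar p \<in> Q" if "p \<in> A - B" for p using iffD1[OF memb that] by (auto simp: Q_def)
    then show "(A - B) \<union> bar ` (A - B) \<subseteq> Q" by blast
    show "\<forall>p\<in>Q - (A - B \<union> bar ` (A - B)). t p = 0"
    proof
      fix p assume p: "p \<in> Q - (A - B \<union> bar ` (A - B))"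
      then have Q: "p \<in> Q" "p \<notin> A - B" "bar p \<notin> A - B" by (auto intro: rev_image_eqI)
      have "\<not> c \<le> p" using memb[of p] Q(1,2) by (simp add: Q_def)
      moreover have "\<not> c \<le> bar p" using memb[of "bar p"] Q(1,3) by (simp add: Q_def)
      ultimately have "w (del (bar p) (del p S)) = 0" using top[of p] p unfolding S_def[symmetric] by (auto simp: Q_def)
      then show "t p = 0" by (simp add: t_def cr_cr_at)
    qed
  qed
  also have "\<dots> = sum t (A - B) + sum t (bar ` (A - B))"
  proof (rule sum.union_disjoint)
    have "c \<le> p" "bar p < c" if "p \<in> A - B" for p using A[of p] that c by auto
    then show "(A - B) \<inter> bar ` (A - B) = {}" by fastforce
  qed (use fin in auto)
  also have "sum t (bar ` (A - B)) = sum t (A - B)"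
  proof (subst sum.reindex)
    show "inj_on bar (A - B)" by (auto intro: inj_onI)
    have "t (bar p) = t p" for p
    proof -
      have "sgi (bar p) = - sgi p" by (simp add: sgi_def)
      then show ?thesis unfolding t_def by (subst cr_cr) simp
    qed
    then show "sum (t \<circ> bar) (A - B) = sum t (A - B)" by simp
  qed
  finally have "sum t (A - B) = 0" by simp
  also have "sum t (A - B) = (\<Sum>p\<in>A - B. sgi (c + int (card B) + int (inversions A B)) *
      (sgi (int (inversions (A - {p}) (insert p B))) * w (config c (A - {p}) (insert p B))))"
  proof (rule sum.cong[OF refl])
    fix p assume p: "p \<in> A - B"
    have "t p = sgi p * (jw_sign p S * jw_sign (bar p) (del p S)) * w (del (bar p) (del p S))"
      using memb[of p] p by (simp add: t_def cr_cr_at)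
    also have "sgi p * (jw_sign p S * jw_sign (bar p) (del p S)) = sgi (c + int (card B) + int (inversions A B)) * sgi (int (inversions (A - {p}) (insert p B)))"
      unfolding S_def using p by (intro pair_sign[OF fin _ _ c A B]) auto
    also have "del (bar p) (del p S) = config c (A - {p}) (insert p B)"
      unfolding S_def using p A c by (intro config_remove_pair[OF fin]) auto
    finally show "t p = sgi (c + int (card B) + int (inversions A B)) * (sgi (int (inversions (A - {p}) (insert p B))) * w (config c (A - {p}) (insert p B)))"
      by (simp add: mult.assoc)
  qed
  also have "\<dots> = sgi (c + int (card B) + int (inversions A B)) * (\<Sum>p\<in>A - B. sgi (int (inversions (A - {p}) (insert p B))) * w (config c (A - {p}) (insert p B)))"
    by (simp add: sum_distrib_left)
  finally show ?thesis by (auto simp: sgi_def split: if_splits)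
qed

text \<open>
  Among the terms with the most particles the rest of \<open>pair_op\<close>, which annihilates two holes at once,
  cannot contribute.
\<close>

lemma leading_ballot:
  assumes w: "w \<in> Mod c" and c: "int n \<le> c" and S: "w S \<noteq> 0"
    and top: "\<And>S'. w S' \<noteq> 0 \<Longrightarrow> card (particles c S') \<le> card (particles c S)"
    and lead: "\<And>S'. w S' \<noteq> 0 \<Longrightarrow> card (particles c S') = card (particles c S) \<Longrightarrow>
      particles c S' \<union> nus c S' = particles c S \<union> nus c S \<Longrightarrow>
      particles c S' \<inter> nus c S' = particles c S \<inter> nus c S \<Longrightarrow>
      two_weight (particles c S') \<le> two_weight (particles c S)"
  shows "card {b \<in> nus c S. m \<le> b} \<le> card {a \<in> particles c S. m \<le> a}"
proof -
  define A where "A = particles c S"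
  define B where "B = nus c S"
  \<comment> \<open>The parts in \<open>C\<close> belong to both sets and those in \<open>Z\<close>
    lie too low to become particles. Only the distribution of \<open>U\<close> between the two sets
    varies, so the coefficients become a function on subsets of \<open>U\<close>.\<close>
  define C where "C = A \<inter> B"
  define X where "X = A - B"
  define U where "U = X \<union> {b \<in> B - A. c \<le> b}"
  define Z where "Z = {b \<in> B. b < c}"
  have Age: "c \<le> a" if "a \<in> A" for a using that particles_ge by (auto simp: A_def)
  have Bge: "per - c \<le> b" if "b \<in> B" for b using that nus_ge by (auto simp: B_def)
  have fin [simp]: "finite A" "finite B" "finite C" "finite X" "finite U" "finite Z"
    by (auto simp: A_def B_def C_def X_def U_def Z_def)
  have XU: "X \<subseteq> U" by (auto simp: U_def)
  have AX: "A = C \<union> X" by (auto simp: C_def X_def)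
  have BX: "B = C \<union> (U - X) \<union> Z" using Age by (auto simp: C_def X_def U_def Z_def)
  have disj: "C \<inter> U = {}" "C \<inter> Z = {}" "U \<inter> Z = {}"
    by (auto simp: C_def X_def U_def Z_def dest: Age)
  have cardAB: "card A = card B" using card_particles_Mod[OF w S] by (simp add: A_def B_def)
  define cf where "cf Y = config c (C \<union> Y) (C \<union> (U - Y) \<union> Z)" for Y
  have bounds: "c \<le> a" if "a \<in> C \<union> Y" "Y \<subseteq> U" for a Y
    using that Age by (auto simp: C_def U_def X_def)
  have bounds': "per - c \<le> b" if "b \<in> C \<union> (U - Y) \<union> Z" for b Y
  proof -
    have "b \<in> B \<or> b \<in> A" using that by (auto simp: C_def U_def X_def Z_def)
    then show ?thesis using Bge Age[of b] c by auto
  qed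
  have finY: "finite Y" if "Y \<subseteq> U" for Y using that fin(5) by (rule finite_subset)
  have cf_particles: "particles c (cf Y) = C \<union> Y" if "Y \<subseteq> U" for Y
    unfolding cf_def using bounds[OF _ that] finY[OF that] by (intro particles_config) auto
  have cf_nus: "nus c (cf Y) = C \<union> (U - Y) \<union> Z" if "Y \<subseteq> U" for Y
    unfolding cf_def using bounds[OF _ that] bounds'[of _ Y] finY[OF that] by (intro nus_config) auto
  have cfX: "cf X = S"
    unfolding cf_def AX[symmetric] BX[symmetric] A_def B_def by (rule config_particles_nus)
  have card_cf: "card (C \<union> Y) = card C + card Y" "card (C \<union> (U - Y) \<union> Z) + card Y = card C + card U + card Z" if "Y \<subseteq> U" for Y
  proof -
    show "card (C \<union> Y) = card C + card Y" using that finY disj by (intro card_Un_disjoint) auto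
    have "card (C \<union> (U - Y) \<union> Z) = card C + card (U - Y) + card Z"
      using disj by (subst card_Un_disjoint, simp, simp, blast, subst card_Un_disjoint) auto
    moreover have "card (U - Y) + card Y = card U"
      using that finY by (simp add: card_Diff_subset card_mono)
    ultimately show "card (C \<union> (U - Y) \<union> Z) + card Y = card C + card U + card Z" by simp
  qed
  have two_X: "2 * card X = card U + card Z"
    using card_cf[OF XU] cardAB AX BX by simp
  define g where "g Y = sgi (int (inversions (C \<union> Y) (C \<union> (U - Y) \<union> Z))) * w (cf Y)" for Y
  have g_nz: "g Y \<noteq> 0 \<longleftrightarrow> w (cf Y) \<noteq> 0" for Y by (auto simp: g_def sgi_def)
  have card_w: "card Y = card X" if "Y \<subseteq> U" "w (cf Y) \<noteq> 0" for Y
    using card_particles_Mod[OF w that(2)] card_cf[OF that(1)] cf_particles[OF that(1)] cf_nus[OF that(1)] two_X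
    by simp
  have main: "card {u \<in> U - X. m \<le> u} \<le> card {u \<in> X. m \<le> u} + 0"
  proof (rule leading_set_ballot[where g = g])
    fix Y assume Y: "Y \<subseteq> U"
    let ?A = "C \<union> Y" and ?B = "C \<union> (U - Y) \<union> Z"
    have AB: "?A - ?B = Y" using Y disj by auto
    have "(\<Sum>p\<in>?A - ?B. sgi (int (inversions (?A - {p}) (insert p ?B))) * w (config c (?A - {p}) (insert p ?B))) = 0"
    proof (rule pair_op_config)
      show "pair_op w = 0" using w c by (rule pair_op_Mod)
      fix p assume p: "w (del (bar p) (del p (config c ?A ?B))) \<noteq> 0"
        "p \<in> beads (config c ?A ?B)" "bar p \<in> beads (config c ?A ?B)"
      show "c \<le> p \<or> c \<le> bar p"
      proof (rule ccontr)
        assume low: "\<not> ?thesis"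
        \<comment> \<open>Removing two beads below \<open>c\<close> adds two holes and no particle.
          Charge zero then forces \<open>Y\<close> to be larger than \<open>X\<close>, contradicting
          the maximal number of particles in \<open>S\<close>.\<close>
        let ?S = "del (bar p) (del p (cf Y))"
        have S: "w ?S \<noteq> 0" using p by (simp add: cf_def)
        have 1: "particles c ?S = ?A" using low cf_particles[OF Y] by (auto simp: particles_def)
        have B: "b \<in> ?B \<longleftrightarrow> bar b < c \<and> bar b \<notin> beads (cf Y)" for b
          by (simp only: cf_nus[OF Y, symmetric] bar_mem_holes_iff[symmetric] holes_def) auto
        have "b \<in> nus c ?S \<longleftrightarrow> b \<in> insert p (insert (bar p) ?B)" for b
        proof -
          have "b \<in> nus c ?S \<longleftrightarrow> bar b < c \<and> (bar b \<notin> beads (cf Y) \<or> bar b = p \<or> bar b = bar p)"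
            by (simp only: bar_mem_holes_iff[symmetric] holes_def) auto
          also have "\<dots> \<longleftrightarrow> b \<in> ?B \<or> b = bar p \<or> b = p"
            unfolding B using low by auto
          finally show ?thesis by blast
        qed
        then have "nus c ?S = insert p (insert (bar p) ?B)" by blast
        moreover have "p \<notin> ?B" "bar p \<notin> ?B"
          using p(2,3) unfolding B cf_def[symmetric] by simp_all
        ultimately have "card (nus c ?S) = card ?B + 2" by (simp add: finY)
        with card_particles_Mod[OF w S] have "card ?A = card ?B + 2" by (simp add: 1)
        with card_cf[OF Y] two_X have "card X < card Y" by simp
        moreover have "card ?A \<le> card A" using top[OF S] 1 by (simp add: A_def)
        ultimately show False using card_cf(1)[OF Y] card_cf(1)[OF XU] AX by simp
      qed
    qed (use c bounds[OF _ Y] Y bounds'[of _ Y] finY[OF Y] in auto)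
    moreover have "sgi (int (inversions (?A - {p}) (insert p ?B))) * w (config c (?A - {p}) (insert p ?B)) = g (Y - {p})" if "p \<in> Y" for p
    proof -
      have "?A - {p} = C \<union> (Y - {p})" "insert p ?B = C \<union> (U - (Y - {p})) \<union> Z" using that Y disj by auto
      then show ?thesis by (simp only: g_def cf_def)
    qed
    ultimately show "(drop_one ^^ Suc 0) g Y = 0" unfolding AB by (simp add: drop_one_def)
  next
    fix Y assume Y: "Y \<subseteq> U" "g Y \<noteq> 0"
    then have wY: "w (cf Y) \<noteq> 0" by (simp add: g_nz)
    have "two_weight (particles c (cf Y)) \<le> two_weight (particles c S)"
    proof (rule lead[OF wY])
      show "card (particles c (cf Y)) = card (particles c S)"
        using card_w[OF Y(1) wY] cf_particles[OF Y(1)] cf_particles[OF XU] card_cf(1)[OF Y(1)] card_cf(1)[OF XU] cfX by simp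
      have "particles c S = C \<union> X" "nus c S = C \<union> (U - X) \<union> Z" using AX BX by (auto simp: A_def B_def)
      then show "particles c (cf Y) \<union> nus c (cf Y) = particles c S \<union> nus c S"
        "particles c (cf Y) \<inter> nus c (cf Y) = particles c S \<inter> nus c S"
        unfolding cf_particles[OF Y(1)] cf_nus[OF Y(1)] using Y(1) XU disj by auto
    qed
    then have "two_weight (C \<union> Y) \<le> two_weight (C \<union> X)"
      unfolding cf_particles[OF Y(1)] A_def[symmetric] AX[symmetric] .
    moreover have "two_weight (C \<union> V) = two_weight C + two_weight V" if "V \<subseteq> U" for V
      unfolding two_weight_def using that disj finY by (intro sum.union_disjoint) auto
    ultimately show "two_weight Y \<le> two_weight X" using Y(1) XU by simp
  qed (use XU S cfX g_nz in auto)
  show ?thesis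
  proof (cases "c \<le> m")
    case True
    have "{b \<in> B. m \<le> b} = {x \<in> C. m \<le> x} \<union> {u \<in> U - X. m \<le> u}" using True by (subst BX) (auto simp: Z_def)
    moreover have "{a \<in> A. m \<le> a} = {x \<in> C. m \<le> x} \<union> {u \<in> X. m \<le> u}" by (subst AX) auto
    moreover have "card ({x \<in> C. m \<le> x} \<union> {u \<in> U - X. m \<le> u}) = card {x \<in> C. m \<le> x} + card {u \<in> U - X. m \<le> u}"
      using disj by (intro card_Un_disjoint) auto
    moreover have "card ({x \<in> C. m \<le> x} \<union> {u \<in> X. m \<le> u}) = card {x \<in> C. m \<le> x} + card {u \<in> X. m \<le> u}"
      using disj XU by (intro card_Un_disjoint) auto
    ultimately show ?thesis using main by (simp add: A_def B_def)
  next
    case False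
    \<comment> \<open>Below the filling level every particle is counted, so charge zero
      suffices.\<close>
    then have "{a \<in> A. m \<le> a} = A" using Age by force
    moreover have "card {b \<in> B. m \<le> b} \<le> card B" by (intro card_mono) auto
    ultimately show ?thesis using cardAB by (simp add: A_def B_def)
  qed
qed

end

section \<open>The diagram automorphism and the second ballot condition\<close>

lemma two_weight_shift: "two_weight ((\<lambda>x. x + k) ` A) = 2 powi k * two_weight A"
  unfolding two_weight_def by (subst sum.reindex) (auto intro: inj_onI simp: power_int_add sum_distrib_left mult.commute)

lemma two_weight_Un_Int:
  "finite A \<Longrightarrow> finite B \<Longrightarrow> two_weight A + two_weight B = two_weight (A \<union> B) + two_weight (A \<inter> B)"
  unfolding two_weight_def by (rule sum.union_inter[symmetric])

context C_fock
begin

text \<open>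
  Exchanging beads and gaps realises the diagram automorphism \<open>j \<mapsto> n - j\<close>. It turns \<open>(\<mu>, \<nu>)\<close> into
  \<open>(\<nu> + n, \<mu> - n)\<close>, so the ballot condition also yields the second interlacing condition.
\<close>

definition refl_pos :: "int \<Rightarrow> int" where
  "refl_pos x = 3 * int n - 1 - x"

lemma refl_pos_refl_pos [simp]: "refl_pos (refl_pos x) = x"
  by (simp add: refl_pos_def)

definition reflect :: "maya \<Rightarrow> maya" where
  "reflect S = Abs_maya {x. refl_pos x \<notin> beads S}"

lemma beads_reflect [simp]: "beads (reflect S) = {x. refl_pos x \<notin> beads S}"
  unfolding reflect_def
proof (rule Abs_maya_inverse, intro CollectI conjI)
  obtain b c where S: "confined b c S" by (rule ex_confined)
  have "refl_pos x \<notin> beads S" if "x < refl_pos c" for x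
    using that confinedD(2)[OF S, of "refl_pos x"] by (auto simp: refl_pos_def)
  then show "\<exists>b. \<forall>x<b. x \<in> {x. refl_pos x \<notin> beads S}" by blast
  have "refl_pos x \<in> beads S" if "x > refl_pos b" for x
    using that confinedD(1)[OF S, of "refl_pos x"] by (force simp: refl_pos_def)
  then show "\<exists>c. \<forall>x>c. x \<notin> {x. refl_pos x \<notin> beads S}" by blast
qed

lemma reflect_reflect [simp]: "reflect (reflect S) = S"
  by (rule maya_eqI) simp

lemma resid_refl: "j \<le> n \<Longrightarrow> resid (n - j) (3 * int n - x) \<longleftrightarrow> resid j x"
proof -
  assume j: "j \<le> n"
  have "resid (n - j) (3 * int n - x) \<longleftrightarrow> per dvd per - (x - int j) \<or> per dvd per * 2 - (x + int j)"
    unfolding resid_def using j by (simp add: algebra_simps of_nat_diff)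
  also have "\<dots> \<longleftrightarrow> resid j x" unfolding resid_def
    by (simp add: dvd_diff_right_iff)
  finally show ?thesis .
qed

text \<open>An upward move of a bead is a downward move of a gap, and the reflection turns it upward
  again. Moves between neighbours carry no signs, so none have to be compared.\<close>

lemma F_reflect:
  assumes "j \<le> n"
  shows "(\<lambda>S. F j w (reflect S)) = F (n - j) (\<lambda>S. w (reflect S))"
proof
  fix S
  show "F j w (reflect S) = F (n - j) (\<lambda>S. w (reflect S)) S"
    unfolding F_at
  proof (rule sum.reindex_bij_witness[of _ "\<lambda>q. refl_pos (q + 1)" "\<lambda>p. refl_pos (p + 1)"])
    fix p assume p: "p \<in> {p. resid j (p + 1) \<and> p \<notin> beads (reflect S) \<and> p + 1 \<in> beads (reflect S)}"
    have r: "refl_pos (p + 1) + 1 = refl_pos p" by (simp add: refl_pos_def)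
    have r': "refl_pos p = 3 * int n - (p + 1)" by (simp add: refl_pos_def)
    show "refl_pos (refl_pos (p + 1) + 1) = p" by (simp add: r)
    show "refl_pos (p + 1) \<in> {q. resid (n - j) (q + 1) \<and> q \<notin> beads S \<and> q + 1 \<in> beads S}"
      using p resid_refl[OF assms, of "p + 1"] by (simp add: r) (simp add: r')
    have "reflect (ins (refl_pos (p + 1)) (del (refl_pos (p + 1) + 1) S)) = ins p (del (p + 1) (reflect S))"
      using p unfolding r by (intro maya_eqI) (auto simp: refl_pos_def)
    then show "w (reflect (ins (refl_pos (p + 1)) (del (refl_pos (p + 1) + 1) S))) = w (ins p (del (p + 1) (reflect S)))"
      by simp
  next
    fix q assume q: "q \<in> {q. resid (n - j) (q + 1) \<and> q \<notin> beads S \<and> q + 1 \<in> beads S}"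
    have r: "refl_pos (q + 1) + 1 = refl_pos q" by (simp add: refl_pos_def)
    have r': "q + 1 = 3 * int n - refl_pos q" by (simp add: refl_pos_def)
    show "refl_pos (refl_pos (q + 1) + 1) = q" by (simp add: r)
    show "refl_pos (q + 1) \<in> {p. resid j (p + 1) \<and> p \<notin> beads (reflect S) \<and> p + 1 \<in> beads (reflect S)}"
      using q resid_refl[OF assms, of "refl_pos q"] unfolding r'[symmetric] by (simp add: r)
  qed
qed

text \<open>The constant 3n in \<open>refl_pos\<close>, congruent to -n modulo 2n, maps the filling
  levels from n to 2n onto the same range, so \<open>leading_ballot\<close> applies on both
  sides.\<close>

lemma reflect_Mod: "w \<in> Mod c \<Longrightarrow> (\<lambda>S. w (reflect S)) \<in> Mod (3 * int n - c)"
proof (induction rule: Mod.induct)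
  case Mod_vac
  have "reflect S = sea c \<longleftrightarrow> S = sea (3 * int n - c)" for S
  proof -
    have "reflect (sea c) = sea (3 * int n - c)" by (rule maya_eqI) (auto simp: refl_pos_def)
    then show ?thesis by (metis reflect_reflect)
  qed
  then have "(\<lambda>S. vac c (reflect S)) = vac (3 * int n - c)" by (simp add: vac_def fun_eq_iff)
  then show ?case by (simp add: Mod.Mod_vac)
next
  case (Mod_F w j)
  then show ?case using Mod.Mod_F[of _ _ "n - j"] by (simp add: F_reflect)
next
  case (Mod_add w u)
  then show ?case using Mod.Mod_add[OF Mod_add.IH] by (simp add: plus_fun_def)
next
  case (Mod_scale w a)
  then show ?case using Mod.Mod_scale[OF Mod_scale.IH] by simp
qed

lemma particles_reflect: "particles (3 * int n - c) (reflect S) = (\<lambda>x. x + int n) ` nus c S"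
proof (rule set_eqI)
  fix x
  have "x \<in> (\<lambda>x. x + int n) ` nus c S \<longleftrightarrow> x - int n \<in> nus c S" by force
  also have "\<dots> \<longleftrightarrow> bar (x - int n) \<in> holes c S" by (simp only: bar_mem_holes_iff)
  also have "bar (x - int n) = refl_pos x" by (simp add: refl_pos_def)
  also have "refl_pos x \<in> holes c S \<longleftrightarrow> x \<in> particles (3 * int n - c) (reflect S)"
    by (auto simp: holes_def particles_def refl_pos_def)
  finally show "x \<in> particles (3 * int n - c) (reflect S) \<longleftrightarrow> x \<in> (\<lambda>x. x + int n) ` nus c S" by simp
qed

lemma nus_reflect: "nus (3 * int n - c) (reflect S) = (\<lambda>x. x - int n) ` particles c S"
proof (rule set_eqI)
  fix x
  have "x \<in> (\<lambda>x. x - int n) ` particles c S \<longleftrightarrow> x + int n \<in> particles c S" by force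
  also have "\<dots> \<longleftrightarrow> refl_pos (bar x) \<in> beads S \<and> bar x < 3 * int n - c"
    by (auto simp: particles_def refl_pos_def algebra_simps)
  also have "\<dots> \<longleftrightarrow> bar x \<in> holes (3 * int n - c) (reflect S)" by (auto simp: holes_def)
  finally show "x \<in> nus (3 * int n - c) (reflect S) \<longleftrightarrow> x \<in> (\<lambda>x. x - int n) ` particles c S"
    by (simp only: bar_mem_holes_iff)
qed

definition base :: real where
  "base = 2 powi per"

lemma base_ge: "4 \<le> base"
proof -
  have "(2::real) powi 2 \<le> 2 powi per" using n_pos by (intro power_int_increasing) auto
  then show ?thesis by (simp add: base_def)
qed

text \<open>
  With these coefficients, minimising \<open>Phi\<close> maximises \<open>two_weight \<mu>\<close> when \<open>\<mu> \<union> \<nu>\<close> is fixed and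
  \<open>two_weight \<nu>\<close> when \<open>\<mu> \<union> (\<nu> + 2n)\<close> is fixed, as both raising operators require.
\<close>

definition Phi :: "int \<Rightarrow> maya \<Rightarrow> real" where
  "Phi c S = (base + 1) * two_weight (particles c S) + 2 * base * two_weight (nus c S)"

text \<open>The two ballot conditions are \<open>leading_ballot\<close> for the vector and for its
  reflection, at the same chosen diagram. Reflection exchanges particles and holes, but charge zero
  preserves the maximality of their number.\<close>

lemma leading_term:
  assumes w: "w \<in> Mod c" and c: "int n \<le> c" "c \<le> per" and nz: "w \<noteq> 0"
  obtains S where "w S \<noteq> 0"
    and "\<And>S'. w S' \<noteq> 0 \<Longrightarrow> card (particles c S') < card (particles c S) \<or>
       card (particles c S') = card (particles c S) \<and> Phi c S \<le> Phi c S'"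
    and "\<And>m. card {b \<in> nus c S. m \<le> b} \<le> card {a \<in> particles c S. m \<le> a}"
    and "\<And>m. card {a \<in> particles c S. m \<le> a} \<le> card {b \<in> nus c S. m - per \<le> b}"
proof -
  let ?Z = "{S. w S \<noteq> 0}"
  have Z: "finite ?Z" "?Z \<noteq> {}" using finite_support_Mod[OF w] nz by (auto simp: fun_eq_iff)
  define L where "L = Max ((\<lambda>S. card (particles c S)) ` ?Z)"
  define Z' where "Z' = {S \<in> ?Z. card (particles c S) = L}"
  have L: "card (particles c S) \<le> L" if "w S \<noteq> 0" for S using Z that by (auto simp: L_def)
  have "L \<in> (\<lambda>S. card (particles c S)) ` ?Z" unfolding L_def using Z by (intro Max_in) auto
  then have Z': "finite Z'" "Z' \<noteq> {}" using Z by (auto simp: Z'_def)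
  have "Min (Phi c ` Z') \<in> Phi c ` Z'" using Z' by (intro Min_in) auto
  then obtain S where S: "S \<in> Z'" "Phi c S = Min (Phi c ` Z')" by auto
  have wS: "w S \<noteq> 0" and cS: "card (particles c S) = L" using S(1) by (auto simp: Z'_def)
  have min: "Phi c S \<le> Phi c S'" if "w S' \<noteq> 0" "card (particles c S') = L" for S'
    using that Z'(1) by (auto simp: S(2) Z'_def)
  have bal1: "card {b \<in> nus c S. m \<le> b} \<le> card {a \<in> particles c S. m \<le> a}" for m
  proof (rule leading_ballot[OF w c(1) wS])
    fix S' assume S': "w S' \<noteq> 0" "card (particles c S') = card (particles c S)"
      "particles c S' \<union> nus c S' = particles c S \<union> nus c S"
      "particles c S' \<inter> nus c S' = particles c S \<inter> nus c S"
    define x x' y y' where "x = two_weight (particles c S)" and "x' = two_weight (particles c S')"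
      and "y = two_weight (nus c S)" and "y' = two_weight (nus c S')"
    have K: "x' + y' = x + y"
      using two_weight_Un_Int[of "particles c S" "nus c S"] two_weight_Un_Int[of "particles c S'" "nus c S'"] S'(3,4)
      by (simp add: x_def x'_def y_def y'_def)
    have "(base + 1) * x + 2 * base * y \<le> (base + 1) * x' + 2 * base * y'"
      using min[OF S'(1)] S'(2) cS by (simp add: Phi_def x_def x'_def y_def y'_def)
    moreover have "y' = x + y - x'" using K by simp
    ultimately have "(base - 1) * x' \<le> (base - 1) * x" by (simp add: algebra_simps)
    then show "two_weight (particles c S') \<le> two_weight (particles c S)" using base_ge by (simp add: x_def x'_def)
  qed (use L cS in auto)
  have bal2: "card {a \<in> particles c S. m \<le> a} \<le> card {b \<in> nus c S. m - per \<le> b}" for m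
  proof -
    let ?c = "3 * int n - c" and ?w = "\<lambda>S. w (reflect S)"
    have cp: "card (particles ?c (reflect S)) = card (nus c S)" for S
      unfolding particles_reflect by (rule card_image) (auto intro: inj_onI)
    have cp': "card (particles ?c S') = card (particles c (reflect S'))" if "?w S' \<noteq> 0" for S'
      using cp[of "reflect S'"] card_particles_Mod[OF w that] by simp
    have w0: "?w (reflect S) \<noteq> 0" using wS by simp
    have "card {b \<in> nus ?c (reflect S). m - int n \<le> b} \<le> card {a \<in> particles ?c (reflect S). m - int n \<le> a}"
    proof (rule leading_ballot[OF reflect_Mod[OF w] _ w0])
      show "int n \<le> ?c" using c by simp
      show "card (particles ?c S') \<le> card (particles ?c (reflect S))" if "?w S' \<noteq> 0" for S'
        using cp'[OF that] cp'[OF w0] L[OF that] cS by simp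
      fix S' assume S': "?w S' \<noteq> 0" "card (particles ?c S') = card (particles ?c (reflect S))"
        "particles ?c S' \<union> nus ?c S' = particles ?c (reflect S) \<union> nus ?c (reflect S)"
        "particles ?c S' \<inter> nus ?c S' = particles ?c (reflect S) \<inter> nus ?c (reflect S)"
      define T where "T = reflect S'"
      have T: "S' = reflect T" by (simp add: T_def)
      define x x' y y' where "x = two_weight (particles c S)" and "x' = two_weight (particles c T)"
        and "y = two_weight (nus c S)" and "y' = two_weight (nus c T)"
      have sh: "two_weight (particles ?c (reflect S)) = 2 powi int n * two_weight (nus c S)"
        "two_weight (nus ?c (reflect S)) = 2 powi (- int n) * two_weight (particles c S)" for S
        unfolding particles_reflect nus_reflect two_weight_shift[symmetric] by simp_all
      have N: "base = 2 powi int n * 2 powi int n" unfolding base_def mult_2 by (rule power_int_add) simp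
      have "2 powi int n * y' + 2 powi (- int n) * x' = 2 powi int n * y + 2 powi (- int n) * x"
        using two_weight_Un_Int[of "particles ?c (reflect S)" "nus ?c (reflect S)"] two_weight_Un_Int[of "particles ?c S'" "nus ?c S'"] S'(3,4)
        unfolding T sh by (simp add: x_def x'_def y_def y'_def)
      then have "2 powi int n * (2 powi int n * y' + 2 powi (- int n) * x') = 2 powi int n * (2 powi int n * y + 2 powi (- int n) * x)"
        by simp
      moreover have "2 powi int n * 2 powi (- int n) = (1::real)" by (simp add: power_int_minus)
      ultimately have K: "base * y' + x' = base * y + x"
        unfolding N distrib_left mult.assoc[symmetric] by simp
      have "card (particles c T) = L" using cp'[OF S'(1)] S'(2) cp'[OF w0] cS by (simp add: T_def)
      then have "(base + 1) * x + 2 * base * y \<le> (base + 1) * x' + 2 * base * y'"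
        using min[of T] S'(1) by (simp add: Phi_def x_def x'_def y_def y'_def T_def)
      moreover have "x' = base * y + x - base * y'" using K by simp
      ultimately have "(base * (base - 1)) * y' \<le> (base * (base - 1)) * y" by (simp add: algebra_simps)
      moreover have "base * (base - 1) > 0" using base_ge by simp
      ultimately have "y' \<le> y" by (simp add: mult_le_cancel_left)
      then show "two_weight (particles ?c S') \<le> two_weight (particles ?c (reflect S))"
        unfolding T sh by (simp add: y_def y'_def)
    qed
    moreover have "{b \<in> nus ?c (reflect S). m - int n \<le> b} = (\<lambda>x. x - int n) ` {a \<in> particles c S. m \<le> a}"
      unfolding nus_reflect by auto
    moreover have "{a \<in> particles ?c (reflect S). m - int n \<le> a} = (\<lambda>x. x + int n) ` {b \<in> nus c S. m - per \<le> b}"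
      unfolding particles_reflect by auto
    ultimately show ?thesis by (simp add: card_image inj_on_def)
  qed
  show ?thesis
  proof (rule that[OF wS _ bal1 bal2])
    show "card (particles c S') < card (particles c S) \<or> card (particles c S') = card (particles c S) \<and> Phi c S \<le> Phi c S'"
      if "w S' \<noteq> 0" for S'
      using L[OF that] min[OF that] cS by linarith
  qed
qed

end

section \<open>Lower bound: vectors with prescribed leading term\<close>

context C_fock
begin

section \<open>Root vectors that preserve the vacuum module\<close>

lemma resid_iff: "resid j q \<Longrightarrow> resid j p \<longleftrightarrow> per dvd p - q \<or> per dvd p + q"
proof -
  assume q: "resid j q"
  show ?thesis
  proof
    assume p: "resid j p"
    from p q consider "per dvd p - int j" "per dvd q - int j"
      | "per dvd p - int j" "per dvd q + int j"
      | "per dvd p + int j" "per dvd q - int j"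
      | "per dvd p + int j" "per dvd q + int j"
      unfolding resid_def by blast
    then show "per dvd p - q \<or> per dvd p + q"
    proof cases
      case 1 from dvd_diff[OF this] show ?thesis by simp
    next
      case 2 from dvd_add[OF this] show ?thesis by simp
    next
      case 3 from dvd_add[OF this] show ?thesis by simp
    next
      case 4 from dvd_diff[OF this] show ?thesis by simp
    qed
  next
    assume "per dvd p - q \<or> per dvd p + q"
    then show "resid j p" using q resid_cong[of p q j] resid_cong[of p "- q" j] by (auto simp: resid_uminus)
  qed
qed

definition ind :: "int \<Rightarrow> int \<Rightarrow> complex" where
  "ind r p = of_bool (per dvd p - r)"

text \<open>
  Coefficients of the root vectors of the affine algebra that lower the principal degree by \<open>k\<close>;
  each is obtained from degree \<open>k - 1\<close> by a commutator with some \<open>F j\<close>.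
\<close>

definition gen :: "int \<Rightarrow> int \<Rightarrow> int \<Rightarrow> complex" where
  "gen k r p = ind r p + sgi (k + 1) * ind (- 1 - k - r) p"

lemma ind_cong: "per dvd r - r' \<Longrightarrow> ind r p = ind r' p"
proof -
  assume d: "per dvd r - r'"
  have "p - r' = (r - r') + (p - r)" by simp
  then have "per dvd p - r' \<longleftrightarrow> per dvd p - r" using d by (metis dvd_add_right_iff)
  then show ?thesis by (simp add: ind_def)
qed

lemma gen_cong: "per dvd r - r' \<Longrightarrow> gen k r = gen k r'"
proof -
  assume d: "per dvd r - r'"
  then have "per dvd (- 1 - k - r) - (- 1 - k - r')" by (simp add: dvd_diff_commute)
  from ind_cong[OF d] ind_cong[OF this] show ?thesis by (simp add: gen_def fun_eq_iff)
qed

definition stable :: "int \<Rightarrow> int \<Rightarrow> (int \<Rightarrow> complex) \<Rightarrow> bool" where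
  "stable c k g \<longleftrightarrow> (\<forall>w\<in>Mod c. shift_op k g w \<in> Mod c)"

lemma Mod_diff: "w \<in> Mod c \<Longrightarrow> u \<in> Mod c \<Longrightarrow> w - u \<in> Mod c"
  using Mod.Mod_add[of w c "\<lambda>S. (- 1) * u S"] Mod.Mod_scale[of u c "- 1"]
  by (simp add: fun_diff_def plus_fun_def)

lemma stable_scale: "stable c k g \<Longrightarrow> stable c k (\<lambda>p. a * g p)"
  by (simp add: stable_def shift_op_linear Mod.Mod_scale)

lemma stable_add: "stable c k g \<Longrightarrow> stable c k g' \<Longrightarrow> stable c k (\<lambda>p. g p + g' p)"
  by (simp add: stable_def shift_op_linear Mod.Mod_add)

lemma stable_commutator:
  assumes "stable c k f" "stable c l g" "k \<noteq> 0" "l \<noteq> 0" "k + l \<noteq> 0"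
  shows "stable c (k + l) (\<lambda>p. f (p + l) * g p - f p * g (p + k))"
  unfolding stable_def shift_op_commutator[OF assms(3-5), symmetric]
  using assms(1,2) by (auto simp: stable_def intro!: Mod_diff)

lemma stable_F: "j \<le> n \<Longrightarrow> stable c 1 (\<lambda>p. chi j (p + 1))"
  using Mod.Mod_F by (auto simp: stable_def F_def)

text \<open>The second summand of \<open>gen\<close> is the mirror image under \<open>bar\<close> of
  the move from \<open>r\<close> to \<open>r + k\<close>. A commutator with \<open>F j\<close>
  lengthens that move at its upper end, and also at its lower end when \<open>r\<close> lies in
  class \<open>j\<close> too.\<close>

lemma stable_gen_step:
  assumes k: "1 \<le> k" and st: "stable c k (gen k r)" and j: "j \<le> n" "resid j (r + k + 1)"
  shows "stable c (k + 1) (\<lambda>p. gen (k + 1) r p - chi j r * gen (k + 1) (r - 1) p)"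
proof -
  have "chi j (p + k + 1) * gen k r p - chi j (p + 1) * gen k r (p + 1)
     = gen (k + 1) r p - chi j r * gen (k + 1) (r - 1) p" for p
  proof -
    have 1: "chi j (p + k + 1) * ind r p = ind r p"
      using resid_cong[of "p + k + 1" "r + k + 1" j] j by (simp add: ind_def algebra_simps)
    have 2: "chi j (p + k + 1) * ind (- 1 - k - r) p = chi j r * ind (- 1 - k - r) p"
      using resid_cong[of "p + k + 1" "- r" j] by (auto simp: ind_def resid_uminus algebra_simps)
    have 3: "chi j (p + 1) * ind r (p + 1) = chi j r * ind (r - 1) p"
      using resid_cong[of "p + 1" r j] by (auto simp: ind_def algebra_simps)
    have 4: "chi j (p + 1) * ind (- 1 - k - r) (p + 1) = ind (- 2 - k - r) p"
    proof -
      have e: "p + 1 - (- (r + k + 1)) = p - (- 2 - k - r)" "p + 1 - (- 1 - k - r) = p - (- 2 - k - r)" by simp_all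
      have "resid j (- (r + k + 1))" using j(2) by (simp only: resid_uminus)
      then have h: "per dvd p - (- 2 - k - r) \<Longrightarrow> resid j (p + 1)"
        using resid_cong[of "p + 1" "- (r + k + 1)" j, unfolded e(1)] by blast
      show ?thesis unfolding ind_def e(2)
        by (cases "per dvd p - (- 2 - k - r)") (simp_all only: h of_bool_eq mult_1 mult_zero_right)
    qed
    have 5: "ind (- 1 - (k + 1) - (r - 1)) p = ind (- 1 - k - r) p" "ind (- 1 - (k + 1) - r) p = ind (- 2 - k - r) p"
      by (rule arg_cong[of _ _ "\<lambda>x. ind x p"], simp)+
    have arrange: "x + s * (q * y) - q * z - s * t = x + (- s) * t - q * (z + (- s) * y)" for x y z s t q :: complex
      by (simp add: algebra_simps)
    have 6: "sgi (k + 1 + 1) = - sgi (k + 1)" by (simp add: sgi_def)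
    have "chi j (p + k + 1) * gen k r p - chi j (p + 1) * gen k r (p + 1)
      = chi j (p + k + 1) * ind r p + sgi (k + 1) * (chi j (p + k + 1) * ind (- 1 - k - r) p)
        - chi j (p + 1) * ind r (p + 1) - sgi (k + 1) * (chi j (p + 1) * ind (- 1 - k - r) (p + 1))"
      unfolding gen_def by (simp only: algebra_simps)
    also have "\<dots> = ind r p + sgi (k + 1) * (chi j r * ind (- 1 - k - r) p) - chi j r * ind (r - 1) p - sgi (k + 1) * ind (- 2 - k - r) p"
      unfolding 1 2 3 4 ..
    also have "\<dots> = gen (k + 1) r p - chi j r * gen (k + 1) (r - 1) p"
      unfolding gen_def 5 6 by (rule arrange)
    finally show ?thesis .
  qed
  moreover have "stable c (1 + k) (\<lambda>p. chi j (p + k + 1) * gen k r p - chi j (p + 1) * gen k r (p + 1))"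
    using stable_commutator[OF stable_F[OF j(1)] st] k by simp
  ultimately show ?thesis by (simp add: add.commute)
qed

text \<open>With \<open>j\<close> the class of \<open>r + k + 1\<close>, the unwanted term of
  \<open>stable_gen_step\<close> occurs only if 2n divides 2r+k+1 or k+1. In the first case it is
  the negative of the wanted one and merely doubles it. In the second, the imaginary root
  directions, only differences of consecutive \<open>r\<close> are obtained directly; they are
  summed from r = 0, which belongs to the first case.\<close>

lemma stable_gen: "1 \<le> k \<Longrightarrow> stable c k (gen k r)"
proof (induction k arbitrary: r rule: int_ge_induct)
  case base
  obtain j where j: "j \<le> n" "resid j (r + 1)" using ex_resid by blast
  \<comment> \<open>The factor 2 belongs to the long simple roots, where both summands of
    \<open>gen\<close> have the same support.\<close>
  have "gen 1 r = (\<lambda>p. (if per dvd 2 * r + 2 then 2 else 1) * chi j (p + 1))"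
  proof
    fix p
    have e: "resid j (p + 1) \<longleftrightarrow> per dvd p - r \<or> per dvd p + r + 2"
      using resid_iff[OF j(2), of "p + 1"] by (simp add: algebra_simps)
    have s: "p + r + 2 = (p - r) + (2 * r + 2)" by simp
    have "p - (- 1 - 1 - r) = p + r + 2" by simp
    then have "ind (- 1 - 1 - r) p = of_bool (per dvd p + r + 2)" by (simp only: ind_def)
    then have g: "gen 1 r p = of_bool (per dvd p - r) + of_bool (per dvd p + r + 2)"
      unfolding gen_def by (simp add: sgi_def ind_def[of r])
    show "gen 1 r p = (if per dvd 2 * r + 2 then 2 else 1) * chi j (p + 1)"
    proof (cases "per dvd p - r")
      case True
      then have "per dvd p + r + 2 \<longleftrightarrow> per dvd 2 * r + 2" unfolding s by (rule dvd_add_right_iff)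
      then show ?thesis using True unfolding g e by auto
    next
      case False
      then have "\<not> (per dvd p + r + 2 \<and> per dvd 2 * r + 2)" unfolding s using dvd_add_left_iff by blast
      then show ?thesis using False unfolding g e by auto
    qed
  qed
  then show ?case using stable_scale[OF stable_F[OF j(1)]] by metis
next
  case (step k)
  have ex: "\<exists>j\<le>n. resid j (r + k + 1)" for r using ex_resid by blast
  have main: "stable c (k + 1) (\<lambda>p. gen (k + 1) r p - chi j r * gen (k + 1) (r - 1) p)" if "j \<le> n" "resid j (r + k + 1)" for r j
    using stable_gen_step[OF step.hyps step.IH that] .
  have special: "stable c (k + 1) (gen (k + 1) r)" if d: "per dvd 2 * r + k + 1" for r
  proof -
    obtain j where j: "j \<le> n" "resid j (r + k + 1)" using ex by blast
    have "resid j r" using resid_iff[OF j(2), of r] d by (simp add: algebra_simps)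
    have "even (2 * r + k + 1)" using d by (meson dvd_trans dvd_triv_left)
    then have odd: "sgi (k + 1 + 1) = - 1" by (simp add: sgi_def)
    have "per dvd (- 1 - (k + 1) - r) - (r - 1)"
    proof -
      have "(- 1 - (k + 1) - r) - (r - 1) = - (2 * r + k + 1)" by simp
      then show ?thesis using d by (metis dvd_minus_iff)
    qed
    then have 1: "ind (- 1 - (k + 1) - r) p = ind (r - 1) p" for p by (rule ind_cong)
    have "per dvd (- 1 - (k + 1) - (r - 1)) - r"
    proof -
      have "(- 1 - (k + 1) - (r - 1)) - r = - (2 * r + k + 1)" by simp
      then show ?thesis using d by (metis dvd_minus_iff)
    qed
    then have 2: "ind (- 1 - (k + 1) - (r - 1)) p = ind r p" for p by (rule ind_cong)
    have "gen (k + 1) r = (\<lambda>p. (1 / 2) * (gen (k + 1) r p - chi j r * gen (k + 1) (r - 1) p))"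
      using \<open>resid j r\<close> unfolding gen_def 1 2 odd by auto
    then show ?thesis using stable_scale[OF main[OF j], of "1 / 2"] by simp
  qed
  show ?case
  proof (cases "per dvd k + 1")
    case True
    have nat: "stable c (k + 1) (gen (k + 1) (int m))" for m
    proof (induction m)
      case 0
      then show ?case using special[of 0] True by simp
    next
      case (Suc m)
      obtain j where j: "j \<le> n" "resid j (int (Suc m) + k + 1)" using ex by blast
      have "resid j (int (Suc m))" using resid_iff[OF j(2), of "int (Suc m)"] True
        by (simp add: algebra_simps) (metis add.commute dvd_minus_iff minus_add_distrib uminus_add_conv_diff)
      then have "gen (k + 1) (int (Suc m)) = (\<lambda>p. (gen (k + 1) (int (Suc m)) p - chi j (int (Suc m)) * gen (k + 1) (int (Suc m) - 1) p) + gen (k + 1) (int m) p)"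
        by (auto simp: fun_eq_iff)
      then show ?case using stable_add[OF main[OF j] Suc] by simp
    qed
    have "gen (k + 1) r = gen (k + 1) (int (nat (r mod per)))"
      using n_pos by (intro gen_cong) simp
    then show ?thesis using nat by metis
  next
    case False
    obtain j where j: "j \<le> n" "resid j (r + k + 1)" using ex by blast
    show ?thesis
    proof (cases "resid j r")
      case True
      then have "per dvd r - (r + k + 1) \<or> per dvd 2 * r + k + 1"
        using resid_iff[OF j(2), of r] by (simp add: algebra_simps)
      moreover have "r - (r + k + 1) = - (k + 1)" by simp
      then have "\<not> per dvd r - (r + k + 1)" using False by (metis dvd_minus_iff)
      ultimately show ?thesis using special by blast
    next
      case False
      then show ?thesis using main[OF j] by simp
    qed
  qed
qed

section \<open>Minimality of \<open>phi\<close> on the fundamental alcove\<close>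

definition phi :: "int \<Rightarrow> int \<Rightarrow> real" where
  "phi a b = (base + 1) * 2 powi a + 2 * base * 2 powi b"

lemma powi_shift: "2 powi (a + per) = base * 2 powi a"
  by (simp add: base_def power_int_add)

lemma powi_mono: "a \<le> b \<Longrightarrow> (2::real) powi a \<le> 2 powi b"
  by (rule power_int_increasing) auto

text \<open>
  The condition \<open>0 \<le> a - b \<le> 2n\<close> selects the fundamental alcove of the affine Weyl group of \<open>sl\<^sub>2\<close>,
  where \<open>phi\<close> is smallest on each orbit.
\<close>

lemma phi_min:
  assumes ab: "b \<le> a" "a \<le> b + per" and s: "a' + b' = a + b"
    and d: "per dvd b' - b \<or> per dvd b' - a"
  shows "phi a b < phi a' b' \<or> a' = a \<and> b' = b"
proof -
  define x y where "x = (2::real) powi a" and "y = (2::real) powi b"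
  have pos: "x > 0" "y > 0" by (simp_all add: x_def y_def)
  have yx: "y \<le> x" "x \<le> base * y" using powi_mono[OF ab(1)] powi_mono[OF ab(2)] by (simp_all add: x_def y_def powi_shift)
  have N: "base \<ge> 4" "base > 0" using base_ge by auto
  have NN4: "4 * base \<le> base * base" using N by (intro mult_right_mono) auto
  have pos': "(2::real) powi a' > 0" "(2::real) powi b' > 0" by simp_all
  have ub1: "phi a b \<le> (3 * base + 1) * x"
  proof -
    have "2 * base * y \<le> 2 * base * x" using yx N by (intro mult_left_mono) auto
    then show ?thesis by (simp add: phi_def x_def[symmetric] y_def[symmetric] algebra_simps)
  qed
  have ub2: "phi a b \<le> (base * base + 3 * base) * y"
  proof -
    have "(base + 1) * x \<le> (base + 1) * (base * y)" using yx N by (intro mult_left_mono) auto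
    then show ?thesis by (simp add: phi_def x_def[symmetric] y_def[symmetric] algebra_simps)
  qed
  \<comment> \<open>Raising either coordinate by a full period already outweighs the upper bounds
    \<open>ub1\<close> and \<open>ub2\<close>. Only the identity and the reflections in the two
    walls of the alcove remain to be compared exactly.\<close>
  have big_a: "phi a b < phi a' b'" if "a + per \<le> a'"
  proof -
    have "base * x \<le> 2 powi a'" using powi_mono[OF that] by (simp add: powi_shift x_def)
    then have "(base + 1) * (base * x) \<le> (base + 1) * 2 powi a'" using N by (intro mult_left_mono) auto
    also have "\<dots> < phi a' b'" using N pos' by (simp add: phi_def)
    finally have "(base * base + base) * x < phi a' b'" by (simp add: algebra_simps)
    moreover have "3 * base + 1 \<le> base * base + base" using NN4 N by linarith
    then have "(3 * base + 1) * x \<le> (base * base + base) * x" using pos by (intro mult_right_mono) auto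
    ultimately show ?thesis using ub1 by linarith
  qed
  have big_b: "phi a b < phi a' b'" if "b + per \<le> b'"
  proof -
    have "base * y \<le> 2 powi b'" using powi_mono[OF that] by (simp add: powi_shift y_def)
    then have "2 * base * (base * y) \<le> 2 * base * 2 powi b'" using N by (intro mult_left_mono) auto
    also have "\<dots> < phi a' b'" using N pos' by (simp add: phi_def)
    finally have "(2 * (base * base)) * y < phi a' b'" by (simp add: algebra_simps)
    moreover have "(base * base + 3 * base) * y \<le> (2 * (base * base)) * y" using NN4 N pos by (intro mult_right_mono) auto
    ultimately show ?thesis using ub2 by linarith
  qed
  from d show ?thesis
  proof
    assume "per dvd b' - b"
    then obtain m where m: "b' = b + per * m" by (auto simp: dvd_def algebra_simps)
    consider "m = 0" | "1 \<le> m" | "m \<le> - 1" by linarith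
    then show ?thesis
    proof cases
      case 1 then show ?thesis using m s by simp
    next
      case 2
      then have "per * 1 \<le> per * m" by (intro mult_left_mono) auto
      then have "b + per \<le> b'" using m by linarith
      then show ?thesis using big_b by blast
    next
      case 3
      then have "per * m \<le> per * (- 1)" by (intro mult_left_mono) auto
      then have "a + per \<le> a'" using m s by linarith
      then show ?thesis using big_a by blast
    qed
  next
    assume "per dvd b' - a"
    then obtain m where m: "b' = a + per * m" by (auto simp: dvd_def algebra_simps)
    \<comment> \<open>The values 0 and -1 are the two wall reflections. There the difference of the
      values of \<open>phi\<close> is base - 1 times x - y or base * y - x, and it vanishes only on
      the wall, where the pair is fixed.\<close>
    consider "m = 0" | "m = - 1" | "1 \<le> m" | "m \<le> - 2" by linarith
    then show ?thesis
    proof cases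
      case 1
      then have ab': "a' = b" "b' = a" using m s by auto
      have "phi a' b' - phi a b = (base - 1) * (x - y)"
        by (simp add: phi_def ab' x_def y_def algebra_simps)
      moreover have "(base - 1) * (x - y) > 0" if "a \<noteq> b"
      proof -
        have "y < x" unfolding x_def y_def using that ab by (intro power_int_strict_increasing) auto
        then show ?thesis using N by simp
      qed
      ultimately show ?thesis using ab' by (cases "a = b") auto
    next
      case 2
      then have ab': "a' = b + per" "a = b' + per" using m s by auto
      have x: "x = base * 2 powi b'" by (simp add: x_def ab'(2) powi_shift)
      have "phi a' b' - phi a b = (base - 1) * (base * y - x)"
        unfolding phi_def ab'(1) powi_shift x_def[symmetric] y_def[symmetric] using x by (simp add: algebra_simps)
      moreover have "(base - 1) * (base * y - x) > 0" if "a \<noteq> b + per"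
      proof -
        have "x < 2 powi (b + per)" unfolding x_def using that ab by (intro power_int_strict_increasing) auto
        then have "x < base * y" by (simp add: powi_shift y_def)
        then show ?thesis using N by simp
      qed
      ultimately show ?thesis using ab' by (cases "a = b + per") auto
    next
      case 3
      then have "per * 1 \<le> per * m" by (intro mult_left_mono) auto
      then have "b + per \<le> b'" using m ab by linarith
      then show ?thesis using big_b by blast
    next
      case 4
      then have "per * m \<le> per * (- 2)" by (intro mult_left_mono) auto
      then have "a + per \<le> a'" using m s ab by linarith
      then show ?thesis using big_a by blast
    qed
  qed
qed

section \<open>Triangular construction of vectors in the module\<close>

lemma config_empty: "config c {} {} = sea c"
  by (rule maya_eqI) (simp add: beads_config)

lemma move_across:
  assumes p: "p \<notin> beads S" "q \<in> beads S" "p < c" "c \<le> q"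
  defines "S' \<equiv> ins p (del q S)"
  shows "card (particles c S) = Suc (card (particles c S'))"
    and "Phi c S = Phi c S' + phi q (bar p)"
proof -
  have P: "particles c S = insert q (particles c S')" "q \<notin> particles c S'"
    using p by (auto simp: S'_def particles_def)
  have "holes c S = insert p (holes c S')" "p \<notin> holes c S'"
    using p by (auto simp: S'_def holes_def)
  then have Q: "nus c S = insert (bar p) (nus c S')" "bar p \<notin> nus c S'"
    by (auto simp: nus_def)
  show "card (particles c S) = Suc (card (particles c S'))" using P by simp
  show "Phi c S = Phi c S' + phi q (bar p)"
    using P Q by (simp add: Phi_def phi_def two_weight_def algebra_simps)
qed

lemma move_not_across:
  assumes p: "p \<notin> beads S" "q \<in> beads S" "\<not> (p < c \<and> c \<le> q)"
  defines "S' \<equiv> ins p (del q S)"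
  shows "card (particles c S) \<le> card (particles c S')"
proof (cases "c \<le> q")
  case True
  then have "particles c S = insert q (particles c S' - {p})" "p \<in> particles c S'"
    using p by (auto simp: S'_def particles_def)
  then show ?thesis using card_Suc_Diff1[of "particles c S'" p] by (simp add: card_insert_if)
next
  case False
  then have "particles c S \<subseteq> particles c S'" using p by (auto simp: S'_def particles_def)
  then show ?thesis by (intro card_mono) auto
qed

text \<open>A new pair (a, b) is inserted by the root vector containing the move from
  \<open>bar b\<close> to \<open>a\<close>. Moves that do not cross the filling level upward cannot
  raise the number of particles. Those that do add some \<open>phi a' b'\<close> to
  \<open>Phi\<close>, where (a', b') is in the orbit of (a, b) and has the same sum, so
  \<open>phi_min\<close> makes the intended move the leading one.\<close>

lemma ex_vector_with_leading_term:
  assumes c: "int n \<le> c" "c \<le> per"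
  shows "\<lbrakk>\<forall>(a, b)\<in>set ps. c \<le> a \<and> per - c \<le> b \<and> b \<le> a \<and> a \<le> b + per;
     distinct (map fst ps); distinct (map snd ps)\<rbrakk> \<Longrightarrow>
   \<exists>v\<in>Mod c. v (config c (fst ` set ps) (snd ` set ps)) \<noteq> 0 \<and>
     (\<forall>S. v S \<noteq> 0 \<longrightarrow> S = config c (fst ` set ps) (snd ` set ps) \<or> card (particles c S) < length ps \<or>
       card (particles c S) = length ps \<and> Phi c (config c (fst ` set ps) (snd ` set ps)) < Phi c S)"
proof (induction ps)
  case Nil
  show ?case by (rule bexI[OF _ Mod.Mod_vac]) (simp add: config_empty vac_def)
next
  case (Cons ab ps)
  obtain a b where ab: "ab = (a, b)" by (cases ab)
  define A B where "A = fst ` set ps" and "B = snd ` set ps"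
  define S0 S1 where "S0 = config c A B" and "S1 = config c (insert a A) (insert b B)"
  have abc: "c \<le> a" "per - c \<le> b" "b \<le> a" "a \<le> b + per" and nab: "a \<notin> A" "b \<notin> B"
    using Cons.prems by (auto simp: ab A_def B_def)
  have A: "finite A" "\<And>x. x \<in> A \<Longrightarrow> c \<le> x" and B: "finite B" "\<And>x. x \<in> B \<Longrightarrow> per - c \<le> x"
    using Cons.prems(1) by (auto simp: A_def B_def)
  have cA: "card A = length ps" using Cons.prems(2) by (simp add: A_def distinct_card flip: set_map)
  obtain v where v: "v \<in> Mod c" "v S0 \<noteq> 0"
    and v_lead: "\<And>S. v S \<noteq> 0 \<Longrightarrow> S = S0 \<or> card (particles c S) < length ps \<or>
       card (particles c S) = length ps \<and> Phi c S0 < Phi c S"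
    using Cons by (auto simp: S0_def A_def B_def)
  define k r where "k = a + b - (per - 1)" and "r = bar b"
  have k: "1 \<le> k" using abc by (simp add: k_def)
  have rk: "r + k = a" by (simp add: k_def r_def)
  define v' where "v' = shift_op k (gen k r) v"
  have v': "v' \<in> Mod c" using stable_gen[OF k, of c r] v(1) by (simp add: stable_def v'_def)
  have cS0: "card (particles c S0) = length ps" using A B by (simp add: S0_def particles_config cA)
  have S1: "beads S1 = insert a (beads S0 - {r})"
  proof -
    have "bar x = b \<longleftrightarrow> x = r" for x by (auto simp: r_def)
    moreover have "r \<notin> A" using A(2)[of r] abc(2) by (auto simp: r_def)
    ultimately show ?thesis using A(1) B(1) by (auto simp: S1_def S0_def beads_config)
  qed
  have r0: "r \<in> beads S0" using A(1) B(1) nab abc by (auto simp: S0_def beads_config r_def)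
  have a0: "a \<notin> beads S0" using A(1) B(1) nab abc by (auto simp: S0_def beads_config)
  have "r \<noteq> a" using k rk by auto
  have S01: "S0 = ins r (del a S1)" using S1 r0 a0 \<open>r \<noteq> a\<close> by (intro maya_eqI) auto
  have mem1: "r \<notin> beads S1" "a \<in> beads S1" using S1 \<open>r \<noteq> a\<close> by auto
  have rc: "r < c" using abc by (simp add: r_def)
  have bar_r: "bar r = b" by (simp add: r_def)
  have cS1: "card (particles c S1) = Suc (length ps)" and PhiS1: "Phi c S1 = Phi c S0 + phi a b"
    using move_across[OF mem1 rc abc(1)] unfolding S01[symmetric] cS0 bar_r by simp_all
  \<comment> \<open>Equality of the leading data is attained by a single move from the previous
    leading diagram. The coefficient of \<open>S1\<close> is therefore one term, and no cancellation
    can occur.\<close>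
  have key: "card (particles c S) < Suc (length ps) \<or> card (particles c S) = Suc (length ps) \<and> Phi c S1 < Phi c S \<or>
      p = r \<and> ins p (del (p + k) S) = S0"
    if p: "p \<notin> beads S" "p + k \<in> beads S" "gen k r p \<noteq> 0" "v (ins p (del (p + k) S)) \<noteq> 0" for p S
  proof (cases "p < c \<and> c \<le> p + k")
    case False
    have "card (particles c (ins p (del (p + k) S))) \<le> length ps"
      using v_lead[OF p(4)] cS0 by auto
    with move_not_across[OF p(1,2) False] show ?thesis by linarith
  next
    case True
    define S' where "S' = ins p (del (p + k) S)"
    have mv: "card (particles c S) = Suc (card (particles c S'))" "Phi c S = Phi c S' + phi (p + k) (bar p)"
      unfolding S'_def using move_across[OF p(1,2)] True by auto
    \<comment> \<open>The support of the root vector is symmetric under \<open>bar\<close>, so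
      \<open>bar p\<close> runs exactly through the classes of \<open>b\<close> and
      \<open>a\<close>.\<close>
    have dv: "per dvd bar p - b \<or> per dvd bar p - a"
    proof -
      have "per dvd p - r \<or> per dvd p - (- 1 - k - r)"
        using p(3) by (auto simp: gen_def ind_def split: if_splits)
      moreover have "bar p - b = - (p - r)" "bar p - a = per - (p - (- 1 - k - r))"
        using rk by (simp_all add: r_def)
      ultimately show ?thesis by (metis dvd_diff dvd_minus_iff dvd_refl)
    qed
    have sm: "(p + k) + bar p = a + b" by (simp add: k_def)
    have phi: "phi a b < phi (p + k) (bar p) \<or> p + k = a \<and> bar p = b"
      by (rule phi_min[OF abc(3,4) sm dv])
    then have phi_le: "phi a b \<le> phi (p + k) (bar p)" by auto
    from v_lead[OF p(4)] consider "S' = S0" | "card (particles c S') < length ps"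
      | "card (particles c S') = length ps" "Phi c S0 < Phi c S'" unfolding S'_def by blast
    then show ?thesis
    proof cases
      case 1
      from phi show ?thesis
      proof
        assume "phi a b < phi (p + k) (bar p)"
        then show ?thesis using mv 1 cS0 PhiS1 by simp
      next
        assume "p + k = a \<and> bar p = b"
        then show ?thesis using 1 unfolding S'_def by (auto simp: r_def)
      qed
    next
      case 2 then show ?thesis using mv by simp
    next
      case 3 then show ?thesis using mv PhiS1 phi_le by simp
    qed
  qed
  have "v' S1 = gen k r r * hop (r + k) r v S1"
  proof -
    have "v' S1 = (\<Sum>p\<in>{r}. gen k r p * hop (p + k) p v S1)"
      unfolding v'_def shift_op_def
    proof (rule sum.mono_neutral_right[OF finite_shift_range])
      show "{r} \<subseteq> {p. p \<notin> beads S1 \<and> p + k \<in> beads S1}" using mem1 rk by auto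
      show "\<forall>p\<in>{p. p \<notin> beads S1 \<and> p + k \<in> beads S1} - {r}. gen k r p * hop (p + k) p v S1 = 0"
      proof (rule ballI, rule ccontr)
        fix p assume p: "p \<in> {p. p \<notin> beads S1 \<and> p + k \<in> beads S1} - {r}" and nz: "gen k r p * hop (p + k) p v S1 \<noteq> 0"
        then have "v (ins p (del (p + k) S1)) \<noteq> 0" using k by (auto simp: hop_at split: if_splits)
        with key[of p S1] p nz cS1 show False by auto
      qed
    qed
    then show ?thesis by simp
  qed
  moreover have "hop (r + k) r v S1 \<noteq> 0"
    unfolding rk hop_at[OF \<open>r \<noteq> a\<close>[symmetric]] using mem1 v(2) S01 by (simp add: jw_sign_def)
  \<comment> \<open>If both indicators hold at \<open>r\<close>, then k + 1 is even, the relative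
    sign is +1, and the two summands add up.\<close>
  moreover have "gen k r r \<noteq> 0"
  proof (cases "per dvd r - (- 1 - k - r)")
    case True
    then have "even (r - (- 1 - k - r))" by (meson dvd_trans dvd_triv_left)
    then have "even (k + 1)" by (simp add: algebra_simps)
    with True show ?thesis by (simp add: gen_def ind_def sgi_def)
  qed (simp add: gen_def ind_def)
  ultimately have nz: "v' S1 \<noteq> 0" by simp
  have lead: "S = S1 \<or> card (particles c S) < Suc (length ps) \<or> card (particles c S) = Suc (length ps) \<and> Phi c S1 < Phi c S"
    if "v' S \<noteq> 0" for S
  proof -
    from that obtain p where p: "p \<notin> beads S" "p + k \<in> beads S" "gen k r p * hop (p + k) p v S \<noteq> 0"
      unfolding v'_def shift_op_def by (metis (no_types, lifting) mem_Collect_eq sum.neutral)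
    then have "v (ins p (del (p + k) S)) \<noteq> 0" using k by (auto simp: hop_at split: if_splits)
    with key[of p S] p have "card (particles c S) < Suc (length ps) \<or> card (particles c S) = Suc (length ps) \<and> Phi c S1 < Phi c S \<or>
      p = r \<and> ins p (del (p + k) S) = S0" by auto
    moreover have "S = S1" if "p = r \<and> ins p (del (p + k) S) = S0"
    proof (rule maya_eqI)
      have "beads S0 = insert r (beads S - {a})" using that rk by (metis beads_del beads_ins)
      then show "beads S = beads S1" using S1 p that rk \<open>r \<noteq> a\<close> by auto
    qed
    ultimately show ?thesis by blast
  qed
  have eq: "config c (fst ` set (ab # ps)) (snd ` set (ab # ps)) = S1"
    by (simp add: ab S1_def A_def B_def)
  show ?case unfolding eq
  proof (rule bexI[OF _ v'], intro conjI allI impI)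
    fix S assume "v' S \<noteq> 0"
    from lead[OF this] show "S = S1 \<or> card (particles c S) < length (ab # ps) \<or>
      card (particles c S) = length (ab # ps) \<and> Phi c S1 < Phi c S" by (simp only: list.size(4) add_Suc_right add_0_right One_nat_def)
  qed (rule nz)
qed

end

section \<open>Bases of the weight spaces\<close>

lemma sorted_desc_set_unique:
  fixes xs ys :: "int list"
  assumes "sorted_wrt (>) xs" "sorted_wrt (>) ys" "set xs = set ys"
  shows "xs = ys"
proof -
  have "sorted_wrt (<) (rev xs)" "sorted_wrt (<) (rev ys)" "set (rev xs) = set (rev ys)"
    using assms by (simp_all add: sorted_wrt_rev)
  then have "rev xs = rev ys" by (metis strict_sorted_equal)
  then show ?thesis by simp
qed

lemma sorted_desc_distinct: "sorted_wrt (>) (xs :: int list) \<Longrightarrow> distinct xs"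
  by (induction xs) auto

lemma card_above_nth:
  fixes xs :: "int list"
  assumes xs: "sorted_wrt (>) xs" and j: "j < length xs"
  shows "card {x \<in> set xs. xs ! j \<le> x} = Suc j"
proof -
  have "{x \<in> set xs. xs ! j \<le> x} = (\<lambda>i. xs ! i) ` {..j}"
  proof (intro set_eqI iffI)
    fix x assume "x \<in> {x \<in> set xs. xs ! j \<le> x}"
    then obtain i where i: "i < length xs" "x = xs ! i" "xs ! j \<le> xs ! i" by (auto simp: in_set_conv_nth)
    then have "\<not> j < i" using sorted_wrt_nth_less[OF xs, of j i] by auto
    then show "x \<in> (\<lambda>i. xs ! i) ` {..j}" using i by auto
  next
    fix x assume "x \<in> (\<lambda>i. xs ! i) ` {..j}"
    then obtain i where i: "i \<le> j" "x = xs ! i" by auto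
    then have "xs ! j \<le> xs ! i" using sorted_wrt_nth_less[OF xs, of i j] j by (cases "i = j") auto
    then show "x \<in> {x \<in> set xs. xs ! j \<le> x}" using i j by auto
  qed
  moreover have "inj_on (\<lambda>i. xs ! i) {..j}"
    using sorted_desc_distinct[OF xs] j by (intro inj_on_nth) auto
  ultimately show ?thesis by (simp add: card_image)
qed

lemma nth_ge_of_card:
  fixes xs :: "int list"
  assumes xs: "sorted_wrt (>) xs" and j: "j < length xs" and c: "Suc j \<le> card {x \<in> set xs. m \<le> x}"
  shows "m \<le> xs ! j"
proof (rule ccontr)
  assume "\<not> m \<le> xs ! j"
  then have "{x \<in> set xs. m \<le> x} \<subseteq> {x \<in> set xs. xs ! j \<le> x} - {xs ! j}" by auto
  then have "card {x \<in> set xs. m \<le> x} \<le> card ({x \<in> set xs. xs ! j \<le> x} - {xs ! j})"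
    by (intro card_mono) auto
  also have "\<dots> = j" using card_above_nth[OF xs j] j by simp
  finally show False using c by simp
qed

context C_fock
begin

definition good_lists :: "int \<Rightarrow> (int list \<times> int list) set" where
  "good_lists c = {(ms, ns). length ms = length ns \<and> sorted_wrt (>) ms \<and> sorted_wrt (>) ns \<and>
     (\<forall>a\<in>set ms. c \<le> a) \<and> (\<forall>b\<in>set ns. per - c \<le> b) \<and>
     (\<forall>j<length ms. ns ! j \<le> ms ! j \<and> ms ! j \<le> ns ! j + per)}"

definition state :: "int \<Rightarrow> int list \<times> int list \<Rightarrow> maya" where
  "state c p = config c (set (fst p)) (set (snd p))"

lemma particles_state: "p \<in> good_lists c \<Longrightarrow> particles c (state c p) = set (fst p)"
  unfolding state_def good_lists_def by (intro particles_config) auto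

lemma nus_state: "p \<in> good_lists c \<Longrightarrow> nus c (state c p) = set (snd p)"
  unfolding state_def good_lists_def by (intro nus_config) auto

lemma inj_on_state: "inj_on (state c) (good_lists c)"
proof (rule inj_onI)
  fix p q assume pq: "p \<in> good_lists c" "q \<in> good_lists c" "state c p = state c q"
  then have "set (fst p) = set (fst q)" "set (snd p) = set (snd q)"
    using particles_state[OF pq(1)] particles_state[OF pq(2)] nus_state[OF pq(1)] nus_state[OF pq(2)] pq(3) by simp_all
  with pq show "p = q"
    by (auto simp: good_lists_def intro!: prod_eqI sorted_desc_set_unique)
qed

text \<open>For decreasing lists of equal length, comparing counts above every threshold gives
  comparison entry by entry; the entries themselves are used as thresholds.\<close>

lemma ballot_imp_good:
  assumes "card (particles c S) = card (nus c S)"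
    and "\<And>m. card {b \<in> nus c S. m \<le> b} \<le> card {a \<in> particles c S. m \<le> a}"
    and "\<And>m. card {a \<in> particles c S. m \<le> a} \<le> card {b \<in> nus c S. m - per \<le> b}"
  shows "S \<in> state c ` good_lists c"
proof
  define ms ns where "ms = rev (sorted_list_of_set (particles c S))" and "ns = rev (sorted_list_of_set (nus c S))"
  have set: "set ms = particles c S" "set ns = nus c S" by (simp_all add: ms_def ns_def)
  have len: "length ms = length ns" using assms(1) by (simp add: ms_def ns_def)
  have sorted: "sorted_wrt (>) ms" "sorted_wrt (>) ns" by (simp_all add: ms_def ns_def sorted_wrt_rev)
  show "S = state c (ms, ns)" by (simp add: state_def set config_particles_nus)
  have "ns ! j \<le> ms ! j" "ms ! j \<le> ns ! j + per" if j: "j < length ms" for j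
  proof -
    have "Suc j \<le> card {x \<in> set ms. ns ! j \<le> x}"
      using card_above_nth[OF sorted(2), of j] assms(2)[of "ns ! j"] j len by (simp add: set)
    then show "ns ! j \<le> ms ! j" by (rule nth_ge_of_card[OF sorted(1) j])
    have "Suc j \<le> card {x \<in> set ns. ms ! j - per \<le> x}"
      using card_above_nth[OF sorted(1) j] assms(3)[of "ms ! j"] by (simp add: set)
    then have "ms ! j - per \<le> ns ! j" using j len by (intro nth_ge_of_card[OF sorted(2)]) auto
    then show "ms ! j \<le> ns ! j + per" by simp
  qed
  then show "(ms, ns) \<in> good_lists c"
    using len sorted set particles_ge nus_ge by (auto simp: good_lists_def)
qed

lemma ex_good_vector:
  assumes c: "int n \<le> c" "c \<le> per" and S: "S \<in> state c ` good_lists c"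
  shows "\<exists>v\<in>Mod c. v S \<noteq> 0 \<and> (\<forall>T. v T \<noteq> 0 \<longrightarrow> T = S \<or> card (particles c T) < card (particles c S) \<or>
       card (particles c T) = card (particles c S) \<and> Phi c S < Phi c T)"
proof -
  obtain ms ns where p: "(ms, ns) \<in> good_lists c" and S': "S = state c (ms, ns)" using S by auto
  have len: "length ms = length ns" and sorted: "sorted_wrt (>) ms" "sorted_wrt (>) ns" using p by (auto simp: good_lists_def)
  have dist: "distinct (map fst (zip ms ns))" "distinct (map snd (zip ms ns))"
    using len sorted sorted_desc_distinct by simp_all
  have all: "\<forall>(a, b)\<in>set (zip ms ns). c \<le> a \<and> per - c \<le> b \<and> b \<le> a \<and> a \<le> b + per"
    using p by (fastforce simp: good_lists_def in_set_zip in_set_conv_nth)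
  have cfg: "config c (fst ` set (zip ms ns)) (snd ` set (zip ms ns)) = S"
    using len by (simp add: S' state_def flip: set_map)
  have cS: "length (zip ms ns) = card (particles c S)"
    using particles_state[OF p] len sorted_desc_distinct[OF sorted(1)] by (simp add: S' distinct_card)
  show ?thesis
    using ex_vector_with_leading_term[OF c all dist] unfolding cfg cS .
qed

text \<open>Gaussian elimination. Every nonzero vector supported in \<open>P\<close> has its leading
  term in \<open>G\<close>, and every element of \<open>G\<close> is the leading term of a module
  vector; \<open>proj\<close> restricts that vector to \<open>P\<close> and keeps its leading
  coefficient.\<close>

theorem Mod_weight_basis:
  fixes P :: "maya \<Rightarrow> bool"
  assumes c: "int n \<le> c" "c \<le> per" and fin: "finite {S. P S}"
    and proj: "\<And>w. w \<in> Mod c \<Longrightarrow> (\<lambda>S. of_bool (P S) * w S) \<in> Mod c"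
  defines "G \<equiv> {S \<in> state c ` good_lists c. P S}"
  obtains v where "\<And>S. S \<in> G \<Longrightarrow> v S \<in> Mod c" "\<And>S T. S \<in> G \<Longrightarrow> v S T \<noteq> 0 \<Longrightarrow> P T"
    and "\<And>w. w \<in> Mod c \<Longrightarrow> (\<And>T. w T \<noteq> 0 \<Longrightarrow> P T) \<Longrightarrow> \<exists>a. w = (\<lambda>T. \<Sum>S\<in>G. a S * v S T)"
    and "\<And>a S. (\<And>T. (\<Sum>S\<in>G. a S * v S T) = 0) \<Longrightarrow> S \<in> G \<Longrightarrow> a S = 0"
proof -
  define lt where "lt S T \<longleftrightarrow> card (particles c T) < card (particles c S) \<or>
       card (particles c T) = card (particles c S) \<and> Phi c S < Phi c T" for S T
  have lt_irrefl: "\<not> lt S S" for S by (simp add: lt_def)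
  have lt_trans: "lt S T \<Longrightarrow> lt T U \<Longrightarrow> lt S U" for S T U by (auto simp: lt_def)
  have finG: "finite G" using fin by (rule rev_finite_subset) (auto simp: G_def)
  have "\<exists>v\<in>Mod c. v S \<noteq> 0 \<and> (\<forall>T. v T \<noteq> 0 \<longrightarrow> P T \<and> (T = S \<or> lt S T))" if S: "S \<in> G" for S
  proof -
    obtain v where v: "v \<in> Mod c" "v S \<noteq> 0" "\<forall>T. v T \<noteq> 0 \<longrightarrow> T = S \<or> lt S T"
      using ex_good_vector[OF c, of S] S unfolding lt_def G_def by blast
    show ?thesis
      by (rule bexI[OF _ proj[OF v(1)]]) (use v S in \<open>auto simp: G_def\<close>)
  qed
  then have "\<forall>S\<in>G. \<exists>v. v \<in> Mod c \<and> v S \<noteq> 0 \<and> (\<forall>T. v T \<noteq> 0 \<longrightarrow> P T \<and> (T = S \<or> lt S T))" by blast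
  from bchoice[OF this] obtain v where
    "\<forall>S\<in>G. v S \<in> Mod c \<and> v S S \<noteq> 0 \<and> (\<forall>T. v S T \<noteq> 0 \<longrightarrow> P T \<and> (T = S \<or> lt S T))" ..
  then have v: "\<And>S. S \<in> G \<Longrightarrow> v S \<in> Mod c" "\<And>S. S \<in> G \<Longrightarrow> v S S \<noteq> 0"
    and vP: "\<And>S T. S \<in> G \<Longrightarrow> v S T \<noteq> 0 \<Longrightarrow> P T" and vlt: "\<And>S T. S \<in> G \<Longrightarrow> v S T \<noteq> 0 \<Longrightarrow> T = S \<or> lt S T"
    by blast+
  have span: "\<exists>a. w = (\<lambda>T. \<Sum>S\<in>G. a S * v S T)" if "w \<in> Mod c" "\<And>T. w T \<noteq> 0 \<Longrightarrow> P T" for w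
    using that
  proof (induction "card {T. P T \<and> (\<exists>S. w S \<noteq> 0 \<and> (T = S \<or> lt S T))}" arbitrary: w rule: less_induct)
    case less
    \<comment> \<open>The support itself may grow when a multiple of \<open>v S\<close> is
      subtracted. The set of diagrams in \<open>P\<close> at or after some diagram of the support
      can only shrink, and it loses the leading diagram.\<close>
    define up where "up w = {T. P T \<and> (\<exists>S. w S \<noteq> 0 \<and> (T = S \<or> lt S T))}" for w :: fock
    have fin_up: "finite (up w)" for w using fin by (rule rev_finite_subset) (auto simp: up_def)
    show ?case
    proof (cases "w = 0")
      case True
      then show ?thesis by (intro exI[of _ "\<lambda>_. 0"]) (simp add: zero_fun_def)
    next
      case False
      from leading_term[OF less.prems(1) c False] obtain S where S: "w S \<noteq> 0"
        "\<And>S'. w S' \<noteq> 0 \<Longrightarrow> card (particles c S') < card (particles c S) \<or>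
           card (particles c S') = card (particles c S) \<and> Phi c S \<le> Phi c S'"
        "\<And>m. card {b \<in> nus c S. m \<le> b} \<le> card {a \<in> particles c S. m \<le> a}"
        "\<And>m. card {a \<in> particles c S. m \<le> a} \<le> card {b \<in> nus c S. m - per \<le> b}"
        by blast
      have min: "\<not> lt S' S" if "w S' \<noteq> 0" for S'
        using S(2)[OF that] by (auto simp: lt_def)
      have SG: "S \<in> G"
        using ballot_imp_good[OF card_particles_Mod[OF less.prems(1) S(1)] S(3,4)] less.prems(2)[OF S(1)] by (simp add: G_def)
      define x where "x = w S / v S S"
      define w' where "w' = (\<lambda>T. w T + (- x) * v S T)"
      have w'Mod: "w' \<in> Mod c"
        using Mod.Mod_add[OF less.prems(1) Mod.Mod_scale[OF v(1)[OF SG], of "- x"]] by (simp add: w'_def plus_fun_def)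
      have w'supp: "w T \<noteq> 0 \<or> lt S T" if "w' T \<noteq> 0" for T
        using that vlt[OF SG, of T] S(1) by (auto simp: w'_def)
      have w'S: "w' S = 0" using v(2)[OF SG] by (simp add: w'_def x_def)
      have w'P: "P T" if "w' T \<noteq> 0" for T
        using that less.prems(2)[of T] vP[OF SG, of T] by (cases "w T = 0"; cases "v S T = 0") (auto simp: w'_def)
      have "up w' \<subseteq> up w"
      proof
        fix T assume "T \<in> up w'"
        then obtain U where U: "P T" "w' U \<noteq> 0" "T = U \<or> lt U T" by (auto simp: up_def)
        from w'supp[OF U(2)] show "T \<in> up w"
          using U S(1) lt_trans by (auto simp: up_def)
      qed
      moreover have "S \<in> up w" using S(1) less.prems(2) by (auto simp: up_def)
      moreover have "S \<notin> up w'"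
      proof
        assume "S \<in> up w'"
        then obtain U where U: "w' U \<noteq> 0" "S = U \<or> lt U S" by (auto simp: up_def)
        then have "lt U S" using w'S by auto
        with w'supp[OF U(1)] min[of U] show False using lt_trans lt_irrefl by blast
      qed
      ultimately have "up w' \<subset> up w" by blast
      then have "card (up w') < card (up w)" using fin_up psubset_card_mono by blast
      from less.hyps[of w', folded up_def, OF this w'Mod w'P]
      obtain a where a: "w' = (\<lambda>T. \<Sum>S\<in>G. a S * v S T)" by blast
      have "w = (\<lambda>T. \<Sum>U\<in>G. (a U + (if U = S then x else 0)) * v U T)"
      proof
        fix T
        have "w T = w' T + x * v S T" by (simp add: w'_def)
        also have "x * v S T = (\<Sum>U\<in>G. (if U = S then x * v U T else 0))" using SG finG by simp
        also have "w' T + \<dots> = (\<Sum>U\<in>G. (a U + (if U = S then x else 0)) * v U T)"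
          unfolding a by (simp add: sum.distrib[symmetric]) (intro sum.cong refl, simp add: algebra_simps)
        finally show "w T = (\<Sum>U\<in>G. (a U + (if U = S then x else 0)) * v U T)" .
      qed
      then show ?thesis by (rule exI[of _ "\<lambda>U. a U + (if U = S then x else 0)"])
    qed
  qed
  have indep: "a S = 0" if a: "\<And>T. (\<Sum>S\<in>G. a S * v S T) = 0" and S: "S \<in> G" for a S
  proof (rule ccontr)
    assume "a S \<noteq> 0"
    define Z where "Z = {S \<in> G. a S \<noteq> 0}"
    have "finite Z" "Z \<noteq> {}" using finG S \<open>a S \<noteq> 0\<close> by (auto simp: Z_def)
    moreover have "asymp_on Z lt" using lt_trans lt_irrefl by (blast intro: asymp_onI)
    moreover have "transp_on Z lt" using lt_trans by (blast intro: transp_onI)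
    \<comment> \<open>Every other vector of the combination is supported at and after its own index,
      so at a minimal index \<open>U\<close> only \<open>v U\<close> contributes.\<close>
    ultimately obtain U where U: "U \<in> Z" "\<And>T. T \<in> Z \<Longrightarrow> \<not> lt T U"
      using Finite_Set.bex_min_element[of Z lt] lt_irrefl by metis
    have "(\<Sum>S\<in>G. a S * v S U) = (\<Sum>S\<in>{U}. a S * v S U)"
    proof (rule sum.mono_neutral_right[OF finG])
      show "{U} \<subseteq> G" using U by (auto simp: Z_def)
      show "\<forall>S\<in>G - {U}. a S * v S U = 0"
        using vlt[of _ U] U(2) by (fastforce simp: Z_def)
    qed
    with a[of U] have "a U * v U U = 0" by simp
    then show False using U(1) v(2) by (auto simp: Z_def)
  qed
  show ?thesis
  proof (rule that[of v])
    show "v S \<in> Mod c" if "S \<in> G" for S using that by (rule v(1))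
    show "P T" if "S \<in> G" "v S T \<noteq> 0" for S T using that by (rule vP)
    show "\<exists>a. w = (\<lambda>T. \<Sum>S\<in>G. a S * v S T)" if "w \<in> Mod c" "\<And>T. w T \<noteq> 0 \<Longrightarrow> P T" for w
      using that by (rule span)
    show "a S = 0" if "\<And>T. (\<Sum>S\<in>G. a S * v S T) = 0" "S \<in> G" for a S
      using that by (rule indep)
  qed
qed

end

section \<open>Coloured integers as positions\<close>

context C_fock
begin

definition letter_at :: "int \<Rightarrow> letter" where
  "letter_at r = (if r < int n then Pos (nat (r + 1)) else Bar (nat (per - r)))"

fun letter_index :: "letter \<Rightarrow> int" where
  "letter_index (Pos j) = int j - 1"
| "letter_index (Bar j) = per - int j"

definition pos_of :: "coloured_int \<Rightarrow> int" where
  "pos_of y = per * fst y + letter_index (snd y)"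

definition coloured_at :: "int \<Rightarrow> coloured_int" where
  "coloured_at p = (p div per, letter_at (p mod per))"

lemma letter_index_bounds: "u \<in> letters n \<Longrightarrow> 0 \<le> letter_index u \<and> letter_index u < per"
  by (auto simp: letters_def)

lemma letter_index_less: "u \<in> letters n \<Longrightarrow> v \<in> letters n \<Longrightarrow> letter_index u < letter_index v \<longleftrightarrow> u < v"
  by (auto simp: letters_def less_letter_def)

lemma letter_at_index: "u \<in> letters n \<Longrightarrow> letter_at (letter_index u) = u"
  by (auto simp: letters_def letter_at_def)

lemma letter_index_at: "0 \<le> r \<Longrightarrow> r < per \<Longrightarrow> letter_index (letter_at r) = r"
  by (auto simp: letter_at_def)

lemma letter_at_letters: "0 \<le> r \<Longrightarrow> r < per \<Longrightarrow> letter_at r \<in> letters n"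
  by (auto simp: letter_at_def letters_def image_iff)

lemma snd_coloured_at: "snd (coloured_at p) \<in> letters n"
  using n_pos by (auto simp: coloured_at_def intro!: letter_at_letters)

lemma pos_of_coloured_at [simp]: "pos_of (coloured_at p) = p"
proof -
  have "letter_index (letter_at (p mod per)) = p mod per"
    using n_pos by (intro letter_index_at) auto
  then show ?thesis by (simp add: pos_of_def coloured_at_def)
qed

lemma coloured_at_pos_of: "snd y \<in> letters n \<Longrightarrow> coloured_at (pos_of y) = y"
proof -
  assume y: "snd y \<in> letters n"
  note b = letter_index_bounds[OF y]
  have "pos_of y div per = fst y" "pos_of y mod per = letter_index (snd y)"
    using b n_pos unfolding pos_of_def by simp_all
  then show ?thesis using letter_at_index[OF y] by (simp add: coloured_at_def)
qed

lemma lex_compare: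
  fixes k l x y :: int
  assumes "0 \<le> x" "x < N" "0 \<le> y" "y < N"
  shows "N * l + y < N * k + x \<longleftrightarrow> l < k \<or> l = k \<and> y < x"
proof -
  consider "l < k" | "l = k" | "k < l" by linarith
  then show ?thesis
  proof cases
    case 1
    then have "N * (l + 1) \<le> N * k" using assms by (intro mult_left_mono) auto
    with 1 assms show ?thesis by (simp add: algebra_simps)
  next
    case 3
    then have "N * (k + 1) \<le> N * l" using assms by (intro mult_left_mono) auto
    with 3 assms show ?thesis by (simp add: algebra_simps)
  qed simp
qed

lemma col_gt_iff:
  assumes "snd x \<in> letters n" "snd y \<in> letters n"
  shows "col_gt x y \<longleftrightarrow> pos_of y < pos_of x"
  using lex_compare[of "letter_index (snd x)" "per" "letter_index (snd y)" "fst y" "fst x"]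
    letter_index_bounds[OF assms(1)] letter_index_bounds[OF assms(2)] letter_index_less[OF assms(2,1)]
  by (auto simp: col_gt_def pos_of_def not_less[symmetric])

lemma col_ge_iff:
  assumes "snd x \<in> letters n" "snd y \<in> letters n"
  shows "col_ge x y \<longleftrightarrow> pos_of y \<le> pos_of x"
  using lex_compare[of "letter_index (snd y)" "per" "letter_index (snd x)" "fst x" "fst y"]
    letter_index_bounds[OF assms(1)] letter_index_bounds[OF assms(2)] letter_index_less[OF assms]
  by (auto simp: col_ge_def pos_of_def not_less[symmetric])

lemma pos_of_succ: "pos_of (col_succ x) = pos_of x + per"
  by (simp add: pos_of_def col_succ_def algebra_simps)

section \<open>Weights of positions and the folded Cartan matrix\<close>

definition pos_weight :: "(nat \<Rightarrow> 'g \<Rightarrow> complex) \<Rightarrow> 'g \<Rightarrow> int \<Rightarrow> complex" where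
  "pos_weight \<alpha> x p = colour_weight n \<alpha> (snd (coloured_at p)) x - of_int (fst (coloured_at p)) * null_root_C n \<alpha> x"

lemma coloured_at_eq:
  assumes "p = per * k + r" "0 \<le> r" "r < per"
  shows "coloured_at p = (k, letter_at r)"
  using assms by (simp add: coloured_at_def)

lemma pos_weight_eq:
  assumes "p = per * k + r" "0 \<le> r" "r < per"
  shows "pos_weight \<alpha> x p = colour_weight n \<alpha> (letter_at r) x - of_int k * null_root_C n \<alpha> x"
  by (simp add: pos_weight_def coloured_at_eq[OF assms])

lemma decompose_pos: obtains k r where "p = per * k + r" "0 \<le> r" "r < per"
  using that[of "p div per" "p mod per"] n_pos by simp

text \<open>Reflection inverts the colour and negates the integer. Hence removing a bead from a hole
  position contributes exactly the weight of the corresponding part of nu.\<close>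

lemma pos_weight_bar: "pos_weight \<alpha> x (bar p) = - pos_weight \<alpha> x p"
proof -
  obtain k r where p: "p = per * k + r" "0 \<le> r" "r < per" by (rule decompose_pos)
  have q: "bar p = per * (- k) + (per - 1 - r)" "0 \<le> per - 1 - r" "per - 1 - r < per"
    using p by auto
  have "colour_weight n \<alpha> (letter_at (per - 1 - r)) x = - colour_weight n \<alpha> (letter_at r) x"
  proof (cases "r < int n")
    case True
    then have "letter_at r = Pos (nat (r + 1))" "letter_at (per - 1 - r) = Bar (nat (r + 1))"
      using p by (auto simp: letter_at_def algebra_simps)
    then show ?thesis by simp
  next
    case False
    then have "letter_at r = Bar (nat (per - r))" "letter_at (per - 1 - r) = Pos (nat (per - r))"
      using p by (auto simp: letter_at_def algebra_simps)
    then show ?thesis by simp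
  qed
  then show ?thesis unfolding pos_weight_eq[OF p] pos_weight_eq[OF q] by simp
qed

text \<open>Consecutive colours in the order of the alphabet differ by one simple root. At the
  wrap-around from 1 barred to 1 the integer increases too, and the null root turns the difference
  into alpha_0.\<close>

lemma pos_weight_succ:
  assumes "j \<le> n" "resid j (p + 1)"
  shows "pos_weight \<alpha> x (p + 1) = pos_weight \<alpha> x p - \<alpha> j x"
proof -
  obtain k r where p: "p = per * k + r" "0 \<le> r" "r < per" by (rule decompose_pos)
  have j: "j = i" if "i \<le> n" "per dvd r + 1 - int i \<or> per dvd r + 1 + int i" for i
  proof (rule resid_unique[OF assms(2) _ assms(1) that(1)])
    have "resid i (r + 1)" using that(2) by (simp add: resid_def)
    moreover have "p + 1 = (r + 1) + per * k" using p(1) by simp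
    ultimately show "resid i (p + 1)" by (simp only: resid_periodic)
  qed
  show ?thesis
  proof (cases "r + 1 < per")
    case True
    have q: "p + 1 = per * k + (r + 1)" "0 \<le> r + 1" "r + 1 < per" using p True by auto
    have "colour_weight n \<alpha> (letter_at (r + 1)) x = colour_weight n \<alpha> (letter_at r) x - \<alpha> j x"
    proof -
      consider "r + 1 < int n" | "r + 1 = int n" | "r + 1 > int n" by linarith
      then show ?thesis
      proof cases
        case 1
        define m where "m = nat (r + 1)"
        have m: "int m = r + 1" "m < n" using p 1 by (auto simp: m_def)
        have "j = m" using m by (intro j) auto
        moreover have "letter_at r = Pos m" "letter_at (r + 1) = Pos (Suc m)"
          using 1 p by (auto simp: letter_at_def m_def nat_add_distrib)
        ultimately show ?thesis using m by (simp add: sum.atLeast_Suc_lessThan)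
      next
        case 2
        have "j = n" using 2 by (intro j) auto
        moreover have "letter_at r = Pos n" "letter_at (r + 1) = Bar n"
          using 2 p by (auto simp: letter_at_def)
        ultimately show ?thesis by simp
      next
        case 3
        define m where "m = nat (per - r - 1)"
        have m: "int m = per - r - 1" "m < n" using p True 3 by (auto simp: m_def)
        have "j = m" using m by (intro j) auto
        moreover have "nat (per - r) = Suc m" "nat (per - (r + 1)) = m"
          using True by (auto simp: m_def nat_eq_iff)
        then have "letter_at r = Bar (Suc m)" "letter_at (r + 1) = Bar m"
          using 3 p by (auto simp: letter_at_def)
        ultimately show ?thesis using m by (simp add: sum.atLeast_Suc_lessThan)
      qed
    qed
    then show ?thesis unfolding pos_weight_eq[OF p] pos_weight_eq[OF q] by simp
  next
    case False
    then have r: "r = per - 1" using p by auto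
    have q: "p + 1 = per * (k + 1) + 0" "0 \<le> (0::int)" "0 < per"
      using p r n_pos by (auto simp: algebra_simps)
    have j0: "j = 0" using r by (intro j) auto
    have l: "letter_at r = Bar 1" "letter_at 0 = Pos 1" using r n_pos by (auto simp: letter_at_def)
    have "{1..n - 1} = {1..<n}" using n_pos by auto
    then show ?thesis unfolding pos_weight_eq[OF p] pos_weight_eq[OF q] l j0
      by (simp add: null_root_C_def algebra_simps)
  qed
qed

lemma resid_neighbours:
  assumes "k \<le> n" "resid k q"
  shows "chi j (q + 1) + chi j (q - 1) = chi j (int k + 1) + chi j (int k - 1)"
  using assms(2) unfolding resid_def[of k]
proof
  assume "per dvd q - int k"
  then have "resid j (q + 1) \<longleftrightarrow> resid j (int k + 1)" "resid j (q - 1) \<longleftrightarrow> resid j (int k - 1)"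
    by (auto intro!: resid_cong)
  then show ?thesis by simp
next
  assume d: "per dvd q + int k"
  have "resid j (q + 1) \<longleftrightarrow> resid j (- (int k - 1))" "resid j (q - 1) \<longleftrightarrow> resid j (- (int k + 1))"
    using d by (auto intro!: resid_cong)
  then show ?thesis by (simp only: resid_uminus add.commute)
qed

lemma resid_small:
  assumes "j \<le> n" "i \<le> n"
  shows "resid j (int i) \<longleftrightarrow> i = j"
proof
  assume "resid j (int i)"
  moreover have "resid i (int i)" by (simp add: resid_def)
  ultimately show "i = j" using resid_unique assms by blast
qed (simp add: resid_def)

text \<open>The matrix is the cyclic second difference of period 2n, folded by p to -p. Entries -2
  arise at classes 0 and n because both neighbours of such a position lie in one class.\<close>

lemma cartan_matrix_resid:
  assumes j: "j \<le> n" and k: "k \<le> n" and q: "resid k q"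
  shows "of_int (cartan_matrix_C n j k) = 2 * chi j q - chi j (q + 1) - chi j (q - 1)"
proof -
  have up: "resid j (int k + 1) \<longleftrightarrow> (if k = n then Suc j = n else j = Suc k)"
  proof (cases "k = n")
    case True
    have "resid j (int n + 1) \<longleftrightarrow> resid j (int (n - 1))"
      using resid_reflect[of j 1 "int n + 1"] n_pos by (simp add: of_nat_diff algebra_simps)
    also have "\<dots> \<longleftrightarrow> n - 1 = j" using j by (intro resid_small) auto
    finally show ?thesis using True n_pos by auto
  next
    case False
    then show ?thesis using resid_small[OF j, of "Suc k"] k by (auto simp: add.commute)
  qed
  have down: "resid j (int k - 1) \<longleftrightarrow> (if k = 0 then j = 1 else Suc j = k)"
  proof (cases "k = 0")
    case True
    then show ?thesis using resid_uminus[of j 1] resid_small[OF j, of 1] n_pos by auto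
  next
    case False
    then have "int k - 1 = int (k - 1)" by (simp add: of_nat_diff)
    then show ?thesis using resid_small[OF j, of "k - 1"] k False by auto
  qed
  have same: "resid j q \<longleftrightarrow> j = k" using resid_unique[OF _ q j k] q by auto
  have "2 * chi j q - chi j (q + 1) - chi j (q - 1) = 2 * chi j q - (chi j (int k + 1) + chi j (int k - 1))"
    using resid_neighbours[OF k q, of j] by (simp add: algebra_simps)
  also have "\<dots> = of_int (cartan_matrix_C n j k)"
    unfolding up down same using j k n_pos by (auto simp: cartan_matrix_C_def)
  finally show ?thesis by simp
qed

lemma int_constI:
  fixes f :: "int \<Rightarrow> 'b"
  assumes "\<And>p. f (p + 1) = f p"
  shows "f p = f q"
proof (induction p rule: int_induct[where k = q])
  case (step2 i)
  then show ?case using assms[of "i - 1"] by simp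
qed (simp_all add: assms)

text \<open>Both sides have the same increments and are odd under \<open>bar\<close>. Their
  difference is a constant equal to its own negative.\<close>

lemma pos_weight_coroot:
  assumes coroot: "\<And>k. k \<le> n \<Longrightarrow> \<alpha> k x = of_int (cartan_matrix_C n j k)" and j: "j \<le> n"
  shows "pos_weight \<alpha> x p = chi j (p + 1) - chi j p"
proof -
  define g where "g p = pos_weight \<alpha> x p - (chi j (p + 1) - chi j p)" for p
  have "g (p + 1) = g p" for p
  proof -
    obtain k where k: "k \<le> n" "resid k (p + 1)" using ex_resid by blast
    have "\<alpha> k x = 2 * chi j (p + 1) - chi j (p + 1 + 1) - chi j p"
      using coroot[OF k(1)] cartan_matrix_resid[OF j k] by simp
    then show ?thesis unfolding g_def pos_weight_succ[OF k] by simp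
  qed
  then have const: "g p = g q" for p q by (rule int_constI)
  have anti: "g (bar p) = - g p" for p
  proof -
    have "resid j (bar p + 1) \<longleftrightarrow> resid j p" "resid j (bar p) \<longleftrightarrow> resid j (p + 1)"
      using resid_reflect[of j 1 p] resid_reflect[of j 1 "p + 1"] by (simp_all add: algebra_simps)
    then show ?thesis by (simp add: g_def pos_weight_bar)
  qed
  have "g p = - g p" using const[of p "bar p"] anti[of p] by simp
  then have "g p = 0" by (simp add: eq_neg_iff_add_eq_0 flip: mult_2)
  then show ?thesis unfolding g_def by (simp only: right_minus_eq)
qed

text \<open>The prescribed last parts enter only as strict lower bounds, at positions c-1 and
  2n-c-1. They become the ranges of particles and of reflected holes for the filling level
  \<open>c\<close>; the interlacing concerns the earlier parts only.\<close>

lemma F_gt_snoc: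
  assumes kc: "snd kc \<in> letters n" "pos_of kc = c - 1" and ld: "snd ld \<in> letters n" "pos_of ld = per - c - 1"
    and xs: "snd ` set xs \<subseteq> letters n" and ys: "snd ` set ys \<subseteq> letters n"
  shows "(xs @ [kc], ys @ [ld]) \<in> F_gt n kc ld \<longleftrightarrow> (map pos_of xs, map pos_of ys) \<in> good_lists c"
proof -
  have chain: "(\<forall>j<length zs. col_gt ((zs @ [z]) ! j) ((zs @ [z]) ! Suc j)) \<longleftrightarrow>
      sorted_wrt (>) (map pos_of zs) \<and> (\<forall>p\<in>set (map pos_of zs). pos_of z < p)"
    if zs: "snd ` set zs \<subseteq> letters n" "snd z \<in> letters n" for zs z
  proof -
    define Z where "Z = zs @ [z]"
    have len: "length Z = Suc (length zs)" by (simp add: Z_def)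
    have l: "snd (Z ! j) \<in> letters n" if "j \<le> length zs" for j
      using that zs by (auto simp: nth_append Z_def)
    have "col_gt (Z ! j) (Z ! Suc j) \<longleftrightarrow> pos_of (Z ! Suc j) < pos_of (Z ! j)" if "j < length zs" for j
      using l[of j] l[of "Suc j"] that by (intro col_gt_iff) auto
    then have "(\<forall>j<length zs. col_gt (Z ! j) (Z ! Suc j)) \<longleftrightarrow>
      (\<forall>j. Suc j < length (map pos_of Z) \<longrightarrow> map pos_of Z ! j > map pos_of Z ! Suc j)"
      by (auto simp: len)
    also have "\<dots> \<longleftrightarrow> sorted_wrt (>) (map pos_of Z)"
      by (subst sorted_wrt_iff_nth_Suc_transp) (auto intro: transpI)
    finally show ?thesis by (auto simp: sorted_wrt_append Z_def)
  qed
  have pairs: "(\<forall>j<length xs. col_ge (col_succ ((ys @ [ld]) ! j)) ((xs @ [kc]) ! j) \<and> col_ge ((xs @ [kc]) ! j) ((ys @ [ld]) ! j)) \<longleftrightarrow>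
     (\<forall>j<length (map pos_of xs). map pos_of ys ! j \<le> map pos_of xs ! j \<and> map pos_of xs ! j \<le> map pos_of ys ! j + per)"
    if len: "length xs = length ys"
  proof -
    have "col_ge (col_succ ((ys @ [ld]) ! j)) ((xs @ [kc]) ! j) \<and> col_ge ((xs @ [kc]) ! j) ((ys @ [ld]) ! j)
      \<longleftrightarrow> pos_of (ys ! j) \<le> pos_of (xs ! j) \<and> pos_of (xs ! j) \<le> pos_of (ys ! j) + per" if j: "j < length xs" for j
    proof -
      have l: "snd (xs ! j) \<in> letters n" "snd (ys ! j) \<in> letters n" "snd (col_succ (ys ! j)) \<in> letters n"
        using xs ys j len by (auto simp: col_succ_def)
      show ?thesis using j len by (simp add: nth_append col_ge_iff[OF l(3,1)] col_ge_iff[OF l(1,2)] pos_of_succ conj_commute)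
    qed
    then show ?thesis using len by auto
  qed
  have 1: "(xs @ [kc], ys @ [ld]) \<in> F_gt n kc ld \<longleftrightarrow> length xs = length ys \<and>
      (\<forall>j<length xs. col_gt ((xs @ [kc]) ! j) ((xs @ [kc]) ! Suc j)) \<and>
      (\<forall>j<length ys. col_gt ((ys @ [ld]) ! j) ((ys @ [ld]) ! Suc j)) \<and>
      (\<forall>j<length xs. col_ge (col_succ ((ys @ [ld]) ! j)) ((xs @ [kc]) ! j) \<and> col_ge ((xs @ [kc]) ! j) ((ys @ [ld]) ! j))"
  proof -
    have lets: "snd ` set (xs @ [kc]) \<subseteq> letters n" "snd ` set (ys @ [ld]) \<subseteq> letters n"
      using kc ld xs ys by auto
    show ?thesis
      unfolding F_gt_def using lets by auto
  qed
  have 2: "(\<forall>p\<in>set (map pos_of xs). pos_of kc < p) \<longleftrightarrow> (\<forall>p\<in>set (map pos_of xs). c \<le> p)"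
    "(\<forall>p\<in>set (map pos_of ys). pos_of ld < p) \<longleftrightarrow> (\<forall>p\<in>set (map pos_of ys). per - c \<le> p)"
    using kc(2) ld(2) by auto
  show ?thesis
    unfolding 1 chain[OF xs kc(1)] chain[OF ys ld(1)] 2 good_lists_def
    using pairs by auto
qed

definition encode :: "coloured_int \<Rightarrow> coloured_int \<Rightarrow> int list \<times> int list \<Rightarrow> coloured_int list \<times> coloured_int list" where
  "encode kc ld p = (map coloured_at (fst p) @ [kc], map coloured_at (snd p) @ [ld])"

lemma inj_encode: "inj (encode kc ld)"
proof -
  have "inj coloured_at" by (rule inj_on_inverseI[of _ pos_of]) simp
  then show ?thesis by (auto simp: encode_def inj_map_eq_map intro!: injI prod_eqI)
qed

lemma F_gt_eq:
  assumes kc: "snd kc \<in> letters n" "pos_of kc = c - 1" and ld: "snd ld \<in> letters n" "pos_of ld = per - c - 1"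
  shows "F_gt n kc ld = encode kc ld ` good_lists c"
proof (intro set_eqI iffI)
  fix p assume p: "p \<in> F_gt n kc ld"
  obtain \<mu> \<nu> where mn: "p = (\<mu>, \<nu>)" by (cases p)
  with p obtain s where s: "length \<mu> = Suc s" "length \<nu> = Suc s" "snd ` set \<mu> \<subseteq> letters n" "snd ` set \<nu> \<subseteq> letters n"
    "\<mu> ! s = kc" "\<nu> ! s = ld" by (auto simp: F_gt_def)
  define xs ys where "xs = butlast \<mu>" and "ys = butlast \<nu>"
  have \<mu>: "\<mu> = xs @ [kc]" using s by (metis append_butlast_last_id diff_Suc_1 last_conv_nth length_0_conv nat.distinct(2) xs_def)
  have \<nu>: "\<nu> = ys @ [ld]" using s by (metis append_butlast_last_id diff_Suc_1 last_conv_nth length_0_conv nat.distinct(2) ys_def)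
  have l: "snd ` set xs \<subseteq> letters n" "snd ` set ys \<subseteq> letters n" using s(3,4) by (auto simp: \<mu> \<nu>)
  have "(map pos_of xs, map pos_of ys) \<in> good_lists c"
    using p F_gt_snoc[OF kc ld l] by (simp add: mn \<mu> \<nu>)
  moreover have "map coloured_at (map pos_of xs) = xs" "map coloured_at (map pos_of ys) = ys"
    using l by (auto intro!: map_idI simp: coloured_at_pos_of)
  then have "p = encode kc ld (map pos_of xs, map pos_of ys)" by (simp add: encode_def mn \<mu> \<nu>)
  ultimately show "p \<in> encode kc ld ` good_lists c" by blast
next
  fix p assume "p \<in> encode kc ld ` good_lists c"
  then obtain ms ns where q: "(ms, ns) \<in> good_lists c" "p = (map coloured_at ms @ [kc], map coloured_at ns @ [ld])"
    by (auto simp: encode_def)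
  have l: "snd ` set (map coloured_at ms) \<subseteq> letters n" "snd ` set (map coloured_at ns) \<subseteq> letters n"
    using snd_coloured_at by auto
  have "map pos_of (map coloured_at ms) = ms" "map pos_of (map coloured_at ns) = ns"
    by (auto intro!: map_idI)
  then show "p \<in> F_gt n kc ld" using F_gt_snoc[OF kc ld l] q by simp
qed

lemma excess_pos_weight:
  "excess c (pos_weight \<alpha> x) S = sum (pos_weight \<alpha> x) (particles c S) + sum (pos_weight \<alpha> x) (nus c S)"
proof -
  have "sum (pos_weight \<alpha> x) (nus c S) = (\<Sum>y\<in>holes c S. pos_weight \<alpha> x (bar y))"
    unfolding nus_def by (subst sum.reindex) (auto intro: inj_onI)
  then show ?thesis by (simp add: excess_def pos_weight_bar sum_negf)
qed

lemma pair_weight_encode: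
  assumes p: "p \<in> good_lists c"
  shows "pair_weight n \<alpha> (encode kc ld p) x = excess c (pos_weight \<alpha> x) (state c p)"
proof -
  have list: "(\<Sum>y\<leftarrow>map coloured_at zs. colour_weight n \<alpha> (snd y) x) - of_int (\<Sum>y\<leftarrow>map coloured_at zs. fst y) * null_root_C n \<alpha> x
     = (\<Sum>z\<leftarrow>zs. pos_weight \<alpha> x z)" for zs
    by (induction zs) (auto simp: pos_weight_def algebra_simps)
  have "pair_weight n \<alpha> (encode kc ld p) x = (\<Sum>z\<leftarrow>fst p. pos_weight \<alpha> x z) + (\<Sum>z\<leftarrow>snd p. pos_weight \<alpha> x z)"
    unfolding list[symmetric] by (simp add: pair_weight_def colour_sequence_weight_def pair_size_def encode_def algebra_simps)
  also have "\<dots> = sum (pos_weight \<alpha> x) (set (fst p)) + sum (pos_weight \<alpha> x) (set (snd p))"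
    using p sorted_desc_distinct by (simp add: good_lists_def sum_list_distinct_conv_sum_set split_beta)
  finally show ?thesis by (simp add: excess_pos_weight particles_state[OF p] nus_state[OF p])
qed

lemma pos_weight_d:
  assumes "\<And>j. j \<le> n \<Longrightarrow> \<alpha> j x = of_bool (j = 0)"
  shows "pos_weight \<alpha> x p = - of_int (p div per)"
proof -
  have "\<alpha> n x = 0" using assms[of n] n_pos by simp
  moreover have "(\<Sum>u = j..<n. \<alpha> u x) = 0" if "1 \<le> j" for j
    using that assms by (intro sum.neutral) auto
  ultimately have "colour_weight n \<alpha> u x = 0" if "u \<in> letters n" for u
    using that by (auto simp: letters_def)
  moreover have "(\<Sum>j = 1..n - 1. \<alpha> j x) = 0" using assms by (intro sum.neutral) auto
  then have "null_root_C n \<alpha> x = 1" using assms[of 0] \<open>\<alpha> n x = 0\<close> by (simp add: null_root_C_def)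
  ultimately show ?thesis using snd_coloured_at[of p] by (simp add: pos_weight_def coloured_at_def)
qed

text \<open>On \<open>d\<close> the weight is minus the total of the integers of all parts. For a
  filling level from 0 to 2n no part is negative, so the total bounds each part and leaves finitely
  many diagrams.\<close>

lemma finite_weight:
  assumes d: "\<And>j. j \<le> n \<Longrightarrow> \<alpha> j x = of_bool (j = 0)" and c: "0 \<le> c" "c \<le> per"
  shows "finite {S. excess c (pos_weight \<alpha> x) S = K}"
proof (cases "{S. excess c (pos_weight \<alpha> x) S = K} = {}")
  case False
  define L where "L S = (\<Sum>a\<in>particles c S. a div per) + (\<Sum>b\<in>nus c S. b div per)" for S
  have L: "excess c (pos_weight \<alpha> x) S = - of_int (L S)" for S
  proof -
    have "pos_weight \<alpha> x = (\<lambda>p. - of_int (p div per))"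
      by (rule ext) (rule pos_weight_d[of \<alpha> x, OF d])
    then show ?thesis unfolding excess_pos_weight L_def by (simp add: sum_negf)
  qed
  obtain T where T: "excess c (pos_weight \<alpha> x) T = K" using False by auto
  define I where "I = {0..per * (L T + 1)}"
  have "{S. excess c (pos_weight \<alpha> x) S = K} \<subseteq> (\<lambda>(A, B). config c A B) ` (Pow I \<times> Pow I)"
  proof
    fix S assume "S \<in> {S. excess c (pos_weight \<alpha> x) S = K}"
    then have "- complex_of_int (L S) = - complex_of_int (L T)" using T L[of S] L[of T] by simp
    then have LS: "L S = L T" by (simp only: neg_equal_iff_equal of_int_eq_iff)
    have nonneg: "0 \<le> p" if "p \<in> particles c S \<union> nus c S" for p
      using that particles_ge[of p c S] nus_ge[of p c S] c by auto
    have le: "p div per \<le> L S" if p: "p \<in> particles c S \<union> nus c S" for p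
    proof -
      have 0: "0 \<le> (\<Sum>a\<in>particles c S. a div per)" "0 \<le> (\<Sum>b\<in>nus c S. b div per)"
        using nonneg n_pos by (auto intro!: sum_nonneg simp: pos_imp_zdiv_nonneg_iff)
      from p show ?thesis
      proof
        assume "p \<in> particles c S"
        then have "p div per \<le> (\<Sum>a\<in>particles c S. a div per)"
          using nonneg n_pos by (intro member_le_sum) (auto simp: pos_imp_zdiv_nonneg_iff)
        with 0 show ?thesis by (simp add: L_def)
      next
        assume "p \<in> nus c S"
        then have "p div per \<le> (\<Sum>a\<in>nus c S. a div per)"
          using nonneg n_pos by (intro member_le_sum) (auto simp: pos_imp_zdiv_nonneg_iff)
        with 0 show ?thesis by (simp add: L_def)
      qed
    qed
    have "p \<in> I" if p: "p \<in> particles c S \<union> nus c S" for p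
    proof -
      have "p = per * (p div per) + p mod per" by simp
      moreover have "per * (p div per) \<le> per * L T" using le[OF p] LS by (intro mult_left_mono) auto
      moreover have "p mod per < per" using n_pos by simp
      ultimately have "p \<le> per * (L T + 1)" unfolding distrib_left by linarith
      then show ?thesis using nonneg[OF p] by (simp add: I_def)
    qed
    then show "S \<in> (\<lambda>(A, B). config c A B) ` (Pow I \<times> Pow I)"
      using config_particles_nus[of c S] by (intro image_eqI[of _ _ "(particles c S, nus c S)"]) auto
  qed
  then show ?thesis by (rule finite_subset) (simp add: I_def)
next
  case True
  then show ?thesis by simp
qed

end

section \<open>Comparison with the irreducible module\<close>

locale C_affine = affine_lie_algebra scale bracket n "cartan_matrix_C n" H h d e f \<alpha> + C_fock n
  for scale :: "complex \<Rightarrow> 'g::ab_group_add \<Rightarrow> 'g"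
    and bracket :: "'g \<Rightarrow> 'g \<Rightarrow> 'g" and n H h d e f \<alpha>
begin

lemma h_in_H: "j \<le> n \<Longrightarrow> h j \<in> H" and d_in_H: "d \<in> H"
  unfolding cartan by (auto intro: span_base)

lemma subspace_H: "subspace H"
  unfolding cartan by (rule subspace_span)

lemma root_sum:
  assumes j: "j \<le> n" and "finite K" "\<And>k. k \<in> K \<Longrightarrow> y k \<in> H"
  shows "\<alpha> j (\<Sum>k\<in>K. scale (a k) (y k)) = (\<Sum>k\<in>K. a k * \<alpha> j (y k))"
  using assms(2,3)
proof (induction K rule: finite_induct)
  case empty
  have "\<alpha> j (scale 0 d) = 0 * \<alpha> j d"
    using root_linear[OF j] d_in_H unfolding linear_functional_on_def by blast
  then show ?case by simp
next
  case (insert k K)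
  have "scale (a k) (y k) \<in> H" "(\<Sum>k\<in>K. scale (a k) (y k)) \<in> H"
    using insert.prems subspace_H by (auto intro!: subspace_scale subspace_sum)
  then have "\<alpha> j (scale (a k) (y k) + (\<Sum>k\<in>K. scale (a k) (y k))) = a k * \<alpha> j (y k) + \<alpha> j (\<Sum>k\<in>K. scale (a k) (y k))"
    using root_linear[OF j] insert.prems unfolding linear_functional_on_def by simp
  with insert show ?case by simp
qed

text \<open>The affine analogue of the sum of fundamental coweights. The coefficients
  \<open>a k\<close> have second difference -1, vanish at 0 and are symmetric about n, which matches
  the folding there; the coefficient 2n of \<open>d\<close>, the Coxeter number, corrects the value
  at node 0.\<close>

lemma ex_grading: "\<exists>x\<in>H. \<forall>j\<le>n. \<alpha> j x = 1"
proof -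
  define a :: "nat \<Rightarrow> complex" where "a k = of_nat k * (2 * of_nat n - of_nat k) / 2" for k
  define y where "y = (\<Sum>k\<in>{1..n}. scale (a k) (h k))"
  define x where "x = y + scale (2 * of_nat n) d"
  have yH: "y \<in> H" unfolding y_def using subspace_H h_in_H by (auto intro!: subspace_sum subspace_scale)
  have sd: "scale (2 * of_nat n) d \<in> H" using subspace_H d_in_H by (auto intro!: subspace_scale)
  have xH: "x \<in> H" unfolding x_def using yH sd subspace_H by (auto intro!: subspace_add)
  define A where "A q = (\<Sum>k\<in>{1..n}. a k * chi k q)" for q
  have A_small: "A (int q) = a q" if "q \<le> n" for q
  proof -
    have "A (int q) = (\<Sum>k\<in>{1..n}. if k = q then a k else 0)"
      unfolding A_def using that by (intro sum.cong refl) (auto simp: resid_small)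
    then show ?thesis using that by (cases "q = 0") (auto simp: a_def)
  qed
  have A_neg: "A (- 1) = a 1"
    using A_small[of 1] n_pos resid_uminus[of _ 1] by (simp add: A_def)
  have A_top: "A (int n + 1) = a (n - 1)"
  proof -
    have "resid k (int n + 1) \<longleftrightarrow> resid k (int (n - 1))" for k
      using resid_reflect[of k 1 "int n + 1"] n_pos by (simp add: of_nat_diff algebra_simps)
    then have "A (int n + 1) = A (int (n - 1))" by (simp add: A_def)
    then show ?thesis using A_small[of "n - 1"] by simp
  qed
  have "\<alpha> j x = 1" if j: "j \<le> n" for j
  proof -
    have jj: "resid j (int j)" by (simp add: resid_def)
    have "\<alpha> j x = \<alpha> j y + 2 * of_nat n * \<alpha> j d"
      using root_linear[OF j] yH sd d_in_H unfolding linear_functional_on_def x_def by simp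
    also have "\<alpha> j y = (\<Sum>k\<in>{1..n}. a k * \<alpha> j (h k))"
      unfolding y_def using h_in_H by (intro root_sum[OF j]) auto
    also have "\<dots> = (\<Sum>k\<in>{1..n}. a k * (2 * chi k (int j) - chi k (int j + 1) - chi k (int j - 1)))"
      using root_coroot[OF _ j] cartan_matrix_resid[OF _ j jj] by (intro sum.cong refl) auto
    also have "\<dots> = 2 * A (int j) - A (int j + 1) - A (int j - 1)"
      unfolding A_def right_diff_distrib sum_subtractf sum_distrib_left by (simp only: mult.left_commute)
    also have "A (int j + 1) = (if j = n then a (n - 1) else a (Suc j))"
      using A_top A_small[of "Suc j"] j by (auto simp: add.commute)
    also have "A (int j - 1) = (if j = 0 then a 1 else a (j - 1))"
      using A_neg A_small[of "j - 1"] j by (auto simp: of_nat_diff)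
    also have "A (int j) = a j" using A_small j by simp
    also have "\<alpha> j d = of_bool (j = 0)" using root_d[OF j] .
    finally have \<alpha>j: "\<alpha> j x = 2 * a j - (if j = n then a (n - 1) else a (Suc j)) - (if j = 0 then a 1 else a (j - 1))
      + 2 * of_nat n * of_bool (j = 0)" .
    show ?thesis
    proof (cases j)
      case 0
      then show ?thesis using \<alpha>j n_pos by (simp add: a_def field_simps)
    next
      case (Suc m)
      show ?thesis
      proof (cases "j = n")
        case True
        then have "n = Suc m" using Suc by simp
        then show ?thesis using \<alpha>j Suc unfolding a_def by (simp add: field_simps)
      next
        case False
        then show ?thesis using \<alpha>j Suc unfolding a_def by (simp add: field_simps)
      qed
    qed
  qed
  with xH show ?thesis by blast
qed

end

section \<open>The relation between the vacuum module and L(Lambda_i)\<close>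

locale C_highest_weight = C_affine scale bracket n H h d e f \<alpha> + lie_module scale bracket scaleV act
  for scale :: "complex \<Rightarrow> 'g::ab_group_add \<Rightarrow> 'g"
    and bracket :: "'g \<Rightarrow> 'g \<Rightarrow> 'g" and n H h d e f \<alpha>
    and scaleV :: "complex \<Rightarrow> 'v::ab_group_add \<Rightarrow> 'v" and act +
  fixes i :: nat and lam :: "'g \<Rightarrow> complex" and hv :: 'v
  assumes i_le: "i \<le> n"
    and lam_coroot: "j \<le> n \<Longrightarrow> lam (h j) = of_bool (i = j)"
    and irred: "irreducible_module"
    and hv_nz: "hv \<noteq> 0"
    and e_hv: "j \<le> n \<Longrightarrow> act (e j) hv = 0"
    and H_hv: "x \<in> H \<Longrightarrow> act x hv = scaleV (lam x) hv"
begin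

text \<open>This level is congruent to -i modulo 2n, so among the generators only \<open>F i\<close>
  can move the top bead of the vacuum.\<close>

definition cut :: int where "cut = per - int i"

lemma cut_bounds: "int n \<le> cut" "cut \<le> per" "0 \<le> cut"
  using i_le by (auto simp: cut_def)

definition wt :: "maya \<Rightarrow> 'g \<Rightarrow> complex" where
  "wt S x = lam x + excess cut (pos_weight \<alpha> x) S"

definition Hop :: "'g \<Rightarrow> fock \<Rightarrow> fock" where
  "Hop x w S = wt S x * w S"

lemma excess_lower:
  assumes "j \<le> n" "resid j (p + 1)" "p \<notin> beads S" "p + 1 \<in> beads S"
  shows "excess cut (pos_weight \<alpha> x) (ins p (del (p + 1) S)) = excess cut (pos_weight \<alpha> x) S + \<alpha> j x"
  using assms by (simp add: excess_move pos_weight_succ)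

lemma F_Hop: "j \<le> n \<Longrightarrow> F j (Hop x w) = (\<lambda>S. (wt S x + \<alpha> j x) * F j w S)"
  unfolding F_at fun_eq_iff sum_distrib_left Hop_def wt_def
  by (auto intro!: sum.cong simp: excess_lower)

text \<open>The boundary term of the commutator is \<open>chi j cut\<close>, which is 1 exactly for
  j = i and so agrees with the value of Lambda_i on the coroot. The excess term is the weight of the
  moved beads by \<open>pos_weight_coroot\<close>.\<close>

lemma E_F_wt:
  assumes "k \<le> n" "j \<le> n"
  shows "E k (F j w) = F j (E k w) + (if k = j then Hop (h j) w else 0)"
proof
  fix S
  have "chi j cut = lam (h j)"
    using lam_coroot[OF assms(2)] resid_reflect[of j 1 "int i"] resid_small[OF assms(2) i_le]
    by (simp add: cut_def)
  moreover have "pos_weight \<alpha> (h j) = (\<lambda>p. chi j (p + 1) - chi j p)"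
    using root_coroot[OF assms(2)] by (intro ext pos_weight_coroot[OF _ assms(2)]) auto
  ultimately have "(chi j cut + excess cut (\<lambda>p. chi j (p + 1) - chi j p) S) * w S = Hop (h j) w S"
    by (simp add: Hop_def wt_def)
  with E_F_commutator[OF assms, of w S cut] show "E k (F j w) S = (F j (E k w) + (if k = j then Hop (h j) w else 0)) S"
    by (auto simp: algebra_simps split: if_splits)
qed

lemma act_zero_right [simp]: "act x 0 = 0"
  using act_scale_right[of x 0 0] by simp

lemma act_zero_left [simp]: "act 0 u = 0"
  using act_scale_left[of 0 0 u] by simp

lemma act_commute: "act x (act y u) = act y (act x u) + act (bracket x y) u"
  by (simp add: act_bracket)

text \<open>The graph of the isomorphism between the Fock module generated by the vacuum and \<open>L(\<Lambda>\<^sub>i)\<close>.\<close>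

inductive R :: "fock \<Rightarrow> 'v \<Rightarrow> bool" where
  R_vac: "R (vac cut) hv"
| R_F: "R w u \<Longrightarrow> j \<le> n \<Longrightarrow> R (F j w) (act (f j) u)"
| R_add: "R w u \<Longrightarrow> R w' u' \<Longrightarrow> R (w + w') (u + u')"
| R_scale: "R w u \<Longrightarrow> R (\<lambda>S. a * w S) (scaleV a u)"

lemma R_Mod: "R w u \<Longrightarrow> w \<in> Mod cut"
  by (induction rule: R.induct) (blast intro: Mod.intros)+

lemma Mod_R: "w \<in> Mod cut \<Longrightarrow> \<exists>u. R w u"
  by (induction rule: Mod.induct) (blast intro: R.intros)+

lemma R_zero: "R 0 0"
  using R_scale[OF R_vac, of 0] by (simp add: zero_fun_def)

lemma R_diff: "R w u \<Longrightarrow> R w' u' \<Longrightarrow> R (w - w') (u - u')"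
  using R_add[of w u "\<lambda>S. (- 1) * w' S" "scaleV (- 1) u'"] R_scale[of w' u' "- 1"]
  by (simp add: fun_diff_def plus_fun_def)

lemma R_sum: "finite K \<Longrightarrow> (\<And>k. k \<in> K \<Longrightarrow> R (w k) (u k)) \<Longrightarrow>
    R (\<lambda>T. \<Sum>k\<in>K. a k * w k T) (\<Sum>k\<in>K. scaleV (a k) (u k))"
proof (induction K rule: finite_induct)
  case empty
  then show ?case using R_zero by (simp add: zero_fun_def)
next
  case (insert k K)
  then have "R ((\<lambda>T. a k * w k T) + (\<lambda>T. \<Sum>k\<in>K. a k * w k T)) (scaleV (a k) (u k) + (\<Sum>k\<in>K. scaleV (a k) (u k)))"
    by (intro R_add R_scale) auto
  then show ?case using insert.hyps by (simp add: plus_fun_def)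
qed

lemma R_H: "R w u \<Longrightarrow> x \<in> H \<Longrightarrow> R (Hop x w) (act x u)"
proof (induction rule: R.induct)
  case R_vac
  have "Hop x (vac cut) = (\<lambda>S. lam x * vac cut S)"
    by (auto simp: Hop_def vac_def wt_def fun_eq_iff)
  then show ?case using R.R_scale[OF R.R_vac, of "lam x"] H_hv[OF R_vac] by simp
next
  case (R_F w u j)
  have "Hop x (F j w) = F j (Hop x w) + (\<lambda>S. (- \<alpha> j x) * F j w S)"
    by (simp add: F_Hop[OF R_F.hyps(2)] fun_eq_iff Hop_def algebra_simps)
  moreover have "act x (act (f j) u) = act (f j) (act x u) + scaleV (- \<alpha> j x) (act (f j) u)"
    unfolding act_commute[of x "f j" u] bracket_H_f[OF R_F.prems R_F.hyps(2)] act_scale_left ..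
  ultimately show ?case
    using R_F by (simp only:) (intro R.R_add R.R_scale R.R_F, auto)
next
  case (R_add w u w' u')
  have "Hop x (w + w') = Hop x w + Hop x w'" by (simp add: Hop_def fun_eq_iff algebra_simps)
  then show ?case using R.R_add[OF R_add.IH(1)[OF R_add.prems] R_add.IH(2)[OF R_add.prems]] by (simp only: act_add_right)
next
  case (R_scale w u a)
  have "Hop x (\<lambda>S. a * w S) = (\<lambda>S. a * Hop x w S)" by (simp add: Hop_def fun_eq_iff algebra_simps)
  then show ?case using R.R_scale[OF R_scale.IH[OF R_scale.prems], of a] by (simp only: act_scale_right)
qed

lemma E_vac: "E k (vac c) = 0"
proof
  fix S
  have "vac c (ins (p + 1) (del p S)) = 0" for p
  proof (rule ccontr)
    assume "vac c (ins (p + 1) (del p S)) \<noteq> 0"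
    then have "beads (ins (p + 1) (del p S)) = {x. x < c}" by (auto simp: vac_def split: if_splits)
    then have eq: "{x. x < c} = insert (p + 1) (beads S - {p})" by simp
    have "p + 1 \<in> {x. x < c}" "p \<notin> {x. x < c}" unfolding eq by auto
    then show False by simp
  qed
  then show "E k (vac c) S = 0 S" by (simp add: E_at)
qed

lemma R_E: "R w u \<Longrightarrow> k \<le> n \<Longrightarrow> R (E k w) (act (e k) u)"
proof (induction rule: R.induct)
  case R_vac
  then show ?case by (simp only: E_vac e_hv R_zero)
next
  case (R_F w u j)
  have FE: "R (F j (E k w)) (act (f j) (act (e k) u))" using R_F by (intro R.R_F) auto
  show ?case
  proof (cases "k = j")
    case True
    have "act (e k) (act (f j) u) = act (f j) (act (e k) u) + act (h j) u"
      using act_commute[of "e k" "f j" u] bracket_e_f[of k j] R_F True by simp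
    moreover have "E k (F j w) = F j (E k w) + Hop (h j) w" using E_F_wt[of k j w] R_F True by simp
    ultimately show ?thesis using R.R_add[OF FE R_H[OF R_F.hyps(1) h_in_H[OF R_F.hyps(2)]]] by (simp only:)
  next
    case False
    have "act (e k) (act (f j) u) = act (f j) (act (e k) u)"
      using act_commute[of "e k" "f j" u] bracket_e_f[of k j] R_F False by simp
    moreover have "E k (F j w) = F j (E k w)" using E_F_wt[of k j w] R_F False by simp
    ultimately show ?thesis using FE by (simp only:)
  qed
next
  case (R_add w u w' u')
  then show ?case using R.R_add[OF R_add.IH(1)[OF R_add.prems] R_add.IH(2)[OF R_add.prems]] by (simp only: act_add_right E_linear)
next
  case (R_scale w u a)
  then show ?case using R.R_scale[OF R_scale.IH[OF R_scale.prems], of a] by (simp only: act_scale_right E_linear)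
qed

text \<open>The Lie algebra elements that preserve \<open>W\<close> form a subalgebra, so it
  suffices to test generators.\<close>

lemma submoduleI:
  assumes "V.subspace W" and "\<And>x u. x \<in> H \<Longrightarrow> u \<in> W \<Longrightarrow> act x u \<in> W"
    and "\<And>j u. j \<le> n \<Longrightarrow> u \<in> W \<Longrightarrow> act (e j) u \<in> W" and "\<And>j u. j \<le> n \<Longrightarrow> u \<in> W \<Longrightarrow> act (f j) u \<in> W"
  shows "submodule W"
proof -
  define X where "X = {x. \<forall>u\<in>W. act x u \<in> W}"
  have "subalgebra X"
    unfolding subalgebra_def
  proof
    show "subspace X" unfolding X_def
      using assms(1) by (auto simp: subspace_def act_add_left act_scale_left V.subspace_0 V.subspace_add V.subspace_scale)
    show "\<forall>x\<in>X. \<forall>y\<in>X. bracket x y \<in> X"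
      using assms(1) by (auto simp: X_def act_bracket V.subspace_diff)
  qed
  moreover have "H \<union> e ` {0..n} \<union> f ` {0..n} \<subseteq> X" using assms(2-4) by (auto simp: X_def)
  ultimately have "X = UNIV" using chevalley_generates unfolding generates_def by blast
  then show ?thesis using assms(1) by (auto simp: submodule_def X_def)
qed

lemma F_zero [simp]: "F j 0 = 0" and E_zero [simp]: "E j 0 = 0"
  by (auto simp: F_at E_at fun_eq_iff)

lemma Hop_zero [simp]: "Hop x 0 = 0"
  by (auto simp: Hop_def fun_eq_iff)

lemma submodule_kernel: "submodule {u. R 0 u}"
proof (rule submoduleI)
  show "V.subspace {u. R 0 u}"
  proof (rule V.subspaceI)
    show "0 \<in> {u. R 0 u}" using R_zero by simp
    show "x + y \<in> {u. R 0 u}" if "x \<in> {u. R 0 u}" "y \<in> {u. R 0 u}" for x y using R_add[of 0 x 0 y] that by simp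
    show "scaleV a x \<in> {u. R 0 u}" if "x \<in> {u. R 0 u}" for a x using R_scale[of 0 x a] that by (simp add: zero_fun_def)
  qed
qed (use R_H[of 0] R_E[of 0] R_F[of 0] in auto)

lemma submodule_range: "submodule {u. \<exists>w. R w u}"
proof (rule submoduleI)
  show "V.subspace {u. \<exists>w. R w u}"
    by (rule V.subspaceI) (use R_zero R_add R_scale in blast)+
qed (use R_H R_E R_F in blast)+

lemma range_R: "\<exists>w. R w u"
proof -
  have "{u. \<exists>w. R w u} = {0} \<or> {u. \<exists>w. R w u} = UNIV"
    using irred submodule_range unfolding irreducible_module_def by blast
  moreover have "hv \<in> {u. \<exists>w. R w u}" using R_vac by blast
  ultimately show ?thesis using hv_nz by blast
qed

section \<open>Principal grading and separation of the highest weight vector\<close>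

definition x0 where "x0 = (SOME x. x \<in> H \<and> (\<forall>j\<le>n. \<alpha> j x = 1))"

lemma x0: "x0 \<in> H" "j \<le> n \<Longrightarrow> \<alpha> j x0 = 1"
proof -
  have "\<exists>x. x \<in> H \<and> (\<forall>j\<le>n. \<alpha> j x = 1)" using ex_grading by blast
  from someI_ex[OF this] have "x0 \<in> H \<and> (\<forall>j\<le>n. \<alpha> j x0 = 1)" unfolding x0_def .
  then show "x0 \<in> H" "j \<le> n \<Longrightarrow> \<alpha> j x0 = 1" by blast+
qed

definition layer :: "nat \<Rightarrow> 'v set" where
  "layer r = {u. act x0 u = scaleV (lam x0 - of_nat r) u}"

lemma f_layer: "u \<in> layer r \<Longrightarrow> j \<le> n \<Longrightarrow> act (f j) u \<in> layer (Suc r)"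
proof -
  assume u: "u \<in> layer r" and j: "j \<le> n"
  have "act x0 (act (f j) u) = act (f j) (act x0 u) + scaleV (- \<alpha> j x0) (act (f j) u)"
    unfolding act_commute[of x0 "f j" u] bracket_H_f[OF x0(1) j] act_scale_left ..
  also have "\<dots> = act (f j) (act x0 u) - act (f j) u" using x0(2)[OF j] by simp
  also have "\<dots> = scaleV (lam x0 - of_nat r) (act (f j) u) - scaleV 1 (act (f j) u)"
    using u by (simp add: layer_def act_scale_right)
  also have "\<dots> = scaleV (lam x0 - of_nat (Suc r)) (act (f j) u)"
    unfolding V.scale_left_diff_distrib[symmetric] by (simp add: algebra_simps)
  finally show ?thesis by (simp add: layer_def)
qed

text \<open>A polynomial in the grading element, the product over s from 1 to m of its differences
  with the eigenvalues of layer s. It annihilates layers 1 to m and acts on layer 0 as m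
  factorial.\<close>

primrec kill :: "nat \<Rightarrow> 'v \<Rightarrow> 'v" where
  "kill 0 u = u"
| "kill (Suc m) u = act x0 (kill m u) - scaleV (lam x0 - of_nat (Suc m)) (kill m u)"

lemma kill_linear: "kill m (scaleV a u + u') = scaleV a (kill m u) + kill m u'"
  by (induction m) (simp_all add: act_add_right act_scale_right V.scale_right_distrib V.scale_right_diff_distrib algebra_simps)

lemma kill_mono: "kill m u = 0 \<Longrightarrow> m \<le> m' \<Longrightarrow> kill m' u = 0"
  by (induction m') (auto simp: le_Suc_eq)

lemma kill_layer: "u \<in> layer r \<Longrightarrow> kill m u = scaleV (\<Prod>s\<in>{1..m}. of_nat s - of_nat r) u"
proof (induction m)
  case (Suc m)
  define P :: complex where "P = (\<Prod>s\<in>{1..m}. of_nat s - of_nat r)"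
  have "kill (Suc m) u = scaleV (P * (lam x0 - of_nat r)) u - scaleV ((lam x0 - of_nat (Suc m)) * P) u"
    using Suc by (simp add: P_def layer_def act_scale_right)
  also have "\<dots> = scaleV (P * (of_nat (Suc m) - of_nat r)) u"
    unfolding V.scale_left_diff_distrib[symmetric] by (simp add: algebra_simps)
  also have "P * (of_nat (Suc m) - of_nat r) = (\<Prod>s\<in>{1..Suc m}. of_nat s - of_nat r)"
    unfolding P_def by (simp add: prod.nat_ivl_Suc')
  finally show ?case .
qed simp

lemma hv_not_lower: "hv \<notin> V.span (\<Union>r\<in>{1..}. layer r)"
proof
  assume "hv \<in> V.span (\<Union>r\<in>{1..}. layer r)"
  then have "\<exists>m. kill m hv = 0"
  proof (induction rule: V.span_induct_alt)
    case base
    then show ?case by (auto intro: exI[of _ 0])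
  next
    case (step a x y)
    then obtain r m where r: "1 \<le> r" "x \<in> layer r" and m: "kill m y = 0" by auto
    have "kill (max m r) x = 0"
      unfolding kill_layer[OF r(2)] using r(1) by (subst prod_zero) auto
    moreover have "kill (max m r) y = 0" using kill_mono[OF m] by simp
    ultimately have "kill (max m r) (scaleV a x + y) = 0" by (simp add: kill_linear)
    then show ?case by blast
  qed
  then obtain m where "kill m hv = 0" by blast
  moreover have "hv \<in> layer 0" using H_hv[OF x0(1)] by (simp add: layer_def)
  ultimately have "scaleV (\<Prod>s\<in>{1..m}. of_nat s) hv = 0" using kill_layer[of hv 0 m] by simp
  then show False using hv_nz by auto
qed

text \<open>Modulo lower layers a vector related to \<open>w\<close> is the vacuum coefficient of
  \<open>w\<close> times \<open>hv\<close>. With \<open>hv_not_lower\<close> this shows that 0 is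
  not related to \<open>hv\<close>, and that a Fock vector related to 0 has no vacuum
  component.\<close>

lemma R_leading: "R w u \<Longrightarrow> u - scaleV (w (sea cut)) hv \<in> V.span (\<Union>r\<in>{1..}. layer r)"
proof (induction rule: R.induct)
  case R_vac
  then show ?case by (simp add: vac_def V.span_zero)
next
  case (R_F w u j)
  have "{p. resid j (p + 1) \<and> p \<notin> beads (sea cut) \<and> p + 1 \<in> beads (sea cut)} = {}" by auto
  then have "F j w (sea cut) = 0" by (simp only: F_at sum.empty)
  have "act (f j) u' \<in> V.span (\<Union>r\<in>{1..}. layer r)" if "u' \<in> V.span (\<Union>r\<in>{1..}. layer r)" for u'
    using that
  proof (induction rule: V.span_induct_alt)
    case (step a x y)
    then have "act (f j) x \<in> (\<Union>r\<in>{1..}. layer r)" using f_layer[OF _ R_F.hyps(2)] by fastforce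
    then show ?case using step by (simp add: act_add_right act_scale_right V.span_add V.span_scale V.span_base)
  qed (simp add: V.span_zero)
  from this[OF R_F.IH] have "act (f j) (u - scaleV (w (sea cut)) hv) \<in> V.span (\<Union>r\<in>{1..}. layer r)" .
  moreover have "hv \<in> layer 0" using H_hv[OF x0(1)] by (simp add: layer_def)
  then have "act (f j) hv \<in> layer 1" using f_layer[OF _ R_F.hyps(2)] by fastforce
  then have "act (f j) hv \<in> V.span (\<Union>r\<in>{1..}. layer r)" by (intro V.span_base) auto
  ultimately have "act (f j) (u - scaleV (w (sea cut)) hv) + scaleV (w (sea cut)) (act (f j) hv) \<in> V.span (\<Union>r\<in>{1..}. layer r)"
    by (intro V.span_add V.span_scale) auto
  moreover have "act (f j) (u - scaleV (w (sea cut)) hv) + scaleV (w (sea cut)) (act (f j) hv) = act (f j) u"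
    using act_add_right[of "f j" "u - scaleV (w (sea cut)) hv" "scaleV (w (sea cut)) hv"] by (simp add: act_scale_right)
  ultimately show ?case using \<open>F j w (sea cut) = 0\<close> by simp
next
  case (R_add w u w' u')
  from V.span_add[OF R_add.IH] show ?case by (simp add: V.scale_left_distrib algebra_simps)
next
  case (R_scale w u a)
  from V.span_scale[OF R_scale.IH, of a] show ?case by (simp add: V.scale_right_diff_distrib)
qed

lemma R_zero_left: "R 0 u \<Longrightarrow> u = 0"
proof -
  assume u: "R 0 u"
  have "{u. R 0 u} = {0} \<or> {u. R 0 u} = UNIV"
    using irred submodule_kernel unfolding irreducible_module_def by blast
  moreover have "\<not> R 0 hv" using R_leading[of 0 hv] hv_not_lower by auto
  ultimately show ?thesis using u by blast
qed

text \<open>Fock vectors related to 0 have no vacuum component and are stable under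
  \<open>E\<close>. Moving each \<open>F j\<close> across the form therefore makes \<open>w\<close>
  orthogonal to the whole vacuum module, hence to itself, and positivity applies.\<close>

lemma R_zero_right: "R w 0 \<Longrightarrow> w = 0"
proof -
  assume w: "R w 0"
  have vac0: "w (sea cut) = 0" if "R w 0" for w
  proof (rule ccontr)
    assume nz: "w (sea cut) \<noteq> 0"
    have "- scaleV (w (sea cut)) hv \<in> V.span (\<Union>r\<in>{1..}. layer r)" using R_leading[OF that] by simp
    then have "scaleV (- inverse (w (sea cut))) (- scaleV (w (sea cut)) hv) \<in> V.span (\<Union>r\<in>{1..}. layer r)"
      by (rule V.span_scale)
    then show False using nz hv_not_lower by simp
  qed
  have orth: "inner u w = 0" if "u \<in> Mod cut" "R w 0" for u w
    using that
  proof (induction arbitrary: w rule: Mod.induct)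
    case Mod_vac
    have "inner (vac cut) w = (\<Sum>S\<in>{sea cut}. vac cut S * cnj (w S))"
      by (rule inner_eq) (auto simp: vac_def)
    then show ?case using vac0[OF Mod_vac] by simp
  next
    case (Mod_F u j)
    have "R (E j w) 0" using R_E[OF Mod_F.prems Mod_F.hyps(2)] by simp
    then show ?case using Mod_F.IH inner_F[OF finite_support_Mod[OF Mod_F.hyps(1)]] by simp
  next
    case (Mod_add u v)
    then show ?case
      using inner_add[OF finite_support_Mod[OF Mod_add.hyps(1)] finite_support_Mod[OF Mod_add.hyps(2)], of w]
        Mod_add.IH(1)[OF Mod_add.prems] Mod_add.IH(2)[OF Mod_add.prems] by (simp only: add_0_left)
  next
    case (Mod_scale u a)
    then show ?case by (simp add: inner_scale finite_support_Mod)
  qed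
  have "w \<in> Mod cut" using w by (rule R_Mod)
  then show "w = 0" using orth[OF _ w] by (intro inner_self_zero finite_support_Mod) auto
qed

lemma R_functional: "R w u \<Longrightarrow> R w u' \<Longrightarrow> u = u'"
  using R_diff[of w u w u'] R_zero_left[of "u - u'"] by simp

lemma R_injective: "R w u \<Longrightarrow> R w' u \<Longrightarrow> w = w'"
  using R_diff[of w u w' u] R_zero_right[of "w - w'"] by simp

section \<open>Weight spaces and the character\<close>

definition has_wt :: "('g \<Rightarrow> complex) \<Rightarrow> maya \<Rightarrow> bool" where
  "has_wt \<beta> S \<longleftrightarrow> (\<forall>x\<in>H. excess cut (pos_weight \<alpha> x) S = \<beta> x)"

lemma weight_space_iff:
  assumes "R w u"
  shows "u \<in> weight_space scaleV act H (\<lambda>x. lam x + \<beta> x) \<longleftrightarrow> (\<forall>S. w S \<noteq> 0 \<longrightarrow> has_wt \<beta> S)"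
proof -
  have "act x u = scaleV (lam x + \<beta> x) u \<longleftrightarrow> (\<forall>S. w S \<noteq> 0 \<longrightarrow> excess cut (pos_weight \<alpha> x) S = \<beta> x)" if x: "x \<in> H" for x
  proof -
    have 1: "R (Hop x w) (act x u)" using assms x by (rule R_H)
    have 2: "R (\<lambda>S. (lam x + \<beta> x) * w S) (scaleV (lam x + \<beta> x) u)" using assms by (rule R_scale)
    have "act x u = scaleV (lam x + \<beta> x) u \<longleftrightarrow> Hop x w = (\<lambda>S. (lam x + \<beta> x) * w S)"
      using 1 2 R_functional R_injective by metis
    also have "\<dots> \<longleftrightarrow> (\<forall>S. w S \<noteq> 0 \<longrightarrow> excess cut (pos_weight \<alpha> x) S = \<beta> x)"
      by (auto simp: fun_eq_iff Hop_def wt_def)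
    finally show ?thesis .
  qed
  then show ?thesis unfolding weight_space_def has_wt_def by auto
qed

text \<open>Projection to a weight passes through \<open>F j\<close> at the cost of adding alpha_j
  to the weight, so the induction must range over all weights \<open>\<beta>\<close>.\<close>

lemma has_wt_proj: "w \<in> Mod cut \<Longrightarrow> (\<lambda>S. of_bool (has_wt \<beta> S) * w S) \<in> Mod cut"
proof (induction arbitrary: \<beta> rule: Mod.induct)
  case Mod_vac
  have "(\<lambda>S. of_bool (has_wt \<beta> S) * vac cut S) = (\<lambda>S. of_bool (has_wt \<beta> (sea cut)) * vac cut S)"
    by (auto simp: vac_def fun_eq_iff)
  then show ?case by (simp only: Mod.Mod_scale[OF Mod.Mod_vac])
next
  case (Mod_F w j)
  have "has_wt (\<lambda>x. \<beta> x + \<alpha> j x) (ins p (del (p + 1) S)) \<longleftrightarrow> has_wt \<beta> S"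
    if "resid j (p + 1)" "p \<notin> beads S" "p + 1 \<in> beads S" for p S
    unfolding has_wt_def using excess_lower[OF Mod_F.hyps(2) that] by auto
  then have "(\<lambda>S. of_bool (has_wt \<beta> S) * F j w S) = F j (\<lambda>S. of_bool (has_wt (\<lambda>x. \<beta> x + \<alpha> j x) S) * w S)"
    unfolding F_at fun_eq_iff sum_distrib_left by (auto intro!: sum.cong)
  then show ?case using Mod.Mod_F[OF Mod_F.IH[of "\<lambda>x. \<beta> x + \<alpha> j x"] Mod_F.hyps(2)] by simp
next
  case (Mod_add w u)
  from Mod.Mod_add[OF Mod_add.IH(1)[of \<beta>] Mod_add.IH(2)[of \<beta>]]
  show ?case by (simp add: plus_fun_def algebra_simps)
next
  case (Mod_scale w a)
  from Mod.Mod_scale[OF Mod_scale.IH[of \<beta>], of a]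
  show ?case by (simp add: mult.left_commute)
qed

lemma finite_has_wt: "finite {S. has_wt \<beta> S}"
  using root_d cut_bounds d_in_H
  by (intro finite_subset[OF _ finite_weight[of \<alpha> d cut "\<beta> d"]]) (auto simp: has_wt_def)

text \<open>Both directions of \<open>R\<close> are used: injectivity transfers independence from
  the Fock basis, and single-valuedness transfers spanning.\<close>

theorem character_eq:
  "character scaleV act H (\<lambda>x. lam x + \<beta> x) = enat (card {S \<in> state cut ` good_lists cut. has_wt \<beta> S})"
proof -
  define G where "G = {S \<in> state cut ` good_lists cut. has_wt \<beta> S}"
  define W where "W = weight_space scaleV act H (\<lambda>x. lam x + \<beta> x)"
  have finG: "finite G" unfolding G_def by (rule finite_subset[OF _ finite_has_wt]) auto
  obtain v where v: "\<And>S. S \<in> G \<Longrightarrow> v S \<in> Mod cut" "\<And>S T. S \<in> G \<Longrightarrow> v S T \<noteq> 0 \<Longrightarrow> has_wt \<beta> T"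
    and span: "\<And>w. w \<in> Mod cut \<Longrightarrow> (\<And>T. w T \<noteq> 0 \<Longrightarrow> has_wt \<beta> T) \<Longrightarrow> \<exists>a. w = (\<lambda>T. \<Sum>S\<in>G. a S * v S T)"
    and indep: "\<And>a S. (\<And>T. (\<Sum>S\<in>G. a S * v S T) = 0) \<Longrightarrow> S \<in> G \<Longrightarrow> a S = 0"
    using Mod_weight_basis[OF cut_bounds(1,2) finite_has_wt has_wt_proj, of \<beta>] unfolding G_def by blast
  have "\<forall>S\<in>G. \<exists>u. R (v S) u" using v(1) Mod_R by blast
  from bchoice[OF this] obtain u where u: "\<And>S. S \<in> G \<Longrightarrow> R (v S) (u S)" by blast
  have zero: "a S = 0" if "(\<Sum>S\<in>G. scaleV (a S) (u S)) = 0" "S \<in> G" for a S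
  proof -
    have "R (\<lambda>T. \<Sum>S\<in>G. a S * v S T) (\<Sum>S\<in>G. scaleV (a S) (u S))" using finG u by (rule R_sum)
    then have "(\<lambda>T. \<Sum>S\<in>G. a S * v S T) = 0" using that(1) R_zero_right by simp
    then have "(\<Sum>S\<in>G. a S * v S T) = 0" for T by (simp add: fun_eq_iff)
    then show ?thesis using indep that(2) by blast
  qed
  have inj: "inj_on u G"
  proof (rule inj_onI, rule ccontr)
    fix S T assume ST: "S \<in> G" "T \<in> G" "u S = u T" "S \<noteq> T"
    have "(\<Sum>U\<in>G. scaleV ((if U = S then 1 else 0) - (if U = T then 1 else 0)) (u U))
      = (\<Sum>U\<in>G. (if U = S then u U else 0)) - (\<Sum>U\<in>G. (if U = T then u U else 0))"
      unfolding sum_subtractf[symmetric] by (intro sum.cong refl) (auto simp: V.scale_left_diff_distrib)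
    also have "\<dots> = 0" using ST finG by simp
    finally have "(if S = S then 1 else 0) - (if S = T then 1 else 0) = (0::complex)"
      using zero[of "\<lambda>U. (if U = S then 1 else 0) - (if U = T then 1 else 0)" S] ST(1) by blast
    then show False using ST(4) by simp
  qed
  have ind: "V.independent (u ` G)"
  proof (rule V.independent_if_scalars_zero)
    fix a x assume a: "(\<Sum>x\<in>u ` G. scaleV (a x) x) = 0" and x: "x \<in> u ` G"
    have "(\<Sum>S\<in>G. scaleV (a (u S)) (u S)) = 0" using a by (simp add: sum.reindex[OF inj])
    then show "a x = 0" using zero[of "\<lambda>S. a (u S)"] x by blast
  qed (use finG in auto)
  have sub: "u ` G \<subseteq> W" unfolding W_def using weight_space_iff[OF u] v(2) by blast
  have gen: "W \<subseteq> V.span (u ` G)"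
  proof
    fix y assume y: "y \<in> W"
    obtain w where w: "R w y" using range_R by blast
    then have "\<And>T. w T \<noteq> 0 \<Longrightarrow> has_wt \<beta> T" using weight_space_iff[OF w, of \<beta>] y unfolding W_def by blast
    from span[OF R_Mod[OF w] this] obtain a where a: "w = (\<lambda>T. \<Sum>S\<in>G. a S * v S T)" by blast
    have "R w (\<Sum>S\<in>G. scaleV (a S) (u S))" unfolding a using finG u by (rule R_sum)
    then have "y = (\<Sum>S\<in>G. scaleV (a S) (u S))" using R_functional[OF w] by blast
    then show "y \<in> V.span (u ` G)" by (simp add: V.span_sum V.span_scale V.span_base)
  qed
  have "V.dim W = card (u ` G)" using V.dim_unique[OF sub gen ind refl] .
  also have "\<dots> = card G" using inj by (rule card_image)
  finally have dim: "V.dim W = card G" .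
  have "\<exists>B. finite B \<and> W \<subseteq> V.span B" using gen finG by blast
  then show ?thesis unfolding character_def W_def[symmetric] dim G_def[symmetric] by simp
qed

end

lemma formal_sum_level_one:
  assumes n: "1 \<le> n"
    and affine: "affine_lie_algebra scale bracket n (cartan_matrix_C n) H h d e f \<alpha>"
    and weights: "fundamental_weights scale n H h d \<Lambda>"
    and i: "i \<le> n" and L: "is_L scale bracket n H e scaleV act (\<Lambda> i)"
    and kc: "snd kc \<in> letters n" "C_fock.pos_of n kc = 2 * int n - int i - 1"
    and ld: "snd ld \<in> letters n" "C_fock.pos_of n ld = int i - 1"
  shows "has_formal_sum scale H (F_gt n kc ld) (pair_weight n \<alpha>)
           (exp_neg_times (\<Lambda> i) (character scaleV act H))"
proof -
  interpret affine_lie_algebra scale bracket n "cartan_matrix_C n" H h d e f \<alpha> by (rule affine)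
  from L interpret lie_module scale bracket scaleV act by (simp add: is_L_def)
  from L obtain v where v: "v \<noteq> 0" "\<forall>j\<le>n. act (e j) v = 0" "\<forall>x\<in>H. act x v = scaleV (\<Lambda> i x) v"
    and irr: irreducible_module
    by (auto simp: is_L_def)
  interpret C_highest_weight scale bracket n H h d e f \<alpha> scaleV act i "\<Lambda> i" v
    by unfold_locales (use n i v irr weights in \<open>auto simp: fundamental_weights_def\<close>)
  have F_gt: "F_gt n kc ld = encode kc ld ` good_lists cut"
    using kc ld by (intro F_gt_eq) (auto simp: cut_def)
  show ?thesis
    unfolding has_formal_sum_def
  proof (intro allI impI conjI)
    fix \<beta>
    define G where "G = {p \<in> good_lists cut. has_wt \<beta> (state cut p)}"
    have eq: "{s \<in> F_gt n kc ld. \<forall>x\<in>H. pair_weight n \<alpha> s x = \<beta> x} = encode kc ld ` G"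
    proof -
      have "(\<forall>x\<in>H. pair_weight n \<alpha> (encode kc ld p) x = \<beta> x) \<longleftrightarrow> has_wt \<beta> (state cut p)"
        if "p \<in> good_lists cut" for p
        by (simp add: pair_weight_encode[OF that] has_wt_def)
      then show ?thesis unfolding F_gt G_def by blast
    qed
    have states: "state cut ` G = {S \<in> state cut ` good_lists cut. has_wt \<beta> S}"
      by (auto simp: G_def)
    have inj: "inj_on (state cut) G" using inj_on_state by (rule inj_on_subset) (auto simp: G_def)
    have "finite (state cut ` G)" unfolding states by (rule finite_subset[OF _ finite_has_wt]) auto
    then have "finite G" using inj by (rule finite_imageD)
    then show "finite {s \<in> F_gt n kc ld. \<forall>x\<in>H. pair_weight n \<alpha> s x = \<beta> x}" unfolding eq by simp
    have "card (encode kc ld ` G) = card G" by (rule card_image[OF inj_on_subset[OF inj_encode subset_UNIV]])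
    also have "\<dots> = card (state cut ` G)" using inj by (simp add: card_image)
    finally show "exp_neg_times (\<Lambda> i) (character scaleV act H) \<beta>
        = enat (card {s \<in> F_gt n kc ld. \<forall>x\<in>H. pair_weight n \<alpha> s x = \<beta> x})"
      unfolding eq exp_neg_times_def character_eq states by simp
  qed
qed

theorem theorem1p12:
  fixes scale :: "complex \<Rightarrow> 'g::ab_group_add \<Rightarrow> 'g"
    and bracket :: "'g \<Rightarrow> 'g \<Rightarrow> 'g"
    and n :: nat
    and H :: "'g set"
    and h :: "nat \<Rightarrow> 'g"
    and d :: 'g
    and e f :: "nat \<Rightarrow> 'g"
    and \<alpha> \<Lambda> :: "nat \<Rightarrow> 'g \<Rightarrow> complex"
    and scaleV :: "complex \<Rightarrow> 'v::ab_group_add \<Rightarrow> 'v"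
  assumes "n \<ge> 1"
    and "affine_lie_algebra scale bracket n (cartan_matrix_C n) H h d e f \<alpha>"
    and "fundamental_weights scale n H h d \<Lambda>"
  shows "(\<forall>act. is_L scale bracket n H e scaleV act (\<Lambda> 0) \<longrightarrow>
            has_formal_sum scale H (F_gt n (0, Bar 1) (- 1, Bar 1)) (pair_weight n \<alpha>)
              (exp_neg_times (\<Lambda> 0) (character scaleV act H))) \<and>
         (\<forall>i\<in>{1..n}. \<forall>act. is_L scale bracket n H e scaleV act (\<Lambda> i) \<longrightarrow>
            has_formal_sum scale H (F_gt n (0, barred n (i + 1)) (0, Pos i)) (pair_weight n \<alpha>)
              (exp_neg_times (\<Lambda> i) (character scaleV act H)))"
proof (intro conjI allI ballI impI)
  interpret C_fock n using assms(1) by unfold_locales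
  fix act
  assume "is_L scale bracket n H e scaleV act (\<Lambda> 0)"
  then show "has_formal_sum scale H (F_gt n (0, Bar 1) (- 1, Bar 1)) (pair_weight n \<alpha>)
              (exp_neg_times (\<Lambda> 0) (character scaleV act H))"
    using assms by (intro formal_sum_level_one) (auto simp: letters_def pos_of_def)
next
  interpret C_fock n using assms(1) by unfold_locales
  fix i act
  assume i: "i \<in> {1..n}" and L: "is_L scale bracket n H e scaleV act (\<Lambda> i)"
  show "has_formal_sum scale H (F_gt n (0, barred n (i + 1)) (0, Pos i)) (pair_weight n \<alpha>)
              (exp_neg_times (\<Lambda> i) (character scaleV act H))"
    using assms i L by (intro formal_sum_level_one) (auto simp: letters_def pos_of_def barred_def)
qed

end
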